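(* Let $Y=Y_V$ be an ICCSS$(p,q)$ process with $p>q>0$ and $\Sigma_L>0$. Let $a,b\in V=\{1,\dots,k\}$ with $a\ne b$. Then the following characterisations hold: (a) The following are equivalent: (i) $Y_a$ and $Y_b$ are contemporaneously uncorrelated with respect to $Y_V$; (ii) $$e_a^\top\int_0^{\min(h,\tilde h)}\mathbf Ce^{\mathbf A(h-s)}\mathbf B\Sigma_L\mathbf B^\top e^{\mathbf A^\top(\tilde h-s)}\mathbf C^\top ds\;e_b=0\quad\text{for }0\le h,\tilde h\le1;$$ (iii) $$e_a^\top\mathbf C\mathbf A^\alpha\mathbf B\Sigma_L\mathbf B^\top(\mathbf A^\top)^\beta\mathbf C^\top e_b=0\quad\text{for }\alpha,\beta=0,\dots,kp-1.$$ (b) $Y_a$ and $Y_b$ are locally contemporaneously uncorrelated with respect to $Y_V$ if and only if $$e_a^\top\mathsf C\mathbf B\Sigma_L\mathbf B^\top\mathsf C^\top e_b=e_a^\top C_q\Sigma_LC_q^\top e_b=0.$$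
   Context: Setting. Let $k\ge1$ and let $p>q>0$ be integers. $L=(L(t))_{t\in\mathbb R}$ is a two-sided $\mathbb R^k$-valued Lévy process with $\mathbb E L(1)=0$, $\mathbb E\|L(1)\|^2<\infty$, $\Sigma_L=\mathbb E[L(1)L(1)^\top]$; $\Sigma_L>0$ means positive definite. Let $P(z)=I_kz^p+A_1z^{p-1}+\dots+A_p$ and $Q(z)=C_0+C_1z+\dots+C_qz^q$ with $A_i,C_j\in M_k(\mathbb R)$ be right coprime (the stacked $2k\times k$ matrix $\begin{pmatrix} P(z) \\ Q(z) \end{pmatrix}$ has rank $k$ for all $z\in\mathbb C$), with $\operatorname{rank}(C_q)=k$ and such that all zeros of $\det P(z)$ and of $\det Q(z)$ have strictly negative real part. Put $$\mathbf A=\begin{pmatrix} 0_k & I_k & 0_k & \cdots & 0_k \\ \vdots & & \ddots & \ddots & \vdots \\ 0_k & \cdots & \cdots & 0_k & I_k \\ -A_p & -A_{p-1} & \cdots & \cdots & -A_1 \end{pmatrix}\in M_{kp}(\mathbb R),\quad \mathbf B=\begin{pmatrix} 0_k \\ \vdots \\ 0_k \\ I_k \end{pmatrix}\in M_{kp\times k}(\mathbb R),$$ $\mathbf C=(C_0,\dots,C_q,0_k,\dots,0_k)\in M_{k\times kp}(\mathbb R)$ and $\mathsf C=(0_k,\dots,0_k,C_0,\dots,C_q)\in M_{k\times kp}(\mathbb R)$. The stationary process $Y(t)=\mathbf CX(t)$ with $X(t)=\int_{-\infty}^te^{\mathbf A(t-u)}\mathbf B\,dL(u)$, $t\in\mathbb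 R$, is the ICCSS$(p,q)$ process. $e_a\in\mathbb R^k$ is the $a$-th unit vector. $\mathcal L_{Y}(t)=\mathcal L_{Y_V}(t)$ is the closure in $L^2$ of the set of finite complex linear combinations of $Y_v(r)$, $v\in V$, $r\le t$; $P_{\mathcal L}$ is the orthogonal projection in $L^2$ onto $\mathcal L$. $Y_a$ and $Y_b$ are contemporaneously uncorrelated with respect to $Y_V$ if $$\mathbb E\big[(Y_a(t+h)-P_{\mathcal L_Y(t)}Y_a(t+h))\overline{(Y_b(t+\tilde h)-P_{\mathcal L_Y(t)}Y_b(t+\tilde h))}\big]=0\quad\text{for all }t\in\mathbb R,\ 0\le h,\tilde h\le1.$$ With $j_v$ such that $Y_v$ is $j_v$ times but not $j_v+1$ times mean-square differentiable (for an ICCSS$(p,q)$ process with $\Sigma_L>0$, $j_v=p-q-1$) and $D^{(j)}$ the mean-square derivative of order $j$, they are locally contemporaneously uncorrelated with respect to $Y_V$ if for all $t\in\mathbb R$ $$\lim_{h\downarrow0}\frac1h\mathbb E\big[(D^{(j_a)}Y_a(t+h)-P_{\mathcal L_Y(t)}D^{(j_a)}Y_a(t+h))\overline{(D^{(j_b)}Y_b(t+h)-P_{\mathcal L_Y(t)}D^{(j_b)}Y_b(t+h))}\big]=0.$$ *)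

theory Defs
  imports "HOL-Probability.Probability"
begin

section \<open>Square-integrable random variables\<close>

definition square_integrable :: "'w measure \<Rightarrow> ('w \<Rightarrow> 'b::{real_normed_vector, second_countable_topology}) \<Rightarrow> bool"
  where "square_integrable M Z \<longleftrightarrow>
    Z \<in> borel_measurable M \<and> integrable M (\<lambda>\<omega>. (norm (Z \<omega>))\<^sup>2)"

text \<open>Convergence in \<open>L\<^sup>2(M)\<close> along a filter. The nonnegative integral is used because it is
  \<open>\<infinity>\<close>, not 0, when the difference is not square integrable.\<close>

definition L2_tendsto ::
    "'w measure \<Rightarrow> ('i \<Rightarrow> 'w \<Rightarrow> 'b::real_normed_vector) \<Rightarrow> ('w \<Rightarrow> 'b) \<Rightarrow> 'i filter \<Rightarrow> bool"
  where "L2_tendsto M Zs Z F \<longleftrightarrow>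
    ((\<lambda>i. \<integral>\<^sup>+ \<omega>. ennreal ((norm (Zs i \<omega> - Z \<omega>))\<^sup>2) \<partial>M) \<longlongrightarrow> 0) F"

text \<open>Orthogonal projection in complex \<open>L\<^sup>2(M)\<close> onto \<open>S\<close>. Random variables are functions, not
  classes modulo null sets, so a version is chosen; for a linear subspace \<open>S\<close> any two versions
  agree almost surely.\<close>

definition L2_proj :: "'w measure \<Rightarrow> ('w \<Rightarrow> complex) set \<Rightarrow> ('w \<Rightarrow> complex) \<Rightarrow> 'w \<Rightarrow> complex"
  where "L2_proj M S Z = (SOME W. W \<in> S \<and>
    (\<forall>U\<in>S. integral\<^sup>L M (\<lambda>\<omega>. (Z \<omega> - W \<omega>) * cnj (U \<omega>)) = 0))"


section \<open>Two-sided L\'evy processes and integrals of deterministic functions\<close>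

definition levy_process :: "'w measure \<Rightarrow> (real \<Rightarrow> 'w \<Rightarrow> real^'k) \<Rightarrow> bool"
  where "levy_process M L \<longleftrightarrow>
    (\<forall>t. L t \<in> borel_measurable M) \<and>
    (AE \<omega> in M. L 0 \<omega> = 0) \<and>
    (\<forall>(n::nat) (t::nat \<Rightarrow> real). strict_mono t \<longrightarrow>
       prob_space.indep_vars M (\<lambda>_. borel) (\<lambda>i \<omega>. L (t (Suc i)) \<omega> - L (t i) \<omega>) {..<n}) \<and>
    (\<forall>s t h. s < t \<longrightarrow>
       distr M borel (\<lambda>\<omega>. L (t + h) \<omega> - L (s + h) \<omega>) = distr M borel (\<lambda>\<omega>. L t \<omega> - L s \<omega>)) \<and>
    (\<forall>t. \<forall>\<epsilon>>0. ((\<lambda>s. measure M {\<omega> \<in> space M. \<epsilon> < norm (L s \<omega> - L t \<omega>)}) \<longlongrightarrow> 0) (at t)) \<and>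
    (AE \<omega> in M. \<forall>t. ((\<lambda>s. L s \<omega>) \<longlongrightarrow> L t \<omega>) (at_right t) \<and>
                     (\<exists>l. ((\<lambda>s. L s \<omega>) \<longlongrightarrow> l) (at_left t)))"

text \<open>The step function \<open>\<Sum>i<n. 1_(t i, t (i+1)] \<Phi> i\<close> and its integral against \<open>L\<close>.\<close>

definition step_fun :: "nat \<Rightarrow> (nat \<Rightarrow> real) \<Rightarrow> (nat \<Rightarrow> real^'k^'m) \<Rightarrow> real \<Rightarrow> real^'k^'m"
  where "step_fun n t \<Phi> u = (\<Sum>i<n. indicator {t i<..t (Suc i)} u *\<^sub>R \<Phi> i)"

definition step_integral ::
    "(real \<Rightarrow> 'w \<Rightarrow> real^'k) \<Rightarrow> nat \<Rightarrow> (nat \<Rightarrow> real) \<Rightarrow> (nat \<Rightarrow> real^'k^'m) \<Rightarrow> 'w \<Rightarrow> real^'m"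
  where "step_integral L n t \<Phi> \<omega> = (\<Sum>i<n. \<Phi> i *v (L (t (Suc i)) \<omega> - L (t i) \<omega>))"

text \<open>\<open>J\<close> is a version of \<open>\<integral> f(u) dL(u)\<close>, the \<open>L\<^sup>2\<close>-extension of the integral of step functions.
  This is the usual integral when \<open>L\<close> is centred with finite second moments.\<close>

definition has_levy_integral ::
    "'w measure \<Rightarrow> (real \<Rightarrow> 'w \<Rightarrow> real^'k) \<Rightarrow> (real \<Rightarrow> real^'k^'m) \<Rightarrow> ('w \<Rightarrow> real^'m) \<Rightarrow> bool"
  where "has_levy_integral M L f J \<longleftrightarrow>
    square_integrable lborel f \<and> J \<in> borel_measurable M \<and>
    (\<exists>n t \<Phi>. (\<forall>j. mono (t j)) \<and>
       L2_tendsto lborel (\<lambda>j::nat. step_fun (n j) (t j) (\<Phi> j)) f sequentially \<and>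
       L2_tendsto M (\<lambda>j::nat. step_integral L (n j) (t j) (\<Phi> j)) J sequentially)"

definition second_moment :: "'w measure \<Rightarrow> ('w \<Rightarrow> real^'k) \<Rightarrow> real^'k^'k"
  where "second_moment M Z = (\<chi> i j. integral\<^sup>L M (\<lambda>\<omega>. Z \<omega> $ i * Z \<omega> $ j))"

definition pos_def :: "real^'n^'n \<Rightarrow> bool"
  where "pos_def S \<longleftrightarrow> transpose S = S \<and> (\<forall>x. x \<noteq> 0 \<longrightarrow> 0 < x \<bullet> (S *v x))"


section \<open>Matrices\<close>

text \<open>The class operations \<open>*\<close>, \<open>^\<close> on \<open>real^'n^'n\<close> are componentwise, hence explicit powers.\<close>

primrec mat_pow :: "real^'n^'n \<Rightarrow> nat \<Rightarrow> real^'n^'n"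
  where
    "mat_pow X 0 = mat 1"
  | "mat_pow X (Suc n) = X ** mat_pow X n"

definition mat_exp :: "real^'n^'n \<Rightarrow> real^'n^'n"
  where "mat_exp X = (\<Sum>n. (1 / fact n) *\<^sub>R mat_pow X n)"

text \<open>Coefficient sequences: \<open>A i\<close> is used for \<open>1 \<le> i \<le> p\<close> and \<open>C j\<close> for \<open>j \<le> q\<close>.\<close>

definition P_poly :: "nat \<Rightarrow> (nat \<Rightarrow> real^'k^'k) \<Rightarrow> complex \<Rightarrow> complex^'k^'k"
  where "P_poly p A z = mat (z ^ p) +
    (\<Sum>i=1..p. map_matrix (\<lambda>x. complex_of_real x * z ^ (p - i)) (A i))"

definition Q_poly :: "nat \<Rightarrow> (nat \<Rightarrow> real^'k^'k) \<Rightarrow> complex \<Rightarrow> complex^'k^'k"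
  where "Q_poly q C z = (\<Sum>j\<le>q. map_matrix (\<lambda>x. complex_of_real x * z ^ j) (C j))"

definition stack :: "'a^'n^'k \<Rightarrow> 'a^'n^'l \<Rightarrow> 'a^'n^('k + 'l)"
  where "stack X Y = (\<chi> r. case r of Inl i \<Rightarrow> X $ i | Inr i \<Rightarrow> Y $ i)"

definition right_coprime :: "(complex \<Rightarrow> complex^'k^'k) \<Rightarrow> (complex \<Rightarrow> complex^'k^'k) \<Rightarrow> bool"
  where "right_coprime P Q \<longleftrightarrow> (\<forall>z. rank (stack (P z) (Q z)) = CARD('k))"

text \<open>Block matrices. The \<open>kp\<close> coordinates are indexed by \<open>'p \<times> 'k\<close> with \<open>p = CARD('p)\<close>: the
  pair \<open>(i, a)\<close> is coordinate \<open>a\<close> of block \<open>i\<close>, and the blocks are numbered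
  \<open>0, \<dots>, p - 1\<close> along the linear order of \<open>'p\<close>.\<close>

definition blk :: "'p::{finite, linorder} \<Rightarrow> nat"
  where "blk i = card {..<i}"

definition bA :: "(nat \<Rightarrow> real^'k^'k) \<Rightarrow> real^('p::{finite, linorder} \<times> 'k)^('p \<times> 'k)"
  where "bA A = (\<chi> r c. let i = blk (fst r); j = blk (fst c) in
    if i = CARD('p) - 1 then - (A (CARD('p) - j) $ snd r $ snd c)
    else if j = i + 1 then mat 1 $ snd r $ snd c
    else 0)"

definition bB :: "real^'k^('p::{finite, linorder} \<times> 'k)"
  where "bB = (\<chi> r c. if blk (fst r) = CARD('p) - 1 then mat 1 $ snd r $ c else 0)"

text \<open>\<open>bC\<close> is \<open>(C\<^sub>0, \<dots>, C\<^sub>q, 0, \<dots>, 0)\<close> and \<open>sC\<close> is \<open>(0, \<dots>, 0, C\<^sub>0, \<dots>, C\<^sub>q)\<close>; in the latter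
  \<open>C\<^sub>0\<close> sits in block \<open>p - 1 - q\<close>.\<close>

definition bC :: "nat \<Rightarrow> (nat \<Rightarrow> real^'k^'k) \<Rightarrow> real^('p::{finite, linorder} \<times> 'k)^'k"
  where "bC q C = (\<chi> r c. let j = blk (fst c) in
    if j \<le> q then C j $ r $ snd c else 0)"

definition sC :: "nat \<Rightarrow> (nat \<Rightarrow> real^'k^'k) \<Rightarrow> real^('p::{finite, linorder} \<times> 'k)^'k"
  where "sC q C = (\<chi> r c. let j = blk (fst c) in
    if CARD('p) - 1 - q \<le> j then C (j - (CARD('p) - 1 - q)) $ r $ snd c else 0)"


section \<open>ICCSS processes\<close>

text \<open>\<open>X t\<close> may be any version of the stochastic integral, which is only determined almost surely.\<close>

definition ICCSS ::
    "'w measure \<Rightarrow> (real \<Rightarrow> 'w \<Rightarrow> real^'k) \<Rightarrow> nat \<Rightarrow> nat \<Rightarrow> (nat \<Rightarrow> real^'k^'k) \<Rightarrow>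
     (nat \<Rightarrow> real^'k^'k) \<Rightarrow> (real \<Rightarrow> 'w \<Rightarrow> real^('p::{finite, linorder} \<times> 'k)) \<Rightarrow>
     (real \<Rightarrow> 'w \<Rightarrow> real^'k) \<Rightarrow> bool"
  where "ICCSS M L p q A C X Y \<longleftrightarrow>
    prob_space M \<and> levy_process M L \<and>
    square_integrable M (L 1) \<and> integral\<^sup>L M (L 1) = 0 \<and>
    p = CARD('p) \<and> 0 < q \<and> q < p \<and>
    right_coprime (P_poly p A) (Q_poly q C) \<and>
    rank (C q) = CARD('k) \<and>
    (\<forall>z. det (P_poly p A z) = 0 \<longrightarrow> Re z < 0) \<and>
    (\<forall>z. det (Q_poly q C z) = 0 \<longrightarrow> Re z < 0) \<and>
    (\<forall>t. has_levy_integral M L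
           (\<lambda>u. indicator {..t} u *\<^sub>R (mat_exp ((t - u) *\<^sub>R bA A) ** bB)) (X t)) \<and>
    (\<forall>t. \<forall>\<omega>\<in>space M. Y t \<omega> = bC q C *v X t \<omega>)"


section \<open>Contemporaneous uncorrelatedness\<close>

definition comp_proc :: "(real \<Rightarrow> 'w \<Rightarrow> real^'k) \<Rightarrow> 'k \<Rightarrow> real \<Rightarrow> 'w \<Rightarrow> complex"
  where "comp_proc Y v t \<omega> = complex_of_real (Y t \<omega> $ v)"

text \<open>\<open>lin_past Y t\<close>: finite complex linear combinations of \<open>Y\<^sub>v(r)\<close>, \<open>r \<le> t\<close>;
  \<open>past M Y t\<close>: their closure in \<open>L\<^sup>2\<close>.\<close>

definition lin_past :: "(real \<Rightarrow> 'w \<Rightarrow> real^'k) \<Rightarrow> real \<Rightarrow> ('w \<Rightarrow> complex) set"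
  where "lin_past Y t = {Z. \<exists>F c. finite F \<and> F \<subseteq> UNIV \<times> {..t} \<and>
    Z = (\<lambda>\<omega>. \<Sum>(v, r)\<in>F. c v r * comp_proc Y v r \<omega>)}"

definition past :: "'w measure \<Rightarrow> (real \<Rightarrow> 'w \<Rightarrow> real^'k) \<Rightarrow> real \<Rightarrow> ('w \<Rightarrow> complex) set"
  where "past M Y t = {Z. square_integrable M Z \<and>
    (\<exists>W. (\<forall>n::nat. W n \<in> lin_past Y t) \<and> L2_tendsto M W Z sequentially)}"

definition resid ::
    "'w measure \<Rightarrow> (real \<Rightarrow> 'w \<Rightarrow> real^'k) \<Rightarrow> real \<Rightarrow> ('w \<Rightarrow> complex) \<Rightarrow> 'w \<Rightarrow> complex"
  where "resid M Y t Z \<omega> = Z \<omega> - L2_proj M (past M Y t) Z \<omega>"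

definition contemp_uncorrelated ::
    "'w measure \<Rightarrow> (real \<Rightarrow> 'w \<Rightarrow> real^'k) \<Rightarrow> 'k \<Rightarrow> 'k \<Rightarrow> bool"
  where "contemp_uncorrelated M Y a b \<longleftrightarrow>
    (\<forall>t h h'. 0 \<le> h \<and> h \<le> 1 \<and> 0 \<le> h' \<and> h' \<le> 1 \<longrightarrow>
      integral\<^sup>L M (\<lambda>\<omega>. resid M Y t (comp_proc Y a (t + h)) \<omega> *
                       cnj (resid M Y t (comp_proc Y b (t + h')) \<omega>)) = 0)"

text \<open>\<open>has_ms_deriv M j Z D\<close>: the process \<open>D\<close> is a version of the mean-square derivative of
  order \<open>j\<close> of \<open>Z\<close>.\<close>

primrec has_ms_deriv ::
    "'w measure \<Rightarrow> nat \<Rightarrow> (real \<Rightarrow> 'w \<Rightarrow> complex) \<Rightarrow> (real \<Rightarrow> 'w \<Rightarrow> complex) \<Rightarrow> bool"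
  where
    "has_ms_deriv M 0 Z D \<longleftrightarrow> D = Z"
  | "has_ms_deriv M (Suc j) Z D \<longleftrightarrow> (\<exists>W. has_ms_deriv M j Z W \<and>
      (\<forall>t. square_integrable M (D t) \<and>
        L2_tendsto M (\<lambda>h \<omega>. (W (t + h) \<omega> - W t \<omega>) / complex_of_real h) (D t) (at 0)))"

definition ms_deriv ::
    "'w measure \<Rightarrow> nat \<Rightarrow> (real \<Rightarrow> 'w \<Rightarrow> complex) \<Rightarrow> real \<Rightarrow> 'w \<Rightarrow> complex"
  where "ms_deriv M j Z = (SOME D. has_ms_deriv M j Z D)"

text \<open>The unique \<open>j\<close> such that \<open>Z\<close> is \<open>j\<close> times but not \<open>j + 1\<close> times mean-square
  differentiable; meaningful only if such a \<open>j\<close> exists.\<close>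

definition ms_order :: "'w measure \<Rightarrow> (real \<Rightarrow> 'w \<Rightarrow> complex) \<Rightarrow> nat"
  where "ms_order M Z = (THE j. (\<exists>D. has_ms_deriv M j Z D) \<and> \<not> (\<exists>D. has_ms_deriv M (Suc j) Z D))"

definition top_deriv ::
    "'w measure \<Rightarrow> (real \<Rightarrow> 'w \<Rightarrow> real^'k) \<Rightarrow> 'k \<Rightarrow> real \<Rightarrow> 'w \<Rightarrow> complex"
  where "top_deriv M Y v = ms_deriv M (ms_order M (comp_proc Y v)) (comp_proc Y v)"

definition locally_contemp_uncorrelated ::
    "'w measure \<Rightarrow> (real \<Rightarrow> 'w \<Rightarrow> real^'k) \<Rightarrow> 'k \<Rightarrow> 'k \<Rightarrow> bool"
  where "locally_contemp_uncorrelated M Y a b \<longleftrightarrow>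
    (\<forall>t. ((\<lambda>h. integral\<^sup>L M (\<lambda>\<omega>. resid M Y t (top_deriv M Y a (t + h)) \<omega> *
                                cnj (resid M Y t (top_deriv M Y b (t + h)) \<omega>))
               / complex_of_real h) \<longlongrightarrow> 0) (at_right 0))"

end

theory Submission
  imports Defs "HOL-Computational_Algebra.Fundamental_Theorem_Algebra"
begin

text \<open>By the isometry of the stochastic integral, the state process \<open>X\<close> has an explicit
  covariance, and \<open>x \<bullet> X (t + h)\<close> splits into \<open>flow h x \<bullet> X t\<close> plus a noise term that is orthogonal
  to \<open>X r\<close> for \<open>r \<le> t\<close>. Once \<open>X t\<close> is known to lie in the closed linear past of \<open>Y\<close>, the residuals
  are exactly these noise terms: their covariances are the integrals in (a)(ii), the quotient by \<open>h\<close>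
  has the limit in (b), and (a)(iii) follows by differentiating at 0 and, conversely, because the
  powers of a matrix applied to a vector are spanned by the first ones.

  That \<open>X t\<close> lies in the past is shown by duality. A bounded functional that vanishes on the past
  turns \<open>X s\<close>, \<open>s \<le> t\<close>, into a bounded solution of \<open>Q(d/ds) f = 0\<close> on a left half line; an
  eigenvector of the corresponding matrix yields \<open>v \<noteq> 0\<close> with \<open>Q(z) v = 0\<close>, so \<open>Re z < 0\<close> and the
  solution grows as \<open>s\<close> tends to minus infinity unless it is zero.\<close>


subsection \<open>Square-integrable functions\<close>

text \<open>A direct proof would recover \<open>X\<close> from \<open>Y\<close> by differentiating
  \<open>p - q - 1\<close> times and then solving a stable equation driven by \<open>Y\<close>, with
  integrals of square-integrable processes over an infinite past. Applying a bounded functional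
  first leaves a deterministic ODE in finite dimension. The obstacle is that \<open>X\<close> itself
  is not mean-square differentiable: only the directions \<open>c\<close> with
  \<open>c v* bB = 0\<close> are. The remedy comes from the outputs: their derivatives up to order
  \<open>p - q - 1\<close> vanish under the functional, the last of them saying that
  \<open>sC\<close> annihilates its vector of values on \<open>X\<close>. These k equations permit
  replacing that vector by its image under a projection all of whose rows kill the noise input, and
  what remains is the dynamics of \<open>Q\<close> in companion form.

  A second theme is the choice of versions. Projections and mean-square derivatives are picked by
  \<open>SOME\<close>, so they are never computed: an explicit candidate is shown to qualify, and
  uniqueness up to null sets identifies the choice with it.

  Moments are assumed for \<open>L 1\<close> only; independence and stationarity carry them over to
  all increments.\<close>

lemma L2_measurable [measurable_dest]:
  "square_integrable M Z \<Longrightarrow> Z \<in> borel_measurable M"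
  by (simp add: square_integrable_def)

lemma L2D: "square_integrable M Z \<Longrightarrow> integrable M (\<lambda>w. (norm (Z w))\<^sup>2)"
  by (simp add: square_integrable_def)

lemma L2_bound:
  assumes "square_integrable M Z" "W \<in> borel_measurable M" "\<And>w. w \<in> space M \<Longrightarrow> norm (W w) \<le> norm (Z w)"
  shows "square_integrable M W"
proof -
  have "integrable M (\<lambda>w. (norm (W w))\<^sup>2)"
    by (rule Bochner_Integration.integrable_bound[OF L2D[OF assms(1)]])
      (use assms in \<open>auto intro!: power_mono AE_I2\<close>)
  with assms(2) show ?thesis by (simp add: square_integrable_def)
qed

lemma L2_AE_cong:
  assumes "square_integrable M Z" "W \<in> borel_measurable M" "AE w in M. W w = Z w"
  shows "square_integrable M W"
proof -
  have [measurable]: "Z \<in> borel_measurable M"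
    using assms(1) by (rule L2_measurable)
  note [measurable] = assms(2)
  have "integrable M (\<lambda>w. (norm (W w))\<^sup>2) \<longleftrightarrow> integrable M (\<lambda>w. (norm (Z w))\<^sup>2)"
    by (rule integrable_cong_AE) (use assms(3) in auto)
  then show ?thesis
    using assms(1,2) by (simp add: square_integrable_def)
qed

lemma norm_add_power2_le: "(norm (x + y))\<^sup>2 \<le> 2 * (norm x)\<^sup>2 + 2 * (norm (y::'a::real_normed_vector))\<^sup>2"
proof -
  have "(norm (x + y))\<^sup>2 \<le> (norm x + norm y)\<^sup>2"
    by (rule power_mono[OF norm_triangle_ineq]) simp
  also have "\<dots> \<le> 2 * (norm x)\<^sup>2 + 2 * (norm y)\<^sup>2"
    using sum_squares_bound[of "norm x" "norm y"] by (simp add: power2_sum)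
  finally show ?thesis .
qed

lemma L2_add:
  assumes "square_integrable M Z" "square_integrable M W"
  shows "square_integrable M (\<lambda>w. Z w + W w)"
proof -
  have [measurable]: "Z \<in> borel_measurable M" "W \<in> borel_measurable M"
    using assms by (auto dest: L2_measurable)
  have "integrable M (\<lambda>w. (norm (Z w + W w))\<^sup>2)"
  proof (rule Bochner_Integration.integrable_bound)
    show "integrable M (\<lambda>w. 2 * (norm (Z w))\<^sup>2 + 2 * (norm (W w))\<^sup>2)"
      using L2D[OF assms(1)] L2D[OF assms(2)] by simp
  qed (auto intro!: AE_I2 simp: norm_add_power2_le)
  then show ?thesis by (simp add: square_integrable_def)
qed

lemma L2_scaleR:
  assumes "square_integrable M Z"
  shows "square_integrable M (\<lambda>w. c *\<^sub>R Z w)"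
proof -
  have [measurable]: "Z \<in> borel_measurable M"
    using assms by (rule L2_measurable)
  show ?thesis
    using L2D[OF assms] by (simp add: square_integrable_def power_mult_distrib)
qed

lemma L2_mult_left:
  fixes Z :: "'w \<Rightarrow> 'b::{real_normed_div_algebra, second_countable_topology}"
  assumes "square_integrable M Z"
  shows "square_integrable M (\<lambda>w. c * Z w)"
proof -
  have [measurable]: "Z \<in> borel_measurable M"
    using assms by (rule L2_measurable)
  show ?thesis
    using L2D[OF assms]
    by (simp add: square_integrable_def norm_mult power_mult_distrib)
qed

lemma L2_zero [simp]: "square_integrable M (\<lambda>_. 0)"
  by (simp add: square_integrable_def)

lemma L2_uminus:
  "square_integrable M Z \<Longrightarrow> square_integrable M (\<lambda>w. - Z w)"
  using L2_scaleR[of M Z "-1"] by simp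

lemma L2_diff:
  assumes "square_integrable M Z" "square_integrable M W"
  shows "square_integrable M (\<lambda>w. Z w - W w)"
  using L2_add[OF assms(1) L2_uminus[OF assms(2)]] by simp

lemma L2_sum:
  "(\<And>i. i \<in> I \<Longrightarrow> square_integrable M (Z i)) \<Longrightarrow> square_integrable M (\<lambda>w. \<Sum>i\<in>I. Z i w)"
  by (induction I rule: infinite_finite_induct) (auto intro: L2_add)

lemma L2_of_real_iff:
  "square_integrable M (\<lambda>w. complex_of_real (Z w)) \<longleftrightarrow> square_integrable M Z"
proof -
  have "Z \<in> borel_measurable M"
    if "(\<lambda>w. complex_of_real (Z w)) \<in> borel_measurable M"
    using measurable_compose[OF that borel_measurable_Re] by (simp only: Re_complex_of_real)
  moreover have "(\<lambda>w. complex_of_real (Z w)) \<in> borel_measurable M"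
    if "Z \<in> borel_measurable M"
    using that by measurable
  ultimately have "(\<lambda>w. complex_of_real (Z w)) \<in> borel_measurable M \<longleftrightarrow> Z \<in> borel_measurable M"
    by blast
  then show ?thesis by (simp add: square_integrable_def)
qed

lemma L2_norm:
  "square_integrable M Z \<Longrightarrow> square_integrable M (\<lambda>w. norm (Z w))"
  by (auto simp: square_integrable_def)

lemma (in finite_measure) L2_const: "square_integrable M (\<lambda>_. c)"
  by (simp add: square_integrable_def)

lemma L2_component:
  fixes Z :: "'w \<Rightarrow> real^'n"
  assumes "square_integrable M Z"
  shows "square_integrable M (\<lambda>w. Z w $ i)"
proof (rule L2_bound[OF assms])
  have [measurable]: "Z \<in> borel_measurable M"
    using assms by (rule L2_measurable)
  show "(\<lambda>w. Z w $ i) \<in> borel_measurable M"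
    by (rule measurable_compose[OF _ borel_measurable_continuous_onI]) (auto intro!: continuous_intros)
qed (simp add: component_le_norm_cart)

lemma L2_power2_iff:
  "square_integrable M Z \<longleftrightarrow> Z \<in> borel_measurable M \<and> integrable M (\<lambda>w. (Z w :: real)\<^sup>2)"
  by (simp add: square_integrable_def)

section \<open>Products and the Cauchy-Schwarz inequality\<close>

lemma L2_times:
  fixes Z W :: "'w \<Rightarrow> 'b::{real_normed_div_algebra, second_countable_topology, banach}"
  assumes "square_integrable M Z" "square_integrable M W"
  shows "integrable M (\<lambda>w. Z w * W w)"
proof (rule Bochner_Integration.integrable_bound)
  have [measurable]: "Z \<in> borel_measurable M" "W \<in> borel_measurable M"
    using assms by (auto dest: L2_measurable)
  show "(\<lambda>w. Z w * W w) \<in> borel_measurable M" by measurable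
  show "integrable M (\<lambda>w. (norm (Z w))\<^sup>2 + (norm (W w))\<^sup>2)"
    using assms by (auto dest: L2D)
  have "norm z * norm w \<le> (norm z)\<^sup>2 + (norm w)\<^sup>2" for z w :: 'b
    using sum_squares_bound[of "norm z" "norm w"] mult_nonneg_nonneg[OF norm_ge_zero norm_ge_zero, of z w]
    by linarith
  then show "AE w in M. norm (Z w * W w) \<le> norm ((norm (Z w))\<^sup>2 + (norm (W w))\<^sup>2)"
    by (intro AE_I2) (simp add: norm_mult)
qed

lemma L2_cnj:
  "square_integrable M Z \<Longrightarrow> square_integrable M (\<lambda>w. cnj (Z w))"
  unfolding square_integrable_def
  by (auto intro: measurable_compose[OF _ borel_measurable_continuous_onI] continuous_intros)

lemma (in finite_measure) L2_imp_integrable: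
  fixes Z :: "'a \<Rightarrow> real"
  shows "square_integrable M Z \<Longrightarrow> integrable M Z"
  using L2_times[OF L2_const[of 1], of Z] by simp

text \<open>The integral of \<open>(Z - t W)^2\<close> is a nonnegative quadratic polynomial in
  \<open>t\<close>; its value at the minimiser \<open>b / c\<close> gives the bound.\<close>

lemma Cauchy_Schwarz_integral:
  fixes Z W :: "'w \<Rightarrow> real"
  assumes Z: "square_integrable M Z" and W: "square_integrable M W"
  shows "(LINT w|M. Z w * W w)\<^sup>2 \<le> (LINT w|M. (Z w)\<^sup>2) * (LINT w|M. (W w)\<^sup>2)"
proof -
  define a b c where "a = (LINT w|M. (Z w)\<^sup>2)" and "b = (LINT w|M. Z w * W w)"
    and "c = (LINT w|M. (W w)\<^sup>2)"
  have q: "0 \<le> a - 2 * t * b + t\<^sup>2 * c" for t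
  proof -
    have "0 \<le> (LINT w|M. (Z w - t * W w)\<^sup>2)" by simp
    also have "\<dots> = (LINT w|M. (Z w)\<^sup>2 - 2 * t * (Z w * W w) + t\<^sup>2 * (W w)\<^sup>2)"
      by (simp add: power2_diff power_mult_distrib algebra_simps)
    also have "\<dots> = a - 2 * t * b + t\<^sup>2 * c"
      using L2_times[OF Z W] L2D[OF Z] L2D[OF W]
      by (simp add: a_def b_def c_def)
    finally show ?thesis .
  qed
  have "c \<ge> 0" by (simp add: c_def)
  have "b\<^sup>2 \<le> a * c"
  proof (cases "c = 0")
    case True
    have "b = 0"
    proof (rule ccontr)
      assume "b \<noteq> 0"
      \<comment> \<open>For \<open>c = 0\<close> the polynomial is affine, and at
        \<open>t = (a + 1) / b\<close> it would take the negative value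
        \<open>- a - 2\<close>.\<close>
      then have "2 * ((a + 1) / b) * b = 2 * (a + 1)" by simp
      with q[of "(a + 1) / b"] True have "0 \<le> a - 2 * (a + 1)" by simp
      moreover have "a \<ge> 0" by (simp add: a_def)
      ultimately show False by simp
    qed
    then show ?thesis by (simp add: True)
  next
    case False
    with \<open>c \<ge> 0\<close> have "c > 0" by simp
    with q[of "b / c"] show ?thesis by (simp add: field_simps power2_eq_square)
  qed
  then show ?thesis by (simp add: a_def b_def c_def)
qed

lemma integral_mult_le_sqrt:
  fixes Z W :: "'w \<Rightarrow> real"
  assumes "square_integrable M Z" "square_integrable M W"
  shows "\<bar>LINT w|M. Z w * W w\<bar> \<le> sqrt (LINT w|M. (Z w)\<^sup>2) * sqrt (LINT w|M. (W w)\<^sup>2)"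
  using real_sqrt_le_mono[OF Cauchy_Schwarz_integral[OF assms]] by (simp add: real_sqrt_mult)

lemma norm_integral_mult_le_sqrt:
  fixes Z W :: "'w \<Rightarrow> complex"
  assumes Z: "square_integrable M Z" and W: "square_integrable M W"
  shows "norm (LINT w|M. Z w * W w) \<le>
    sqrt (LINT w|M. (norm (Z w))\<^sup>2) * sqrt (LINT w|M. (norm (W w))\<^sup>2)"
proof -
  have "norm (LINT w|M. Z w * W w) \<le> (LINT w|M. norm (Z w) * norm (W w))"
    using integral_norm_bound[of M "\<lambda>w. Z w * W w"] by (simp add: norm_mult)
  also have "\<dots> \<le> sqrt (LINT w|M. (norm (Z w))\<^sup>2) * sqrt (LINT w|M. (norm (W w))\<^sup>2)"
    using integral_mult_le_sqrt[OF L2_norm[OF Z] L2_norm[OF W]]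
    by linarith
  finally show ?thesis .
qed

section \<open>Convergence in mean square\<close>

lemma nn_integral_norm_power2:
  "square_integrable M Z \<Longrightarrow>
    (\<integral>\<^sup>+ w. ennreal ((norm (Z w))\<^sup>2) \<partial>M) = ennreal (LINT w|M. (norm (Z w))\<^sup>2)"
  by (rule nn_integral_eq_integral) (auto dest: L2D)

lemma L2_tendsto_iff_integral:
  assumes "\<And>i. square_integrable M (\<lambda>w. Zs i w - Z w)"
  shows "L2_tendsto M Zs Z F \<longleftrightarrow> ((\<lambda>i. LINT w|M. (norm (Zs i w - Z w))\<^sup>2) \<longlongrightarrow> 0) F"
  unfolding L2_tendsto_def nn_integral_norm_power2[OF assms]
  by (subst ennreal_0[symmetric], rule tendsto_ennreal_iff) auto

text \<open>Distances are nonnegative integrals, so convergence to 0 forces \<open>Z\<close> to lie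
  at finite distance from some \<open>Zs i\<close>; square integrability of the limit need not be
  assumed.\<close>

lemma L2_tendsto_square_integrable:
  assumes lim: "L2_tendsto M Zs Z F" and "F \<noteq> bot"
    and Zs: "\<And>i. square_integrable M (Zs i)" and [measurable]: "Z \<in> borel_measurable M"
  shows "square_integrable M Z"
proof -
  have "eventually (\<lambda>i. (\<integral>\<^sup>+ w. ennreal ((norm (Zs i w - Z w))\<^sup>2) \<partial>M) < 1) F"
    using lim unfolding L2_tendsto_def by (rule order_tendstoD) simp
  then obtain i where i: "(\<integral>\<^sup>+ w. ennreal ((norm (Zs i w - Z w))\<^sup>2) \<partial>M) < 1"
    using \<open>F \<noteq> bot\<close> eventually_happens' by blast
  have [measurable]: "Zs i \<in> borel_measurable M"
    using Zs by (rule L2_measurable)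
  have "integrable M (\<lambda>w. (norm (Zs i w - Z w))\<^sup>2)"
    by (rule integrableI_bounded) (use i in \<open>auto intro: less_trans\<close>)
  then have "square_integrable M (\<lambda>w. Zs i w - Z w)"
    by (simp add: square_integrable_def)
  from L2_diff[OF Zs[of i] this] show ?thesis by simp
qed

lemma L2_tendsto_bound:
  assumes "L2_tendsto M Zs Z F"
    and "\<And>i w. w \<in> space M \<Longrightarrow> norm (Ws i w - W w) \<le> norm (Zs i w - Z w)"
  shows "L2_tendsto M Ws W F"
  unfolding L2_tendsto_def
proof (rule tendsto_sandwich[OF _ _ tendsto_const])
  show "((\<lambda>i. \<integral>\<^sup>+ w. ennreal ((norm (Zs i w - Z w))\<^sup>2) \<partial>M) \<longlongrightarrow> 0) F"
    using assms(1) by (simp add: L2_tendsto_def)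
qed (auto intro!: always_eventually nn_integral_mono ennreal_leI power_mono assms(2))

text \<open>Joint continuity of the inner product: the difference of the products splits into three
  terms, each with a small factor, and Cauchy-Schwarz bounds them. It carries the isometry from step
  functions to their limits.\<close>

lemma L2_tendsto_integral_mult:
  fixes Z W :: "'w \<Rightarrow> real"
  assumes Z: "L2_tendsto M Zs Z F" "\<And>i. square_integrable M (Zs i)" "square_integrable M Z"
    and W: "L2_tendsto M Ws W F" "\<And>i. square_integrable M (Ws i)" "square_integrable M W"
  shows "((\<lambda>i. LINT w|M. Zs i w * Ws i w) \<longlongrightarrow> (LINT w|M. Z w * W w)) F"
proof -
  note dZ = L2_diff[OF Z(2) Z(3)] and dW = L2_diff[OF W(2) W(3)]
  have z0: "((\<lambda>i. sqrt (LINT w|M. (Zs i w - Z w)\<^sup>2)) \<longlongrightarrow> 0) F"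
    using Z(1) tendsto_real_sqrt unfolding L2_tendsto_iff_integral[OF dZ] by fastforce
  have w0: "((\<lambda>i. sqrt (LINT w|M. (Ws i w - W w)\<^sup>2)) \<longlongrightarrow> 0) F"
    using W(1) tendsto_real_sqrt unfolding L2_tendsto_iff_integral[OF dW] by fastforce
  have "((\<lambda>i. sqrt (LINT w|M. (Zs i w - Z w)\<^sup>2) * sqrt (LINT w|M. (Ws i w - W w)\<^sup>2)
      + sqrt (LINT w|M. (Zs i w - Z w)\<^sup>2) * sqrt (LINT w|M. (W w)\<^sup>2)
      + sqrt (LINT w|M. (Z w)\<^sup>2) * sqrt (LINT w|M. (Ws i w - W w)\<^sup>2)) \<longlongrightarrow>
      0 * 0 + 0 * sqrt (LINT w|M. (W w)\<^sup>2) + sqrt (LINT w|M. (Z w)\<^sup>2) * 0) F"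
    by (intro tendsto_intros z0 w0)
  then have bound0: "((\<lambda>i. sqrt (LINT w|M. (Zs i w - Z w)\<^sup>2) * sqrt (LINT w|M. (Ws i w - W w)\<^sup>2)
      + sqrt (LINT w|M. (Zs i w - Z w)\<^sup>2) * sqrt (LINT w|M. (W w)\<^sup>2)
      + sqrt (LINT w|M. (Z w)\<^sup>2) * sqrt (LINT w|M. (Ws i w - W w)\<^sup>2)) \<longlongrightarrow> 0) F"
    by simp
  have "((\<lambda>i. (LINT w|M. Zs i w * Ws i w) - (LINT w|M. Z w * W w)) \<longlongrightarrow> 0) F"
  proof (rule Lim_null_comparison[OF always_eventually bound0], rule allI)
    fix i
    have "(LINT w|M. Zs i w * Ws i w) - (LINT w|M. Z w * W w) =
      (LINT w|M. (Zs i w - Z w) * (Ws i w - W w) + (Zs i w - Z w) * W w + Z w * (Ws i w - W w))"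
      by (subst Bochner_Integration.integral_diff[symmetric])
        (auto intro!: L2_times Z W Bochner_Integration.integral_cong simp: algebra_simps)
    also have "\<dots> = (LINT w|M. (Zs i w - Z w) * (Ws i w - W w)) + (LINT w|M. (Zs i w - Z w) * W w)
        + (LINT w|M. Z w * (Ws i w - W w))"
      using L2_times[OF dZ dW] L2_times[OF dZ W(3)]
        L2_times[OF Z(3) dW] by simp
    finally show "norm ((LINT w|M. Zs i w * Ws i w) - (LINT w|M. Z w * W w))
      \<le> sqrt (LINT w|M. (Zs i w - Z w)\<^sup>2) * sqrt (LINT w|M. (Ws i w - W w)\<^sup>2)
      + sqrt (LINT w|M. (Zs i w - Z w)\<^sup>2) * sqrt (LINT w|M. (W w)\<^sup>2)
      + sqrt (LINT w|M. (Z w)\<^sup>2) * sqrt (LINT w|M. (Ws i w - W w)\<^sup>2)"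
      using integral_mult_le_sqrt[OF dZ dW, of i i] integral_mult_le_sqrt[OF dZ W(3), of i]
        integral_mult_le_sqrt[OF Z(3) dW, of i] by (simp add: abs_le_iff)
  qed
  then show ?thesis by (simp add: LIM_zero_iff)
qed

lemma L2_tendsto_AE_cong:
  assumes "\<And>i. AE w in M. Zs i w = Zs' i w" "AE w in M. Z w = Z' w"
  shows "L2_tendsto M Zs Z F \<longleftrightarrow> L2_tendsto M Zs' Z' F"
proof -
  have "(\<integral>\<^sup>+ w. ennreal ((norm (Zs i w - Z w))\<^sup>2) \<partial>M) = (\<integral>\<^sup>+ w. ennreal ((norm (Zs' i w - Z' w))\<^sup>2) \<partial>M)" for i
  proof (rule nn_integral_cong_AE)
    show "AE w in M. ennreal ((norm (Zs i w - Z w))\<^sup>2) = ennreal ((norm (Zs' i w - Z' w))\<^sup>2)"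
      using assms(1)[of i] assms(2) by eventually_elim simp
  qed
  then show ?thesis by (simp add: L2_tendsto_def)
qed

text \<open>The quadratic triangle inequality is applied under the nonnegative integral, so mere
  measurability suffices. This matters for mean-square derivatives, where the differentiated process
  is only known to be measurable.\<close>

lemma L2_tendsto_measurable_unique:
  fixes Z Z' :: "'w \<Rightarrow> 'b::{real_normed_vector, second_countable_topology}"
  assumes lim: "L2_tendsto M Zs Z F" "L2_tendsto M Zs Z' F" and "F \<noteq> bot"
    and [measurable]: "\<And>i. Zs i \<in> borel_measurable M" "Z \<in> borel_measurable M" "Z' \<in> borel_measurable M"
  shows "AE w in M. Z w = Z' w"
proof -
  let ?N = "\<lambda>i. \<integral>\<^sup>+ w. ennreal ((norm (Zs i w - Z w))\<^sup>2) \<partial>M"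
  let ?N' = "\<lambda>i. \<integral>\<^sup>+ w. ennreal ((norm (Zs i w - Z' w))\<^sup>2) \<partial>M"
  have le: "(\<integral>\<^sup>+ w. ennreal ((norm (Z w - Z' w))\<^sup>2) \<partial>M) \<le> 2 * ?N' i + 2 * ?N i" for i
  proof -
    have "(\<integral>\<^sup>+ w. ennreal ((norm (Z w - Z' w))\<^sup>2) \<partial>M) \<le>
        (\<integral>\<^sup>+ w. 2 * ennreal ((norm (Zs i w - Z' w))\<^sup>2) + 2 * ennreal ((norm (Zs i w - Z w))\<^sup>2) \<partial>M)"
    proof (rule nn_integral_mono)
      fix w
      have "(norm (Z w - Z' w))\<^sup>2 \<le> 2 * (norm (Zs i w - Z' w))\<^sup>2 + 2 * (norm (Zs i w - Z w))\<^sup>2"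
        using norm_add_power2_le[of "Zs i w - Z' w" "Z w - Zs i w"] by (simp add: norm_minus_commute)
      then show "ennreal ((norm (Z w - Z' w))\<^sup>2) \<le>
          2 * ennreal ((norm (Zs i w - Z' w))\<^sup>2) + 2 * ennreal ((norm (Zs i w - Z w))\<^sup>2)"
        by (simp add: ennreal_leI flip: ennreal_plus ennreal_mult' ennreal_numeral)
    qed
    also have "\<dots> = 2 * ?N' i + 2 * ?N i"
      by (simp add: nn_integral_add nn_integral_cmult)
    finally show ?thesis .
  qed
  have "((\<lambda>i. 2 * ?N' i + 2 * ?N i) \<longlongrightarrow> 2 * 0 + 2 * 0) F"
    using lim unfolding L2_tendsto_def by (intro tendsto_add ennreal_tendsto_cmult) auto
  then have "(\<integral>\<^sup>+ w. ennreal ((norm (Z w - Z' w))\<^sup>2) \<partial>M) \<le> 2 * 0 + 2 * 0"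
    using \<open>F \<noteq> bot\<close> le by (intro tendsto_lowerbound) auto
  then have "(\<integral>\<^sup>+ w. ennreal ((norm (Z w - Z' w))\<^sup>2) \<partial>M) = 0" by simp
  then have "AE w in M. ennreal ((norm (Z w - Z' w))\<^sup>2) = 0"
    by (subst (asm) nn_integral_0_iff_AE) auto
  then show ?thesis by eventually_elim simp
qed


subsection \<open>The matrix exponential\<close>

lemma mat_pow_Suc2: "mat_pow X (Suc n) = mat_pow X n ** X"
  by (induction n) (simp_all add: matrix_mul_assoc)

lemma mat_pow_scaleR: "mat_pow (c *\<^sub>R X) n = c ^ n *\<^sub>R mat_pow X n"
  by (induction n) (simp_all add: scalar_matrix_assoc[symmetric] matrix_scalar_ac)

lemma mat_pow_transpose: "mat_pow (transpose X) n = transpose (mat_pow X n)"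
proof (induction n)
  case (Suc n)
  then show ?case
    by (simp only: mat_pow_Suc2[of "transpose X"] mat_pow_Suc2[of X] matrix_transpose_mul)
       (simp only: mat_pow_Suc2[of "transpose X", symmetric] mat_pow.simps matrix_transpose_mul[symmetric] Suc[symmetric])
qed (simp add: transpose_mat)

lemma mat_pow_mult_vec: "mat_pow X n *v x = ((*v) X ^^ n) x"
  by (induction n) (simp_all add: matrix_vector_mul_assoc[symmetric])

lemma abs_mat_pow_le: "\<bar>mat_pow (X :: real^'n^'n) n $ i $ j\<bar> \<le> (\<Sum>i\<in>UNIV. \<Sum>j\<in>UNIV. \<bar>X $ i $ j\<bar>) ^ n"
proof (induction n arbitrary: i)
  case (Suc n)
  define c where "c = (\<Sum>i\<in>UNIV. \<Sum>j\<in>UNIV. \<bar>X $ i $ j\<bar>)"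
  have row: "(\<Sum>k\<in>UNIV. \<bar>X $ i $ k\<bar>) \<le> c"
    unfolding c_def by (rule member_le_sum) (auto intro: sum_nonneg)
  have "\<bar>mat_pow X (Suc n) $ i $ j\<bar> \<le> (\<Sum>k\<in>UNIV. \<bar>X $ i $ k * mat_pow X n $ k $ j\<bar>)"
    by (simp add: matrix_matrix_mult_def sum_abs)
  also have "\<dots> \<le> (\<Sum>k\<in>UNIV. \<bar>X $ i $ k\<bar> * c ^ n)"
    using Suc.IH by (intro sum_mono) (simp add: abs_mult mult_left_mono c_def)
  also have "\<dots> = (\<Sum>k\<in>UNIV. \<bar>X $ i $ k\<bar>) * c ^ n"
    by (simp add: sum_distrib_right)
  also have "\<dots> \<le> c * c ^ n"
    by (rule mult_right_mono[OF row]) (auto simp: c_def intro!: zero_le_power sum_nonneg)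
  finally show ?case by (simp add: c_def)
qed (simp add: mat_def)

lemma summable_mat_exp_entry:
  "summable (\<lambda>n. mat_pow (X :: real^'n^'n) n $ i $ j / fact n * t ^ n)"
proof (rule summable_comparison_test')
  define c where "c = (\<Sum>i\<in>UNIV. \<Sum>j\<in>UNIV. \<bar>X $ i $ j\<bar>)"
  show "summable (\<lambda>n. (c * \<bar>t\<bar>) ^ n / fact n)"
    using summable_exp[of "c * \<bar>t\<bar>"] by (simp add: divide_inverse mult.commute)
  show "norm (mat_pow X n $ i $ j / fact n * t ^ n) \<le> (c * \<bar>t\<bar>) ^ n / fact n" if "0 \<le> n" for n
    using mult_right_mono[OF abs_mat_pow_le[of X n i j], of "\<bar>t\<bar> ^ n"]
    by (simp add: abs_mult power_abs power_mult_distrib c_def divide_right_mono)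
qed

text \<open>Entrywise the matrix series is a real power series in \<open>t\<close>, which gives
  convergence here and termwise differentiation below.\<close>

lemma mat_exp_sums: "(\<lambda>n. (t ^ n / fact n) *\<^sub>R mat_pow X n) sums mat_exp (t *\<^sub>R (X :: real^'n^'n))"
  and mat_exp_entry: "mat_exp (t *\<^sub>R X) $ i $ j = (\<Sum>n. mat_pow X n $ i $ j / fact n * t ^ n)"
proof -
  have *: "(\<lambda>n. (t ^ n / fact n) *\<^sub>R mat_pow X n) sums
      (\<chi> i j. \<Sum>n. mat_pow X n $ i $ j / fact n * t ^ n)"
    unfolding sums_def
  proof (intro vec_tendstoI)
    fix i j
    show "(\<lambda>k. (\<Sum>n<k. (t ^ n / fact n) *\<^sub>R mat_pow X n) $ i $ j) \<longlonglongrightarrow>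
        (\<chi> i j. \<Sum>n. mat_pow X n $ i $ j / fact n * t ^ n) $ i $ j"
      using summable_LIMSEQ[OF summable_mat_exp_entry[of X i j t]] by (simp add: mult.commute)
  qed
  have eq: "mat_exp (t *\<^sub>R X) = (\<chi> i j. \<Sum>n. mat_pow X n $ i $ j / fact n * t ^ n)"
    using sums_unique[OF *] by (simp add: mat_exp_def mat_pow_scaleR)
  show "(\<lambda>n. (t ^ n / fact n) *\<^sub>R mat_pow X n) sums mat_exp (t *\<^sub>R X)"
    using * eq by simp
  show "mat_exp (t *\<^sub>R X) $ i $ j = (\<Sum>n. mat_pow X n $ i $ j / fact n * t ^ n)"
    by (simp add: eq)
qed

lemma mat_exp_zero: "mat_exp (0 :: real^'n^'n) = mat 1"
proof -
  have "mat_exp (0 *\<^sub>R 0 :: real^'n^'n) $ i $ j = mat 1 $ i $ j" for i j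
    unfolding mat_exp_entry by (subst powser_zero) simp
  then show ?thesis by (simp add: vec_eq_iff)
qed

lemma mat_exp_transpose: "mat_exp (t *\<^sub>R transpose X) = transpose (mat_exp (t *\<^sub>R X))"
  unfolding vec_eq_iff mat_exp_entry mat_pow_transpose by (simp add: transpose_def mat_exp_entry)

text \<open>The factor \<open>X\<close> can be split off a power on either side. Both forms are
  wanted: in \<open>mat_exp_add\<close> a left and a right derivative cancel.\<close>

lemma mat_exp_entry_has_derivative:
  fixes X :: "real^'n^'n"
  shows "((\<lambda>t. mat_exp (t *\<^sub>R X) $ i $ j) has_real_derivative (X ** mat_exp (t *\<^sub>R X)) $ i $ j) (at t)"
    and "((\<lambda>t. mat_exp (t *\<^sub>R X) $ i $ j) has_real_derivative (mat_exp (t *\<^sub>R X) ** X) $ i $ j) (at t)"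
proof -
  define a where "a i j n = mat_pow X n $ i $ j / fact n" for i j n
  have D: "((\<lambda>t. mat_exp (t *\<^sub>R X) $ i $ j) has_real_derivative (\<Sum>n. diffs (a i j) n * t ^ n)) (at t)"
    unfolding mat_exp_entry a_def
    by (rule termdiffs_strong_converges_everywhere) (rule summable_mat_exp_entry)
  have summ: "summable (\<lambda>n. a i j n * t ^ n)" for i j
    unfolding a_def by (rule summable_mat_exp_entry)
  have d: "diffs (a i j) n = mat_pow X (Suc n) $ i $ j / fact n" for n
    by (simp add: diffs_def a_def del: mat_pow.simps)
  have "(\<Sum>n. diffs (a i j) n * t ^ n) = (\<Sum>n. \<Sum>k\<in>UNIV. X $ i $ k * (a k j n * t ^ n))"
    unfolding d by (simp add: matrix_matrix_mult_def a_def sum_distrib_right sum_divide_distrib mult.assoc)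
  also have "\<dots> = (\<Sum>k\<in>UNIV. X $ i $ k * (\<Sum>n. a k j n * t ^ n))"
    by (subst suminf_sum) (auto intro: summable_mult summ simp: suminf_mult[OF summ])
  also have "\<dots> = (X ** mat_exp (t *\<^sub>R X)) $ i $ j"
    by (simp add: matrix_matrix_mult_def mat_exp_entry a_def)
  finally show "((\<lambda>t. mat_exp (t *\<^sub>R X) $ i $ j) has_real_derivative (X ** mat_exp (t *\<^sub>R X)) $ i $ j) (at t)"
    using D by simp
  have "(\<Sum>n. diffs (a i j) n * t ^ n) = (\<Sum>n. \<Sum>k\<in>UNIV. X $ k $ j * (a i k n * t ^ n))"
    unfolding d mat_pow_Suc2
    by (simp add: matrix_matrix_mult_def a_def sum_distrib_left sum_divide_distrib mult_ac)
  also have "\<dots> = (\<Sum>k\<in>UNIV. X $ k $ j * (\<Sum>n. a i k n * t ^ n))"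
    by (subst suminf_sum) (auto intro: summable_mult summ simp: suminf_mult[OF summ])
  also have "\<dots> = (mat_exp (t *\<^sub>R X) ** X) $ i $ j"
    by (simp add: matrix_matrix_mult_def mat_exp_entry a_def mult.commute)
  finally show "((\<lambda>t. mat_exp (t *\<^sub>R X) $ i $ j) has_real_derivative (mat_exp (t *\<^sub>R X) ** X) $ i $ j) (at t)"
    using D by simp
qed

text \<open>The product of the exponentials at \<open>u\<close> and at \<open>s + t - u\<close> has
  derivative 0 in \<open>u\<close>; its values at \<open>u = s\<close> and \<open>u = 0\<close> are
  the two sides.\<close>

lemma mat_exp_add:
  fixes X :: "real^'n^'n"
  shows "mat_exp ((s + t) *\<^sub>R X) = mat_exp (s *\<^sub>R X) ** mat_exp (t *\<^sub>R X)"
proof -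
  define g where "g i j u = (mat_exp (u *\<^sub>R X) ** mat_exp ((s + t - u) *\<^sub>R X)) $ i $ j" for i j u
  have "(g i j has_real_derivative 0) (at u)" for i j u
  proof -
    have 1: "((\<lambda>u. mat_exp ((s + t - u) *\<^sub>R X) $ k $ j) has_real_derivative
        (X ** mat_exp ((s + t - u) *\<^sub>R X)) $ k $ j * (0 - 1)) (at u)" for k
      by (rule DERIV_chain2[OF mat_exp_entry_has_derivative(1)]) (auto intro!: derivative_eq_intros)
    have "(g i j has_real_derivative
        (\<Sum>k\<in>UNIV. mat_exp (u *\<^sub>R X) $ i $ k * ((X ** mat_exp ((s + t - u) *\<^sub>R X)) $ k $ j * (0 - 1)) +
          (mat_exp (u *\<^sub>R X) ** X) $ i $ k * mat_exp ((s + t - u) *\<^sub>R X) $ k $ j)) (at u)"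
      unfolding g_def matrix_matrix_mult_def[of "mat_exp _" "mat_exp _"] vec_lambda_beta
      by (intro DERIV_sum DERIV_mult' mat_exp_entry_has_derivative(2) 1)
    also have "(\<Sum>k\<in>UNIV. mat_exp (u *\<^sub>R X) $ i $ k * ((X ** mat_exp ((s + t - u) *\<^sub>R X)) $ k $ j * (0 - 1)) +
          (mat_exp (u *\<^sub>R X) ** X) $ i $ k * mat_exp ((s + t - u) *\<^sub>R X) $ k $ j) =
        ((mat_exp (u *\<^sub>R X) ** X) ** mat_exp ((s + t - u) *\<^sub>R X)) $ i $ j -
        (mat_exp (u *\<^sub>R X) ** (X ** mat_exp ((s + t - u) *\<^sub>R X))) $ i $ j"
      by (simp add: matrix_matrix_mult_def[of "mat_exp _" "X ** _"]
          matrix_matrix_mult_def[of "_ ** X" "mat_exp _"] sum.distrib sum_negf sum_subtractf)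
    finally show ?thesis by (simp add: matrix_mul_assoc)
  qed
  then have "g i j s = g i j 0" for i j
    using DERIV_isconst_all by blast
  then show ?thesis
    by (simp add: g_def vec_eq_iff mat_exp_zero)
qed

lemma has_vector_derivative_componentwise:
  fixes f :: "real \<Rightarrow> real^'n"
  assumes "\<And>i. ((\<lambda>t. f t $ i) has_vector_derivative f' $ i) (at t within S)"
  shows "(f has_vector_derivative f') (at t within S)"
  using assms unfolding has_vector_derivative_def
  by (subst has_derivative_componentwise_within) (auto simp: Basis_vec_def inner_axis)

lemma mat_exp_vec_has_derivative:
  fixes X :: "real^'n^'n"
  shows "((\<lambda>t. mat_exp (t *\<^sub>R X) *v x) has_vector_derivative X *v (mat_exp (t *\<^sub>R X) *v x)) (at t within S)"
proof (rule has_vector_derivative_componentwise)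
  fix i
  have "((\<lambda>t. (mat_exp (t *\<^sub>R X) *v x) $ i) has_real_derivative
      (\<Sum>j\<in>UNIV. (X ** mat_exp (t *\<^sub>R X)) $ i $ j * x $ j)) (at t within S)"
    unfolding matrix_vector_mult_def[of "mat_exp _"] vec_lambda_beta
    by (intro DERIV_sum DERIV_cmult_right mat_exp_entry_has_derivative(1)[THEN DERIV_subset]) simp
  then show "((\<lambda>t. (mat_exp (t *\<^sub>R X) *v x) $ i) has_vector_derivative (X *v (mat_exp (t *\<^sub>R X) *v x)) $ i)
      (at t within S)"
    unfolding has_real_derivative_iff_has_vector_derivative[symmetric]
    by (simp add: matrix_vector_mul_assoc) (simp add: matrix_vector_mult_def)
qed

lemma mat_exp_vec_continuous:
  "continuous_on S (\<lambda>t. mat_exp (t *\<^sub>R (X :: real^'n^'n)) *v x)"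
  by (rule continuous_at_imp_continuous_on)
    (auto intro: has_vector_derivative_continuous mat_exp_vec_has_derivative)

lemma mat_exp_vec_sums:
  "(\<lambda>n. t ^ n / fact n * (y \<bullet> (mat_pow X n *v x))) sums (y \<bullet> (mat_exp (t *\<^sub>R (X :: real^'n^'n)) *v x))"
proof -
  have "bounded_linear (\<lambda>Z :: real^'n^'n. y \<bullet> (Z *v x))"
    unfolding linear_conv_bounded_linear[symmetric]
    by (rule linearI)
      (simp_all add: matrix_vector_mult_add_rdistrib inner_add_right scaleR_matrix_vector_assoc[symmetric])
  from bounded_linear.sums[OF this mat_exp_sums[of t X]] show ?thesis
    by (simp add: scaleR_matrix_vector_assoc[symmetric])
qed


subsection \<open>Krylov subspaces\<close>

text \<open>This takes the place of Cayley-Hamilton. More than \<open>DIM('a)\<close> vectors cannot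
  be independent, so some iterate with index at most \<open>DIM('a)\<close> lies in the span of its
  predecessors. From then on that span is invariant and contains every iterate.\<close>

lemma funpow_in_span_Krylov:
  fixes f :: "'a::euclidean_space \<Rightarrow> 'a"
  assumes "linear f"
  shows "(f ^^ n) x \<in> span ((\<lambda>i. (f ^^ i) x) ` {..<DIM('a)})"
proof -
  define K where "K m = span ((\<lambda>i. (f ^^ i) x) ` {..<m})" for m
  have K_mono: "K m \<subseteq> K m'" if "m \<le> m'" for m m'
    unfolding K_def by (rule span_mono) (use that in auto)
  have "\<exists>m\<le>DIM('a). (f ^^ m) x \<in> K m"
  proof (rule ccontr)
    assume "\<not> ?thesis"
    then have notin: "(f ^^ m) x \<notin> K m" if "m \<le> DIM('a)" for m
      using that by blast
    have ind: "independent ((\<lambda>i. (f ^^ i) x) ` {..<m}) \<and> inj_on (\<lambda>i. (f ^^ i) x) {..<m}"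
      if "m \<le> Suc (DIM('a))" for m
      using that
    proof (induction m)
      case (Suc m)
      let ?I = "(\<lambda>i. (f ^^ i) x) ` {..<m}"
      have "(f ^^ m) x \<notin> span ?I"
        using notin[of m] Suc.prems by (simp add: K_def)
      moreover from this have "(f ^^ m) x \<notin> ?I"
        by (metis span_base)
      moreover have "independent ?I" "inj_on (\<lambda>i. (f ^^ i) x) {..<m}"
        using Suc by simp_all
      moreover from calculation have "independent (insert ((f ^^ m) x) ?I)"
        by (intro independent_insertI)
      ultimately show ?case
        by (simp add: lessThan_Suc)
    qed (simp add: independent_empty)
    from ind[OF order.refl] have "card ((\<lambda>i. (f ^^ i) x) ` {..<Suc (DIM('a))}) \<le> DIM('a)"
      using independent_bound by blast
    with ind[OF order.refl] show False by (simp add: card_image)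
  qed
  then obtain m where m: "m \<le> DIM('a)" "(f ^^ m) x \<in> K m" by blast
  have inv: "f y \<in> K m" if "y \<in> K m" for y
  proof -
    have "f y \<in> span (f ` (\<lambda>i. (f ^^ i) x) ` {..<m})"
      using that \<open>linear f\<close> unfolding K_def by (simp add: linear_span_image)
    also have "\<dots> \<subseteq> K m"
      unfolding K_def
    proof (rule span_minimal, rule subsetI)
      fix z assume "z \<in> f ` (\<lambda>i. (f ^^ i) x) ` {..<m}"
      then obtain i where i: "i < m" "z = (f ^^ Suc i) x" by auto
      show "z \<in> span ((\<lambda>i. (f ^^ i) x) ` {..<m})"
      proof (cases "Suc i = m")
        case True
        then show ?thesis using m(2) i by (simp add: K_def)
      next
        case False
        then show ?thesis using i by (intro span_base image_eqI[of _ _ "Suc i"]) auto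
      qed
    qed simp
    finally show ?thesis .
  qed
  have "(f ^^ n) x \<in> K m"
  proof (induction n)
    case 0
    show ?case
    proof (cases "m = 0")
      case True
      then show ?thesis using m(2) by simp
    next
      case False
      then show ?thesis
        unfolding K_def by (intro span_base image_eqI[of _ _ 0]) auto
    qed
  qed (simp add: inv)
  then show ?thesis using K_mono[OF m(1)] by (auto simp: K_def)
qed


subsection \<open>A closure criterion in \<open>L\<^sup>2\<close>\<close>

text \<open>A Hahn--Banach argument without completeness: the errors \<open>e n = x - U n\<close> along a minimizing
  sequence are Cauchy, and \<open>y \<mapsto> lim \<langle>e n, y\<rangle>\<close> is the separating functional.\<close>

lemma L2_closure_criterion:
  fixes S :: "('w \<Rightarrow> real) set"
  assumes S_L2: "\<And>U. U \<in> S \<Longrightarrow> square_integrable M U"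
    and S_zero: "(\<lambda>_. 0) \<in> S"
    and S_add: "\<And>U V c. U \<in> S \<Longrightarrow> V \<in> S \<Longrightarrow> (\<lambda>w. U w + c * V w) \<in> S"
    and x: "square_integrable M x"
    and separating: "\<And>\<phi> K. (\<And>y z c. square_integrable M y \<Longrightarrow> square_integrable M z \<Longrightarrow>
          \<phi> (\<lambda>w. y w + c * z w) = \<phi> y + c * \<phi> z) \<Longrightarrow>
        (\<And>y. square_integrable M y \<Longrightarrow> (\<phi> y)\<^sup>2 \<le> K * (LINT w|M. (y w)\<^sup>2)) \<Longrightarrow>
        (\<And>U. U \<in> S \<Longrightarrow> \<phi> U = 0) \<Longrightarrow> \<phi> x = (0::real)"
  shows "\<exists>U. (\<forall>n::nat. U n \<in> S) \<and> L2_tendsto M U x sequentially"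
proof -
  define N where "N y = (LINT w|M. (y w)\<^sup>2)" for y :: "'w \<Rightarrow> real"
  define ip where "ip y z = (LINT w|M. y w * z w)" for y z :: "'w \<Rightarrow> real"
  have N_nonneg: "0 \<le> N y" for y by (simp add: N_def)
  have CS: "(ip y z)\<^sup>2 \<le> N y * N z" if "square_integrable M y" "square_integrable M z" for y z
    unfolding ip_def N_def using that by (rule Cauchy_Schwarz_integral)
  have ip_add: "ip y (\<lambda>w. z w + c * v w) = ip y z + c * ip y v"
    if "square_integrable M y" "square_integrable M z" "square_integrable M v" for y z v c
    using L2_times[OF that(1,2)] L2_times[OF that(1,3)]
    by (simp add: ip_def distrib_left mult.left_commute)
  have N_add: "N (\<lambda>w. z w + c * v w) = N z + 2 * c * ip z v + c\<^sup>2 * N v"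
    if zw: "square_integrable M z" "square_integrable M v" for z v c
  proof -
    have "N (\<lambda>w. z w + c * v w) = (LINT w|M. (z w)\<^sup>2 + 2 * c * (z w * v w) + c\<^sup>2 * (v w)\<^sup>2)"
      by (simp add: N_def power2_sum power_mult_distrib algebra_simps)
    also have "\<dots> = N z + 2 * c * ip z v + c\<^sup>2 * N v"
      using L2_times[OF zw] L2D[OF zw(1)] L2D[OF zw(2)]
      by (simp add: N_def ip_def)
    finally show ?thesis .
  qed
  \<comment> \<open>Differences are written as \<open>x w + (- 1) * U w\<close> throughout, so that
    \<open>ip_add\<close> and \<open>N_add\<close> apply to them as they stand.\<close>
  define d where "d = Inf ((\<lambda>U. N (\<lambda>w. x w + (- 1) * U w)) ` S)"
  have bdd: "bdd_below ((\<lambda>U. N (\<lambda>w. x w + (- 1) * U w)) ` S)"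
    using N_nonneg by (auto simp: bdd_below_def)
  have d_le: "d \<le> N (\<lambda>w. x w + (- 1) * U w)" if "U \<in> S" for U
    unfolding d_def using that bdd by (auto intro: cInf_lower)
  have "d \<ge> 0"
    unfolding d_def using S_zero N_nonneg by (auto intro!: cInf_greatest)
  define \<epsilon> where "\<epsilon> n = inverse (real (Suc n))" for n
  have \<epsilon>: "0 < \<epsilon> n" "\<epsilon> n \<le> 1" for n by (auto simp: \<epsilon>_def field_simps)
  have \<epsilon>_lim: "\<epsilon> \<longlonglongrightarrow> 0"
    unfolding \<epsilon>_def by (rule LIMSEQ_inverse_real_of_nat)
  have "\<exists>U\<in>S. N (\<lambda>w. x w + (- 1) * U w) < d + \<epsilon> n" for n
  proof -
    have "Inf ((\<lambda>U. N (\<lambda>w. x w + (- 1) * U w)) ` S) < d + \<epsilon> n"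
      using \<epsilon>(1)[of n] by (simp add: d_def)
    then show ?thesis
      using S_zero bdd by (subst (asm) cInf_less_iff) auto
  qed
  then obtain U where U: "\<And>n. U n \<in> S" "\<And>n. N (\<lambda>w. x w + (- 1) * U n w) < d + \<epsilon> n"
    by metis
  define e where "e n = (\<lambda>w. x w + (- 1) * U n w)" for n
  have UL2: "square_integrable M (U n)" for n using U(1) S_L2 by blast
  have eL2: "square_integrable M (e n)" for n
    using L2_diff[OF x UL2] by (simp add: e_def)
  have Ne: "N (e n) < d + \<epsilon> n" for n using U(2) by (simp add: e_def)
  \<comment> \<open>A move from \<open>U n\<close> along \<open>t * V\<close> stays in
    \<open>S\<close> and can lower the squared distance by at most \<open>\<epsilon> n\<close>; the
    best choice is \<open>t = ip (e n) V / N V\<close>.\<close>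
  have near_orth: "(ip (e n) V)\<^sup>2 \<le> \<epsilon> n * N V" if V: "V \<in> S" for n V
  proof -
    have VL2: "square_integrable M V" using V S_L2 by blast
    have q: "2 * t * ip (e n) V - t\<^sup>2 * N V \<le> \<epsilon> n" for t
    proof -
      have "(\<lambda>w. U n w + t * V w) \<in> S" using U(1) V by (rule S_add)
      from d_le[OF this] have "d \<le> N (\<lambda>w. e n w + (- t) * V w)"
        by (simp add: e_def algebra_simps)
      then show ?thesis using N_add[OF eL2 VL2, of n "- t"] Ne[of n] by simp
    qed
    show ?thesis
    proof (cases "N V = 0")
      case True
      then show ?thesis using CS[OF eL2 VL2, of n] by simp
    next
      case False
      then have "N V > 0" using N_nonneg[of V] by simp
      with q[of "ip (e n) V / N V"] show ?thesis by (simp add: field_simps power2_eq_square)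
    qed
  qed
  \<comment> \<open>Parallelogram law: the midpoint of \<open>U n\<close> and \<open>U m\<close>
    lies in \<open>S\<close>, so its squared distance to \<open>x\<close> is at least
    \<open>d\<close>.\<close>
  have Cauchy_e: "N (\<lambda>w. e n w + (- 1) * e m w) \<le> 2 * \<epsilon> n + 2 * \<epsilon> m" for n m
  proof -
    have "(\<lambda>w. (1/2) * U n w + (1/2) * U m w) \<in> S"
      using S_add[OF S_add[OF S_zero U(1), of "1/2" n] U(1), of "1/2" m] by simp
    from d_le[OF this] have "d \<le> N (\<lambda>w. 0 + (1/2) * (e n w + 1 * e m w))"
      by (simp add: e_def algebra_simps)
    also have "\<dots> = (1/4) * N (\<lambda>w. e n w + 1 * e m w)"
      by (simp add: N_def power_mult_distrib power2_eq_square)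
    finally have "4 * d \<le> N (\<lambda>w. e n w + 1 * e m w)" by simp
    then show ?thesis
      using N_add[OF eL2 eL2, of n "-1" m] N_add[OF eL2 eL2, of n 1 m] Ne[of n] Ne[of m] by simp
  qed
  have conv: "convergent (\<lambda>n. ip (e n) y)" if y: "square_integrable M y" for y
  proof (rule Cauchy_convergent, rule CauchyI)
    fix r :: real assume "r > 0"
    have "(\<lambda>n. 4 * \<epsilon> n * N y) \<longlonglongrightarrow> 4 * 0 * N y" by (intro tendsto_intros \<epsilon>_lim)
    then have "eventually (\<lambda>n. 4 * \<epsilon> n * N y < r\<^sup>2) sequentially"
      by (rule order_tendstoD) (use \<open>r > 0\<close> in simp)
    then obtain n0 where n0: "4 * \<epsilon> n0 * N y < r\<^sup>2" by (auto simp: eventually_sequentially)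
    have "norm (ip (e m) y - ip (e n) y) < r" if mn: "m \<ge> n0" "n \<ge> n0" for m n
    proof -
      have "ip (e m) y - ip (e n) y = ip y (\<lambda>w. e m w + (- 1) * e n w)"
        using ip_add[OF y eL2 eL2, of m "-1" n] by (simp add: ip_def mult.commute)
      moreover have "(ip y (\<lambda>w. e m w + (- 1) * e n w))\<^sup>2 \<le> N y * N (\<lambda>w. e m w + (- 1) * e n w)"
        using L2_diff[OF eL2 eL2, of m n] by (intro CS y) simp
      moreover have "\<epsilon> m \<le> \<epsilon> n0" "\<epsilon> n \<le> \<epsilon> n0"
        using mn by (auto simp: \<epsilon>_def field_simps)
      then have "N y * N (\<lambda>w. e m w + (- 1) * e n w) \<le> N y * (4 * \<epsilon> n0)"
        using Cauchy_e[of m n] by (intro mult_left_mono N_nonneg) linarith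
      ultimately have "(ip (e m) y - ip (e n) y)\<^sup>2 < r\<^sup>2"
        using n0 by (simp add: mult_ac)
      then show ?thesis
        using \<open>r > 0\<close> by (metis abs_le_square_iff abs_of_pos not_le real_norm_def)
    qed
    then show "\<exists>n0. \<forall>m\<ge>n0. \<forall>n\<ge>n0. norm (ip (e m) y - ip (e n) y) < r" by blast
  qed
  define \<phi> where "\<phi> y = lim (\<lambda>n. ip (e n) y)" for y
  have \<phi>: "(\<lambda>n. ip (e n) y) \<longlonglongrightarrow> \<phi> y" if "square_integrable M y" for y
    unfolding \<phi>_def using conv[OF that] by (simp add: convergent_LIMSEQ_iff)
  have "\<phi> x = 0"
  \<comment> \<open>The constant bounds \<open>N (e n) < d + \<epsilon> n\<close>, because
    \<open>\<epsilon> n \<le> 1\<close>.\<close>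
  proof (rule separating[of \<phi> "d + 1"])
    fix y z :: "'w \<Rightarrow> real" and c :: real assume yz: "square_integrable M y" "square_integrable M z"
    have "(\<lambda>n. ip (e n) (\<lambda>w. y w + c * z w)) \<longlonglongrightarrow> \<phi> y + c * \<phi> z"
      unfolding ip_add[OF eL2 yz] by (intro tendsto_intros \<phi> yz)
    then show "\<phi> (\<lambda>w. y w + c * z w) = \<phi> y + c * \<phi> z"
      unfolding \<phi>_def by (rule limI)
  next
    fix y :: "'w \<Rightarrow> real" assume y: "square_integrable M y"
    have "(\<lambda>n. (ip (e n) y)\<^sup>2) \<longlonglongrightarrow> (\<phi> y)\<^sup>2" by (intro tendsto_intros \<phi> y)
    moreover have "(ip (e n) y)\<^sup>2 \<le> (d + 1) * (LINT w|M. (y w)\<^sup>2)" for n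
    proof -
      have "(ip (e n) y)\<^sup>2 \<le> N (e n) * N y" using eL2 y by (rule CS)
      also have "\<dots> \<le> (d + 1) * N y"
        using Ne[of n] \<epsilon>[of n] by (intro mult_right_mono N_nonneg) simp
      finally show ?thesis by (simp add: N_def)
    qed
    ultimately show "(\<phi> y)\<^sup>2 \<le> (d + 1) * (LINT w|M. (y w)\<^sup>2)"
      by (intro LIMSEQ_le_const2) auto
  next
    fix V assume V: "V \<in> S"
    have "(\<lambda>n. (ip (e n) V)\<^sup>2) \<longlonglongrightarrow> 0"
    proof (rule tendsto_sandwich[OF _ _ tendsto_const])
      have "(\<lambda>n. \<epsilon> n * N V) \<longlonglongrightarrow> 0 * N V" by (intro tendsto_intros \<epsilon>_lim)
      then show "(\<lambda>n. \<epsilon> n * N V) \<longlonglongrightarrow> 0" by simp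
    qed (auto intro!: always_eventually near_orth V)
    moreover have "(\<lambda>n. (ip (e n) V)\<^sup>2) \<longlonglongrightarrow> (\<phi> V)\<^sup>2"
      by (intro tendsto_intros \<phi> S_L2 V)
    ultimately have "(\<phi> V)\<^sup>2 = 0" using LIMSEQ_unique by blast
    then show "\<phi> V = 0" by simp
  qed
  then have lim_x: "(\<lambda>n. ip (e n) x) \<longlonglongrightarrow> 0" using \<phi>[OF x] by simp
  have N_U: "N (U n) \<le> 2 * N x + 2 * (d + 1)" for n
  proof -
    have "N (U n) = N (\<lambda>w. x w + (- 1) * e n w)" by (simp add: e_def)
    also have "\<dots> = N x - 2 * ip x (e n) + N (e n)" using N_add[OF x eL2, of "-1" n] by simp
    also have "\<dots> \<le> 2 * N x + 2 * N (e n)"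
      using N_add[OF x eL2, of 1 n] N_nonneg[of "\<lambda>w. x w + 1 * e n w"] by simp
    also have "\<dots> \<le> 2 * N x + 2 * (d + 1)" using Ne[of n] \<epsilon>[of n] by simp
    finally show ?thesis .
  qed
  \<comment> \<open>The squared distance \<open>N (e n)\<close> equals
    \<open>ip (e n) x - ip (e n) (U n)\<close>. The first term tends to 0 since
    \<open>\<phi> x = 0\<close>; the second does so by near orthogonality to the moving element
    \<open>U n\<close>, whose norms stay bounded.\<close>
  have "(\<lambda>n. (ip (e n) (U n))\<^sup>2) \<longlonglongrightarrow> 0"
  proof (rule tendsto_sandwich[OF _ _ tendsto_const])
    have "(\<lambda>n. \<epsilon> n * (2 * N x + 2 * (d + 1))) \<longlonglongrightarrow> 0 * (2 * N x + 2 * (d + 1))"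
      by (intro tendsto_intros \<epsilon>_lim)
    then show "(\<lambda>n. \<epsilon> n * (2 * N x + 2 * (d + 1))) \<longlonglongrightarrow> 0" by simp
    have "(ip (e n) (U n))\<^sup>2 \<le> \<epsilon> n * (2 * N x + 2 * (d + 1))" for n
      using near_orth[OF U(1), of n n] mult_left_mono[OF N_U[of n], of "\<epsilon> n"] \<epsilon>[of n] by linarith
    then show "\<forall>\<^sub>F n in sequentially. (ip (e n) (U n))\<^sup>2 \<le> \<epsilon> n * (2 * N x + 2 * (d + 1))" by simp
  qed simp
  then have "(\<lambda>n. sqrt ((ip (e n) (U n))\<^sup>2)) \<longlonglongrightarrow> sqrt 0" by (rule tendsto_real_sqrt)
  then have "(\<lambda>n. ip (e n) (U n)) \<longlonglongrightarrow> 0" by (simp add: tendsto_rabs_zero_iff)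
  from tendsto_diff[OF lim_x this] have "(\<lambda>n. ip (e n) x - ip (e n) (U n)) \<longlonglongrightarrow> 0" by simp
  moreover have "ip (e n) x - ip (e n) (U n) = N (e n)" for n
    using ip_add[OF eL2 x UL2, of n "-1" n]
    by (simp add: N_def ip_def e_def power2_eq_square)
  ultimately have "(\<lambda>n. N (e n)) \<longlonglongrightarrow> 0" by simp
  then have "(\<lambda>n. LINT w|M. (norm (U n w - x w))\<^sup>2) \<longlonglongrightarrow> 0"
    by (simp add: N_def e_def power2_commute)
  then have "L2_tendsto M U x sequentially"
    using L2_diff[OF UL2 x] by (subst L2_tendsto_iff_integral)
  with U(1) show ?thesis by blast
qed


subsection \<open>Second moments of increments\<close>

text \<open>Cauchy's functional equation. Subtracting the linear candidate leaves an additive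
  \<open>g\<close> that vanishes on the naturals, hence has period 1, and is bounded on [0, 1],
  hence everywhere; but \<open>g (n * t) = n * g t\<close> is bounded in \<open>n\<close> only if
  \<open>g t = 0\<close>.\<close>

lemma additive_bounded_imp_linear:
  fixes f :: "real \<Rightarrow> real"
  assumes add: "\<And>s t. 0 \<le> s \<Longrightarrow> 0 \<le> t \<Longrightarrow> f (s + t) = f s + f t"
    and bdd: "\<And>t. 0 < t \<Longrightarrow> t < \<delta> \<Longrightarrow> \<bar>f t\<bar> \<le> K" and "\<delta> > 0" and "t \<ge> 0"
  shows "f t = t * f 1"
proof -
  define g where "g t = f t - t * f 1" for t
  have g_add: "g (s + t) = g s + g t" if "0 \<le> s" "0 \<le> t" for s t
    using add[OF that] by (simp add: g_def algebra_simps)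
  have g_zero: "g 0 = 0" using g_add[of 0 0] by simp
  have g_mult: "g (real n * t) = real n * g t" if "0 \<le> t" for n t
  proof (induction n)
    case (Suc n)
    have "g (real (Suc n) * t) = g (real n * t + t)" by (simp add: algebra_simps)
    also have "\<dots> = real (Suc n) * g t" using g_add[of "real n * t" t] that Suc by (simp add: algebra_simps)
    finally show ?case .
  qed (simp add: g_zero)
  \<comment> \<open>Division by \<open>m\<close> maps [0, 1] into the range where \<open>f\<close>
    is bounded; the bound comes back multiplied by \<open>m\<close>.\<close>
  obtain m where m: "1 / \<delta> < real m" using reals_Archimedean2 by blast
  then have "0 < real m" using \<open>\<delta> > 0\<close> by (meson divide_pos_pos less_trans zero_less_one)
  define C where "C = real m * (\<bar>K\<bar> + \<bar>f 1\<bar>)"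
  have g_bdd: "\<bar>g x\<bar> \<le> C" if "0 \<le> x" "x \<le> 1" for x
  proof (cases "x = 0")
    case True
    then show ?thesis using \<open>0 < real m\<close> by (simp add: g_zero C_def)
  next
    case False
    have le1: "x / real m \<le> 1 / real m" using that \<open>0 < real m\<close> by (simp add: divide_right_mono)
    also have "1 / real m < \<delta>" using m \<open>\<delta> > 0\<close> \<open>0 < real m\<close> by (simp add: field_simps)
    finally have "\<bar>f (x / real m)\<bar> \<le> K" using bdd that False \<open>0 < real m\<close> by simp
    moreover have "x / real m \<le> 1" using le1 \<open>0 < real m\<close> by (simp add: field_simps)
    then have "\<bar>x / real m * f 1\<bar> \<le> \<bar>f 1\<bar>"
      using that unfolding abs_mult by (intro mult_left_le_one_le) auto
    ultimately have "\<bar>g (x / real m)\<bar> \<le> \<bar>K\<bar> + \<bar>f 1\<bar>" unfolding g_def by linarith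
    moreover have "g x = real m * g (x / real m)" using g_mult[of "x / real m" m] that \<open>0 < real m\<close> by simp
    ultimately show ?thesis using \<open>0 < real m\<close> by (simp add: abs_mult C_def)
  qed
  have g_nat: "g (real k) = 0" for k using g_mult[of 1 k] by (simp add: g_def)
  have "\<bar>real n * g t\<bar> \<le> C" for n
  proof -
    have fl: "\<lfloor>real n * t\<rfloor> \<ge> 0" using \<open>t \<ge> 0\<close> by simp
    have "real n * t = real (nat \<lfloor>real n * t\<rfloor>) + frac (real n * t)"
      using fl by (simp add: frac_def)
    then have "g (real n * t) = g (frac (real n * t))"
      using g_add[of "real (nat \<lfloor>real n * t\<rfloor>)" "frac (real n * t)"] g_nat by simp
    then show ?thesis
      using g_mult[OF \<open>t \<ge> 0\<close>] g_bdd[of "frac (real n * t)"] frac_lt_1[of "real n * t"] by simp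
  qed
  moreover have "\<exists>n. C < real n * \<bar>g t\<bar>" if "g t \<noteq> 0"
    using that by (intro reals_Archimedean3[rule_format]) simp
  ultimately have "g t = 0"
    unfolding abs_mult abs_of_nat by (metis not_less)
  then show ?thesis by (simp add: g_def)
qed

text \<open>By Fubini the second moment of the sum is the average over \<open>y\<close>, distributed
  as \<open>Y\<close>, of the second moment of \<open>X + y\<close>. So the latter is finite for at
  least one constant \<open>y\<close>, and constants do not affect square integrability.\<close>

lemma (in prob_space) L2_indep_summand:
  fixes X Y :: "'a \<Rightarrow> real"
  assumes ind: "indep_var borel X borel Y" and sum: "square_integrable M (\<lambda>w. X w + Y w)"
  shows "square_integrable M X"
proof -
  have [measurable]: "X \<in> borel_measurable M" "Y \<in> borel_measurable M"
    using indep_var_rv1[OF ind] indep_var_rv2[OF ind] by auto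
  interpret X: prob_space "distr M borel X" by (rule prob_space_distr) simp
  interpret Y: prob_space "distr M borel Y" by (rule prob_space_distr) simp
  interpret XY: pair_sigma_finite "distr M borel X" "distr M borel Y" ..
  have "(\<integral>\<^sup>+ w. ennreal ((X w + Y w)\<^sup>2) \<partial>M) < \<infinity>"
    using nn_integral_norm_power2[OF sum] by simp
  also have "(\<integral>\<^sup>+ w. ennreal ((X w + Y w)\<^sup>2) \<partial>M) =
      (\<integral>\<^sup>+ z. ennreal ((fst z + snd z)\<^sup>2) \<partial>distr M (borel \<Otimes>\<^sub>M borel) (\<lambda>w. (X w, Y w)))"
    by (subst nn_integral_distr) auto
  also have "distr M (borel \<Otimes>\<^sub>M borel) (\<lambda>w. (X w, Y w)) = distr M borel X \<Otimes>\<^sub>M distr M borel Y"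
    using ind by (simp add: indep_var_distribution_eq)
  also have "(\<integral>\<^sup>+ z. ennreal ((fst z + snd z)\<^sup>2) \<partial>(distr M borel X \<Otimes>\<^sub>M distr M borel Y)) =
      (\<integral>\<^sup>+ y. \<integral>\<^sup>+ x. ennreal ((x + y)\<^sup>2) \<partial>distr M borel X \<partial>distr M borel Y)"
    by (subst XY.nn_integral_snd[symmetric]) auto
  finally have "AE y in distr M borel Y. (\<integral>\<^sup>+ x. ennreal ((x + y)\<^sup>2) \<partial>distr M borel X) \<noteq> \<infinity>"
    by (intro nn_integral_PInf_AE) auto
  then obtain y where "(\<integral>\<^sup>+ x. ennreal ((x + y)\<^sup>2) \<partial>distr M borel X) \<noteq> \<infinity>"
    using Y.AE_prob_1 by (metis (mono_tags, lifting) Y.AE_False eventually_mono)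
  then have "(\<integral>\<^sup>+ w. ennreal ((X w + y)\<^sup>2) \<partial>M) < \<infinity>"
    by (subst (asm) nn_integral_distr) (auto simp: top.not_eq_extremum)
  then have "integrable M (\<lambda>w. (X w + y)\<^sup>2)"
    by (intro integrableI_bounded) auto
  then have "square_integrable M (\<lambda>w. X w + y)"
    by (simp add: L2_power2_iff)
  from L2_diff[OF this L2_const[of y]] show ?thesis by simp
qed

locale centred_levy = prob_space M for M :: "'w measure" +
  fixes L :: "real \<Rightarrow> 'w \<Rightarrow> real^'k"
  assumes levy: "levy_process M L"
    and L1_L2: "square_integrable M (L 1)"
    and L1_mean: "integral\<^sup>L M (L 1) = 0"
begin

abbreviation (input) \<Sigma> :: "real^'k^'k"
  where "\<Sigma> \<equiv> second_moment M (L 1)"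

definition incr :: "real \<Rightarrow> real \<Rightarrow> 'k \<Rightarrow> 'w \<Rightarrow> real"
  where "incr s t i w = (L t w - L s w) $ i"

lemma L_measurable [measurable]: "L t \<in> borel_measurable M"
  using levy by (simp add: levy_process_def)

lemma vec_nth_measurable [measurable]: "(\<lambda>x::real^'n. x $ i) \<in> borel_measurable borel"
  by (intro borel_measurable_continuous_onI continuous_intros)

lemma incr_measurable [measurable]: "incr s t i \<in> borel_measurable M"
  unfolding incr_def by measurable

lemma incr_split: "incr r t i w = incr r s i w + incr s t i w"
  by (simp add: incr_def)

lemma incr_split_fun: "incr r t i = (\<lambda>w. incr r s i w + incr s t i w)"
  by (rule ext) (rule incr_split)

lemma incr_same [simp]: "incr s s i = (\<lambda>_. 0)"
  by (simp add: incr_def fun_eq_iff)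

lemma incr_indep:
  assumes "r < s" "s < t"
  shows "indep_var borel (incr r s i) borel (incr s t j)"
proof -
  \<comment> \<open>\<open>levy_process\<close> speaks of strictly increasing sequences on all
    naturals, so the three times are continued beyond \<open>T 2 = t\<close> by unit steps.\<close>
  define T where "T n = (if n = 0 then r else if n = 1 then s else t + real n - 2)" for n :: nat
  have "strict_mono T"
    unfolding strict_mono_Suc_iff using assms by (auto simp: T_def)
  then have "indep_vars (\<lambda>_. borel) (\<lambda>i w. L (T (Suc i)) w - L (T i) w) {..<2::nat}"
    using levy by (simp add: levy_process_def)
  from indep_var_restrict[OF this, of "{0}" "{1}"]
  have ind: "indep_var (PiM {0} (\<lambda>_. borel)) (\<lambda>w. \<lambda>i\<in>{0}. L (T (Suc i)) w - L (T i) w)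
      (PiM {1} (\<lambda>_. borel)) (\<lambda>w. \<lambda>i\<in>{1::nat}. L (T (Suc i)) w - L (T i) w)"
    by auto
  have "indep_var borel ((\<lambda>f. f 0 $ i) \<circ> (\<lambda>w. \<lambda>i\<in>{0}. L (T (Suc i)) w - L (T i) w))
      borel ((\<lambda>f. f 1 $ j) \<circ> (\<lambda>w. \<lambda>i\<in>{1::nat}. L (T (Suc i)) w - L (T i) w))"
    by (rule indep_var_compose[OF ind]) measurable
  then show ?thesis by (simp add: T_def comp_def incr_def[abs_def])
qed

lemma incr_stationary:
  assumes "s \<le> t" and [measurable]: "g \<in> borel_measurable borel"
  shows "integrable M (\<lambda>w. g (L t w - L s w)) \<longleftrightarrow> integrable M (\<lambda>w. g (L (t - s) w - L 0 w))"
    and "(LINT w|M. g (L t w - L s w)) = (LINT w|M. (g (L (t - s) w - L 0 w) :: real))"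
proof -
  have eq: "distr M borel (\<lambda>w. L t w - L s w) = distr M borel (\<lambda>w. L (t - s) w - L 0 w)"
  proof (cases "s = t")
    case False
    have "distr M borel (\<lambda>w. L (t' + h) w - L (s' + h) w) = distr M borel (\<lambda>w. L t' w - L s' w)"
      if "s' < t'" for s' t' h
      using levy that by (simp add: levy_process_def)
    from this[of 0 "t - s" s] False \<open>s \<le> t\<close> show ?thesis by simp
  qed simp
  show "integrable M (\<lambda>w. g (L t w - L s w)) \<longleftrightarrow> integrable M (\<lambda>w. g (L (t - s) w - L 0 w))"
    using integrable_distr_eq[of "\<lambda>w. L t w - L s w" M borel g]
      integrable_distr_eq[of "\<lambda>w. L (t - s) w - L 0 w" M borel g] by (simp add: eq)
  show "(LINT w|M. g (L t w - L s w)) = (LINT w|M. g (L (t - s) w - L 0 w))"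
    using integral_distr[of "\<lambda>w. L t w - L s w" M borel g]
      integral_distr[of "\<lambda>w. L (t - s) w - L 0 w" M borel g] by (simp add: eq)
qed

lemma AE_L0: "AE w in M. L 0 w = 0"
  using levy by (simp add: levy_process_def)

text \<open>For \<open>0 < h < 1\<close> the increment over \<open>[0, h]\<close> is an independent
  summand of the one over [0, 1], whose second moment is given; longer increments are sums of unit
  ones and a remainder, and stationarity moves the starting point.\<close>

lemma incr_L2: assumes "s \<le> t" shows "square_integrable M (incr s t i)"
proof -
  have shift: "square_integrable M (incr s t i) \<longleftrightarrow> square_integrable M (incr 0 (t - s) i)"
    if "s \<le> t" for s t
    using incr_stationary(1)[OF that, of "\<lambda>x. (x $ i)\<^sup>2"]
    by (simp add: L2_power2_iff) (simp add: incr_def)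
  have one: "square_integrable M (incr 0 1 i)"
  proof (rule L2_AE_cong[OF L2_component[OF L1_L2, of i]])
    show "AE w in M. incr 0 1 i w = L 1 w $ i"
      using AE_L0 by eventually_elim (simp add: incr_def)
  qed simp
  have small: "square_integrable M (incr 0 h i)" if "0 \<le> h" "h \<le> 1" for h
  proof -
    show ?thesis
    proof (cases "h = 0 \<or> h = 1")
      case False
      then have h: "0 < h" "h < 1" using that by auto
      have "square_integrable M (\<lambda>w. incr 0 h i w + incr h 1 i w)"
        using one unfolding incr_split_fun[of 0 1 i h] .
      then show ?thesis
        by (rule L2_indep_summand[OF incr_indep[OF h]])
    qed (use one in auto)
  qed
  have "square_integrable M (incr 0 h i)" if "0 \<le> h" "h \<le> real n" for h n
    using that
  proof (induction n arbitrary: h)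
    case (Suc n)
    show ?case
    proof (cases "h \<le> 1")
      case False
      then have "square_integrable M (incr 0 1 i)" "square_integrable M (incr 1 h i)"
        using shift[of 1 h] Suc.IH[of "h - 1"] Suc.prems one by simp_all
      then show ?thesis
        unfolding incr_split_fun[of 0 h i 1] by (rule L2_add)
    qed (use Suc.prems small in auto)
  qed simp
  then have "square_integrable M (incr 0 (t - s) i)"
    using assms real_arch_simple[of "t - s"] by auto
  then show ?thesis using shift[OF assms] by simp
qed

section \<open>Mean and covariance of increments as functions of the time span\<close>

definition mean where "mean i t = (LINT w|M. incr 0 t i w)"
definition cov where "cov i j t = (LINT w|M. (incr 0 t i w - mean i t) * (incr 0 t j w - mean j t))"

lemma incr_integrable: "s \<le> t \<Longrightarrow> integrable M (incr s t i)"
  by (intro L2_imp_integrable incr_L2)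

lemma mean_incr: "s \<le> t \<Longrightarrow> (LINT w|M. incr s t i w) = mean i (t - s)"
  using incr_stationary(2)[of s t "\<lambda>x. x $ i"] by (simp add: mean_def incr_def)

lemma cov_incr:
  assumes "s \<le> t"
  shows "(LINT w|M. (incr s t i w - mean i (t - s)) * (incr s t j w - mean j (t - s))) = cov i j (t - s)"
  using incr_stationary(2)[OF assms, of "\<lambda>x. (x $ i - mean i (t - s)) * (x $ j - mean j (t - s))"]
  by (simp add: cov_def incr_def)

lemma mean_add: assumes "0 \<le> s" "0 \<le> t" shows "mean i (s + t) = mean i s + mean i t"
proof -
  have "mean i (s + t) = (LINT w|M. incr 0 s i w + incr s (s + t) i w)"
    unfolding mean_def incr_split_fun[of 0 "s + t" i s] ..
  also have "\<dots> = mean i s + mean i t"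
    using assms by (simp add: incr_integrable mean_incr)
  finally show ?thesis .
qed

lemma incr_uncorrelated:
  assumes "r \<le> s" "s \<le> t"
  shows "(LINT w|M. incr r s i w * incr s t j w) = mean i (s - r) * mean j (t - s)"
proof (cases "r = s \<or> s = t")
  case True
  then show ?thesis by (auto simp: mean_def)
next
  case False
  then have "r < s" "s < t" using assms by auto
  from indep_var_lebesgue_integral[OF incr_indep[OF this]] show ?thesis
    using assms by (simp add: incr_integrable mean_incr)
qed

lemma cov_add: assumes "0 \<le> s" "0 \<le> t" shows "cov i j (s + t) = cov i j s + cov i j t"
proof -
  define c where "c i = (\<lambda>w. incr 0 s i w - mean i s)" for i
  define d where "d i = (\<lambda>w. incr s (s + t) i w - mean i t)" for i
  have L2: "square_integrable M (c i)" "square_integrable M (d i)" for i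
    unfolding c_def d_def using assms by (auto intro!: L2_diff L2_const incr_L2)
  note int = L2_times[OF L2(1) L2(1)] L2_times[OF L2(1) L2(2)]
    L2_times[OF L2(2) L2(1)] L2_times[OF L2(2) L2(2)]
  have cross: "(LINT w|M. c i w * d j w) = 0" for i j
  proof -
    have "integrable M (\<lambda>w. incr 0 s i w * incr s (s + t) j w)"
      using assms by (intro L2_times incr_L2) auto
    then have "(LINT w|M. incr 0 s i w * incr s (s + t) j w - mean i s * incr s (s + t) j w
        - mean j t * incr 0 s i w + mean i s * mean j t) = 0"
      using assms by (simp add: incr_integrable incr_uncorrelated mean_incr prob_space)
    then show ?thesis by (simp add: c_def d_def algebra_simps)
  qed
  have "cov i j (s + t) = (LINT w|M. c i w * c j w + c i w * d j w + d i w * c j w + d i w * d j w)"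
    unfolding cov_def mean_add[OF assms] c_def d_def
    by (rule Bochner_Integration.integral_cong[OF refl])
      (simp add: incr_split[of 0 "s + t" _ _ s] algebra_simps)
  also have "\<dots> = (LINT w|M. c i w * c j w) + (LINT w|M. c i w * d j w) + (LINT w|M. c j w * d i w)
      + (LINT w|M. d i w * d j w)"
    by (simp add: int mult.commute)
  also have "\<dots> = cov i j s + cov i j t"
    using cov_incr[of s "s + t" i j] assms by (simp add: cross) (simp add: c_def d_def cov_def)
  finally show ?thesis .
qed

lemma cov_self_nonneg: "0 \<le> cov i i t"
  by (simp add: cov_def)

text \<open>Independence makes \<open>cov i j\<close> additive. Variances are monotone in time
  because they are additive and nonnegative, so Cauchy-Schwarz bounds \<open>cov i j\<close> on (0,
  1).\<close>

lemma cov_linear: assumes "0 \<le> t" shows "cov i j t = t * cov i j 1"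
proof (rule additive_bounded_imp_linear[where \<delta> = 1 and K = "sqrt (cov i i 1) * sqrt (cov j j 1)"])
  have mono: "cov i i t \<le> cov i i 1" if "0 < t" "t < 1" for t i
    using cov_add[of t "1 - t" i i] cov_self_nonneg[of i "1 - t"] that by simp
  fix t :: real assume t: "0 < t" "t < 1"
  have "square_integrable M (\<lambda>w. incr 0 t i w - mean i t)" for i
    using t by (intro L2_diff L2_const incr_L2) simp
  from integral_mult_le_sqrt[OF this this]
  have "\<bar>cov i j t\<bar> \<le> sqrt (cov i i t) * sqrt (cov j j t)"
    by (simp add: cov_def power2_eq_square)
  also have "\<dots> \<le> sqrt (cov i i 1) * sqrt (cov j j 1)"
    using mono[OF t] cov_self_nonneg by (intro mult_mono) auto
  finally show "\<bar>cov i j t\<bar> \<le> sqrt (cov i i 1) * sqrt (cov j j 1)" .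
qed (use assms cov_add in auto)

text \<open>The second moments bound only the fluctuation of the increments; that the mean is bounded
  near 0 comes from stochastic continuity.\<close>

lemma mean_zero: assumes "0 \<le> t" shows "mean i t = 0"
proof -
  have "((\<lambda>s. measure M {w \<in> space M. 1 < norm (L s w - L 0 w)}) \<longlongrightarrow> 0) (at 0)"
    using levy by (simp add: levy_process_def)
  then have "\<forall>\<^sub>F s in at 0. measure M {w \<in> space M. 1 < norm (L s w - L 0 w)} < 1/4"
    by (rule order_tendstoD) simp
  then obtain d where d: "d > 0"
    "\<And>s. s \<noteq> 0 \<Longrightarrow> \<bar>s\<bar> < d \<Longrightarrow> measure M {w \<in> space M. 1 < norm (L s w - L 0 w)} < 1/4"
    unfolding eventually_at by (auto simp: dist_real_def)
  \<comment> \<open>If \<open>\<bar>mean i s\<bar> > 2\<close>, then at every point either the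
    increment of \<open>L\<close> exceeds 1 in norm, which has probability below 1/4, or component
    \<open>i\<close> deviates from its mean by at least 1, which by Chebyshev has probability at
    most \<open>s * cov i i 1 < 1/2\<close>. These do not add up to 1. The summand 1 in the
    denominator avoids division by zero.\<close>
  define \<delta> where "\<delta> = min d (1 / (2 * (cov i i 1 + 1)))"
  have "mean i t = t * mean i 1"
  proof (rule additive_bounded_imp_linear[where \<delta> = \<delta> and K = 2])
    show "\<delta> > 0" using d(1) cov_self_nonneg[of i 1] by (simp add: \<delta>_def add_nonneg_pos)
    fix s assume s: "0 < s" "s < \<delta>"
    show "\<bar>mean i s\<bar> \<le> 2"
    proof (rule ccontr)
      assume big: "\<not> ?thesis"
      let ?A = "{w \<in> space M. 1 < norm (L s w - L 0 w)}"
      let ?B = "{w \<in> space M. 1 \<le> \<bar>incr 0 s i w - mean i s\<bar>}"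
      have "space M \<subseteq> ?A \<union> ?B"
      proof
        fix w assume "w \<in> space M"
        moreover have "\<bar>incr 0 s i w\<bar> \<le> norm (L s w - L 0 w)"
          unfolding incr_def by (rule component_le_norm_cart)
        ultimately show "w \<in> ?A \<union> ?B" using big by auto
      qed
      then have "1 \<le> measure M (?A \<union> ?B)"
        using prob_space finite_measure_mono[of "space M" "?A \<union> ?B"] by simp
      also have "\<dots> \<le> measure M ?A + measure M ?B"
        by (rule measure_subadditive) auto
      also have "measure M ?A < 1/4" using d(2)[of s] s by (simp add: \<delta>_def)
      also have "measure M ?B \<le> cov i i s"
        using Chebyshev_inequality[of "incr 0 s i" 1] L2D[OF incr_L2[of 0 s i]] s
        by (simp add: mean_def[symmetric] cov_def power2_eq_square)
      also have "cov i i s = s * cov i i 1" using s by (intro cov_linear) simp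
      finally have "3/4 < s * cov i i 1" by simp
      moreover have "s * (2 * (cov i i 1 + 1)) < 1"
        using s cov_self_nonneg[of i 1] by (simp add: \<delta>_def field_simps)
      ultimately show False using s by (simp add: algebra_simps)
    qed
  qed (use assms mean_add in auto)
  also have "mean i 1 = 0"
  proof -
    have "integrable M (L 1)"
      using L2D[OF L1_L2]
      by (intro integrable_norm_cancel[OF L2_imp_integrable]) (auto simp: L2_power2_iff)
    then have "(LINT w|M. L 1 w $ i) = 0"
      using integral_bounded_linear[OF bounded_linear_vec_nth, of M "L 1" i] L1_mean by simp
    moreover have "mean i 1 = (LINT w|M. L 1 w $ i)"
      unfolding mean_def by (rule integral_cong_AE) (use AE_L0 in \<open>auto simp: incr_def\<close>)
    ultimately show ?thesis by simp
  qed
  finally show ?thesis by simp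
qed

lemma cov_one: "cov i j 1 = \<Sigma> $ i $ j"
  unfolding cov_def second_moment_def
  by (simp add: mean_zero, rule integral_cong_AE) (use AE_L0 in \<open>auto simp: incr_def\<close>)

lemma incr_product_common_start:
  assumes "r \<le> s" "r \<le> t"
  shows "(LINT w|M. incr r s i w * incr r t j w) = (min s t - r) * \<Sigma> $ i $ j"
proof -
  have sq: "(LINT w|M. incr r s i w * incr r s j w) = (s - r) * \<Sigma> $ i $ j"
    if "r \<le> s" for s i j
    using cov_incr[OF that, of i j] that by (simp add: mean_zero cov_linear cov_one)
  have le: "(LINT w|M. incr r s i w * incr r t j w) = (s - r) * \<Sigma> $ i $ j"
    if "r \<le> s" "s \<le> t" for s t i j
  proof -
    have "(LINT w|M. incr r s i w * incr r t j w) =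
        (LINT w|M. incr r s i w * incr r s j w + incr r s i w * incr s t j w)"
      by (simp add: incr_split[of r t _ _ s] distrib_left)
    also have "\<dots> = (LINT w|M. incr r s i w * incr r s j w) + (LINT w|M. incr r s i w * incr s t j w)"
      using that by (intro Bochner_Integration.integral_add L2_times incr_L2) auto
    also have "\<dots> = (s - r) * \<Sigma> $ i $ j"
      using that by (simp add: sq incr_uncorrelated mean_zero)
    finally show ?thesis .
  qed
  have sym: "\<Sigma> $ i $ j = \<Sigma> $ j $ i"
    by (simp add: second_moment_def mult.commute)
  show ?thesis
  proof (cases "s \<le> t")
    case True
    then show ?thesis using le[of s t i j] assms by (simp add: min_def)
  next
    case False
    then show ?thesis
      using le[of t s j i] assms sym by (simp add: min_def mult.commute)
  qed
qed

text \<open>Both increments are written as differences of increments from a common origin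
  \<open>r\<close>. The resulting alternating sum of minima is the length of the overlap of the two
  intervals.\<close>

lemma incr_product:
  assumes "a \<le> b" "c \<le> d"
  shows "(LINT w|M. incr a b i w * incr c d j w) =
    measure lborel ({a<..b} \<inter> {c<..d}) * \<Sigma> $ i $ j"
proof -
  define r where "r = min a c"
  have r: "r \<le> a" "r \<le> c" "r \<le> b" "r \<le> d" using assms by (auto simp: r_def)
  note int = L2_times[OF incr_L2 incr_L2]
  have "(LINT w|M. incr a b i w * incr c d j w) =
      (LINT w|M. incr r b i w * incr r d j w - incr r b i w * incr r c j w
        - incr r a i w * incr r d j w + incr r a i w * incr r c j w)"
    by (simp add: incr_split[of r b _ _ a] incr_split[of r d _ _ c] algebra_simps)
  also have "\<dots> = (LINT w|M. incr r b i w * incr r d j w) - (LINT w|M. incr r b i w * incr r c j w)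
      - (LINT w|M. incr r a i w * incr r d j w) + (LINT w|M. incr r a i w * incr r c j w)"
    using r by (simp add: int)
  also have "\<dots> = (min b d - min b c - min a d + min a c) * \<Sigma> $ i $ j"
    using r by (simp add: incr_product_common_start algebra_simps)
  also have "min b d - min b c - min a d + min a c = measure lborel ({a<..b} \<inter> {c<..d})"
  proof -
    have "{a<..b} \<inter> {c<..d} = {max a c<..min b d}" by auto
    then show ?thesis using assms by (auto simp: min_def max_def)
  qed
  finally show ?thesis .
qed

end


subsection \<open>The isometry of the stochastic integral\<close>

context centred_levy
begin

lemma step_integral_nth:
  "step_integral L n t \<Phi> w $ i = (\<Sum>m<n. \<Sum>k\<in>UNIV. \<Phi> m $ i $ k * incr (t m) (t (Suc m)) k w)"
  by (simp add: step_integral_def matrix_vector_mult_def incr_def)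

lemma step_fun_nth:
  "step_fun n t \<Phi> u $ i $ k = (\<Sum>m<n. \<Phi> m $ i $ k * indicator {t m<..t (Suc m)} u)"
  by (simp add: step_fun_def mult.commute)

lemma step_integral_nth_L2:
  "mono t \<Longrightarrow> square_integrable M (\<lambda>w. step_integral L n t \<Phi> w $ i)"
  unfolding step_integral_nth
  by (intro L2_sum L2_mult_left incr_L2) (auto simp: mono_def)

lemma step_fun_nth_L2: "square_integrable lborel (\<lambda>u. step_fun n t \<Phi> u $ i $ k)"
  unfolding step_fun_nth
proof (intro L2_sum L2_mult_left)
  have "(\<lambda>u. (norm (indicator {a<..b} u :: real))\<^sup>2) = indicator {a<..b}" for a b :: real
    by (auto simp: indicator_def)
  moreover have "integrable lborel (indicator {a<..b} :: real \<Rightarrow> real)" for a b :: real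
    by (cases "a \<le> b") simp_all
  ultimately show "square_integrable lborel (indicator {t m<..t (Suc m)} :: real \<Rightarrow> real)" for m
    by (simp add: square_integrable_def)
qed

text \<open>A pair of cells contributes the length of its overlap times an entry of \<Sigma>, and
  that length is also the integral of the product of the indicators. Working with overlaps avoids a
  common refinement of the two partitions.\<close>

lemma step_isometry:
  assumes "mono s" "mono t"
  shows "(LINT w|M. step_integral L n s \<Phi> w $ i * step_integral L m t \<Psi> w $ j) =
    (\<Sum>k\<in>UNIV. \<Sum>l\<in>UNIV. \<Sigma> $ k $ l *
      (\<integral>u. step_fun n s \<Phi> u $ i $ k * step_fun m t \<Psi> u $ j $ l \<partial>lborel))"
proof -
  define S where "S = \<Sigma>"
  define I where "I a = {s a<..s (Suc a)}" for a
  define J where "J a = {t a<..t (Suc a)}" for a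
  have le: "s a \<le> s (Suc a)" "t a \<le> t (Suc a)" for a
    using assms by (auto simp: mono_def)
  have int: "integrable M (\<lambda>w. incr (s a) (s (Suc a)) k w * incr (t b) (t (Suc b)) l w)" for a b k l
    by (intro L2_times incr_L2 le)
  have product: "(LINT w|M. incr (s a) (s (Suc a)) k w * incr (t b) (t (Suc b)) l w) =
      measure lborel (I a \<inter> J b) * S $ k $ l" for a b k l
    unfolding I_def J_def S_def by (intro incr_product le)
  have ind_int: "(\<integral>u. indicator (I a) u * indicator (J b) u \<partial>lborel) = measure lborel (I a \<inter> J b)"
    and ind_integrable: "integrable lborel (\<lambda>u. indicator (I a) u * indicator (J b) u :: real)" for a b
  proof -
    have *: "emeasure lborel (I a \<inter> J b) < \<infinity>"
      by (rule le_less_trans[OF emeasure_mono[of _ "I a"]]) (auto simp: I_def J_def le)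
    show "(\<integral>u. indicator (I a) u * indicator (J b) u \<partial>lborel) = measure lborel (I a \<inter> J b)"
      by (simp flip: indicator_inter_arith)
    show "integrable lborel (\<lambda>u. indicator (I a) u * indicator (J b) u :: real)"
      using * by (simp flip: indicator_inter_arith add: I_def J_def)
  qed
  have "(LINT w|M. step_integral L n s \<Phi> w $ i * step_integral L m t \<Psi> w $ j) =
      (LINT w|M. (\<Sum>a<n. \<Sum>k\<in>UNIV. \<Sum>b<m. \<Sum>l\<in>UNIV. \<Phi> a $ i $ k * \<Psi> b $ j $ l *
        (incr (s a) (s (Suc a)) k w * incr (t b) (t (Suc b)) l w)))"
    unfolding step_integral_nth
    by (simp only: sum_distrib_right) (simp only: sum_distrib_left mult.assoc mult.left_commute)
  also have "\<dots> = (\<Sum>a<n. \<Sum>k\<in>UNIV. \<Sum>b<m. \<Sum>l\<in>UNIV. \<Phi> a $ i $ k * \<Psi> b $ j $ l *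
      (measure lborel (I a \<inter> J b) * S $ k $ l))"
    by (simp add: int product)
  also have "\<dots> = (\<Sum>k\<in>UNIV. \<Sum>a<n. \<Sum>l\<in>UNIV. \<Sum>b<m. \<Phi> a $ i $ k * \<Psi> b $ j $ l *
      (measure lborel (I a \<inter> J b) * S $ k $ l))"
    by (subst sum.swap) (intro sum.cong refl sum.swap)
  also have "\<dots> = (\<Sum>k\<in>UNIV. \<Sum>l\<in>UNIV. \<Sum>a<n. \<Sum>b<m. \<Phi> a $ i $ k * \<Psi> b $ j $ l *
      (measure lborel (I a \<inter> J b) * S $ k $ l))"
    by (intro sum.cong refl sum.swap)
  also have "\<dots> = (\<Sum>k\<in>UNIV. \<Sum>l\<in>UNIV. S $ k $ l *
      (\<integral>u. step_fun n s \<Phi> u $ i $ k * step_fun m t \<Psi> u $ j $ l \<partial>lborel))"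
  proof (intro sum.cong refl)
    fix k l
    have "(\<integral>u. step_fun n s \<Phi> u $ i $ k * step_fun m t \<Psi> u $ j $ l \<partial>lborel) =
        (\<integral>u. (\<Sum>a<n. \<Sum>b<m. \<Phi> a $ i $ k * \<Psi> b $ j $ l * (indicator (I a) u * indicator (J b) u)) \<partial>lborel)"
      unfolding step_fun_nth I_def J_def
      by (simp only: sum_distrib_right) (simp only: sum_distrib_left mult.assoc mult.left_commute)
    also have "\<dots> = (\<Sum>a<n. \<Sum>b<m. \<Phi> a $ i $ k * \<Psi> b $ j $ l * measure lborel (I a \<inter> J b))"
      by (simp add: ind_integrable ind_int)
    finally show "(\<Sum>a<n. \<Sum>b<m. \<Phi> a $ i $ k * \<Psi> b $ j $ l * (measure lborel (I a \<inter> J b) * S $ k $ l)) =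
        S $ k $ l * (\<integral>u. step_fun n s \<Phi> u $ i $ k * step_fun m t \<Psi> u $ j $ l \<partial>lborel)"
      by (simp add: sum_distrib_left mult_ac)
  qed
  finally show ?thesis by (simp add: S_def)
qed

lemma levy_integral_approx:
  assumes "has_levy_integral M L f J"
  obtains n t \<Phi> where "\<And>j::nat. mono (t j)"
    "\<And>i k. L2_tendsto lborel (\<lambda>j u. step_fun (n j) (t j) (\<Phi> j) u $ i $ k) (\<lambda>u. f u $ i $ k) sequentially"
    "\<And>i. L2_tendsto M (\<lambda>j w. step_integral L (n j) (t j) (\<Phi> j) w $ i) (\<lambda>w. J w $ i) sequentially"
proof -
  obtain n t \<Phi> where *: "\<And>j::nat. mono (t j)"
    "L2_tendsto lborel (\<lambda>j. step_fun (n j) (t j) (\<Phi> j)) f sequentially"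
    "L2_tendsto M (\<lambda>j. step_integral L (n j) (t j) (\<Phi> j)) J sequentially"
    using assms unfolding has_levy_integral_def by blast
  show ?thesis
  proof (rule that[OF *(1)])
    have "norm (step_fun (n j) (t j) (\<Phi> j) u $ i $ k - f u $ i $ k) \<le> norm (step_fun (n j) (t j) (\<Phi> j) u - f u)"
      for j u i k
      using component_le_norm_cart[of "(step_fun (n j) (t j) (\<Phi> j) u - f u) $ i" k]
        Finite_Cartesian_Product.norm_nth_le[of "step_fun (n j) (t j) (\<Phi> j) u - f u" i]
      by simp
    then show "L2_tendsto lborel (\<lambda>j u. step_fun (n j) (t j) (\<Phi> j) u $ i $ k) (\<lambda>u. f u $ i $ k) sequentially"
      for i k
      by (rule L2_tendsto_bound[OF *(2)])
    have "norm (step_integral L (n j) (t j) (\<Phi> j) w $ i - J w $ i)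
        \<le> norm (step_integral L (n j) (t j) (\<Phi> j) w - J w)" for j i w
      using component_le_norm_cart[of "step_integral L (n j) (t j) (\<Phi> j) w - J w" i] by simp
    then show "L2_tendsto M (\<lambda>j w. step_integral L (n j) (t j) (\<Phi> j) w $ i) (\<lambda>w. J w $ i) sequentially" for i
      by (rule L2_tendsto_bound[OF *(3)])
  qed
qed

lemma levy_integral_nth_L2:
  assumes "has_levy_integral M L f J"
  shows "square_integrable M (\<lambda>w. J w $ i)"
proof -
  have "J \<in> borel_measurable M"
    using assms by (simp add: has_levy_integral_def)
  from measurable_compose[OF this vec_nth_measurable]
  have meas: "(\<lambda>w. J w $ i) \<in> borel_measurable M" .
  from assms obtain n t \<Phi> where "\<And>j::nat. mono (t j)"
    "\<And>i. L2_tendsto M (\<lambda>j w. step_integral L (n j) (t j) (\<Phi> j) w $ i) (\<lambda>w. J w $ i) sequentially"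
    by (rule levy_integral_approx) (rule that)
  from L2_tendsto_square_integrable[OF this(2) trivial_limit_sequentially
      step_integral_nth_L2[OF this(1)] meas]
  show ?thesis .
qed

lemma levy_integrand_nth_L2:
  assumes "has_levy_integral M L f J"
  shows "square_integrable lborel (\<lambda>u. f u $ i $ k)"
proof (rule L2_bound)
  show f: "square_integrable lborel f"
    using assms by (simp add: has_levy_integral_def)
  have "(\<lambda>x. x $ i $ k) \<in> borel_measurable borel"
    by (intro borel_measurable_continuous_onI continuous_intros)
  from measurable_compose[OF L2_measurable[OF f] this]
  show "(\<lambda>u. f u $ i $ k) \<in> borel_measurable lborel" .
  show "norm (f u $ i $ k) \<le> norm (f u)" for u
    using component_le_norm_cart[of "f u $ i" k] Finite_Cartesian_Product.norm_nth_le[of "f u" i]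
    by simp
qed

lemma levy_integral_isometry_nth:
  assumes f: "has_levy_integral M L f J" and g: "has_levy_integral M L g K"
  shows "(LINT w|M. J w $ i * K w $ j) = (\<Sum>k\<in>UNIV. \<Sum>l\<in>UNIV. \<Sigma> $ k $ l *
      (\<integral>u. f u $ i $ k * g u $ j $ l \<partial>lborel))"
proof -
  obtain n s \<Phi> where 1: "\<And>j::nat. mono (s j)"
    "\<And>i k. L2_tendsto lborel (\<lambda>j u. step_fun (n j) (s j) (\<Phi> j) u $ i $ k) (\<lambda>u. f u $ i $ k) sequentially"
    "\<And>i. L2_tendsto M (\<lambda>j w. step_integral L (n j) (s j) (\<Phi> j) w $ i) (\<lambda>w. J w $ i) sequentially"
    using f by (rule levy_integral_approx) (rule that)
  obtain m t \<Psi> where 2: "\<And>j::nat. mono (t j)"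
    "\<And>i k. L2_tendsto lborel (\<lambda>j u. step_fun (m j) (t j) (\<Psi> j) u $ i $ k) (\<lambda>u. g u $ i $ k) sequentially"
    "\<And>i. L2_tendsto M (\<lambda>j w. step_integral L (m j) (t j) (\<Psi> j) w $ i) (\<lambda>w. K w $ i) sequentially"
    using g by (rule levy_integral_approx) (rule that)
  have "(\<lambda>r. LINT w|M. step_integral L (n r) (s r) (\<Phi> r) w $ i * step_integral L (m r) (t r) (\<Psi> r) w $ j)
      \<longlonglongrightarrow> (LINT w|M. J w $ i * K w $ j)"
    by (intro L2_tendsto_integral_mult 1 2 step_integral_nth_L2 levy_integral_nth_L2[OF f]
        levy_integral_nth_L2[OF g])
  moreover have "(\<lambda>r. LINT w|M. step_integral L (n r) (s r) (\<Phi> r) w $ i * step_integral L (m r) (t r) (\<Psi> r) w $ j)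
      \<longlonglongrightarrow> (\<Sum>k\<in>UNIV. \<Sum>l\<in>UNIV. \<Sigma> $ k $ l *
      (\<integral>u. f u $ i $ k * g u $ j $ l \<partial>lborel))"
    unfolding step_isometry[OF 1(1) 2(1)]
    by (intro tendsto_sum tendsto_mult_left L2_tendsto_integral_mult 1 2 step_fun_nth_L2
        levy_integrand_nth_L2[OF f] levy_integrand_nth_L2[OF g])
  ultimately show ?thesis by (rule LIMSEQ_unique)
qed

lemma levy_integral_isometry:
  assumes f: "has_levy_integral M L f J" and g: "has_levy_integral M L g K"
  shows "(LINT w|M. (x \<bullet> J w) * (y \<bullet> K w)) =
      (\<integral>u. (x v* f u) \<bullet> (\<Sigma> *v (y v* g u)) \<partial>lborel)"
    and "integrable lborel (\<lambda>u. (x v* f u) \<bullet> (\<Sigma> *v (y v* g u)))"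
proof -
  define S where "S = \<Sigma>"
  have int: "integrable lborel (\<lambda>u. f u $ i $ k * g u $ j $ l)" for i j k l
    by (rule L2_times[OF levy_integrand_nth_L2[OF f] levy_integrand_nth_L2[OF g]])
  have expand: "(x v* f u) \<bullet> (S *v (y v* g u)) = (\<Sum>i\<in>UNIV. \<Sum>j\<in>UNIV. x $ i * y $ j *
      (\<Sum>k\<in>UNIV. \<Sum>l\<in>UNIV. S $ k $ l * (f u $ i $ k * g u $ j $ l)))" for u
  proof -
    have "(x v* f u) \<bullet> (S *v (y v* g u)) = (\<Sum>k\<in>UNIV. (\<Sum>i\<in>UNIV. f u $ i $ k * x $ i) *
        (\<Sum>l\<in>UNIV. S $ k $ l * (\<Sum>j\<in>UNIV. g u $ j $ l * y $ j)))"
      by (simp add: inner_vec_def vector_matrix_mult_def matrix_vector_mult_def mult.commute)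
    also have "\<dots> = (\<Sum>k\<in>UNIV. \<Sum>i\<in>UNIV. \<Sum>l\<in>UNIV. \<Sum>j\<in>UNIV.
        f u $ i $ k * x $ i * (S $ k $ l * (g u $ j $ l * y $ j)))"
      by (simp only: sum_distrib_right) (simp only: sum_distrib_left)
    also have "\<dots> = (\<Sum>k\<in>UNIV. \<Sum>i\<in>UNIV. \<Sum>l\<in>UNIV. \<Sum>j\<in>UNIV.
        x $ i * y $ j * (S $ k $ l * (f u $ i $ k * g u $ j $ l)))"
      by (intro sum.cong refl) (simp only: mult_ac)
    also have "\<dots> = (\<Sum>i\<in>UNIV. \<Sum>k\<in>UNIV. \<Sum>j\<in>UNIV. \<Sum>l\<in>UNIV.
        x $ i * y $ j * (S $ k $ l * (f u $ i $ k * g u $ j $ l)))"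
      by (subst sum.swap) (intro sum.cong refl sum.swap)
    also have "\<dots> = (\<Sum>i\<in>UNIV. \<Sum>j\<in>UNIV. \<Sum>k\<in>UNIV. \<Sum>l\<in>UNIV.
        x $ i * y $ j * (S $ k $ l * (f u $ i $ k * g u $ j $ l)))"
      by (intro sum.cong refl sum.swap)
    finally show ?thesis by (simp add: sum_distrib_left)
  qed
  show "integrable lborel (\<lambda>u. (x v* f u) \<bullet> (\<Sigma> *v (y v* g u)))"
    unfolding S_def[symmetric] expand by (simp add: int)
  have "(LINT w|M. (x \<bullet> J w) * (y \<bullet> K w)) =
      (LINT w|M. (\<Sum>i\<in>UNIV. \<Sum>j\<in>UNIV. x $ i * y $ j * (J w $ i * K w $ j)))"
    unfolding inner_vec_def sum_product by (simp add: mult_ac)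
  also have "\<dots> = (\<Sum>i\<in>UNIV. \<Sum>j\<in>UNIV. x $ i * y $ j * (LINT w|M. J w $ i * K w $ j))"
    using L2_times[OF levy_integral_nth_L2[OF f] levy_integral_nth_L2[OF g]] by simp
  also have "\<dots> = (\<integral>u. (x v* f u) \<bullet> (S *v (y v* g u)) \<partial>lborel)"
    unfolding expand levy_integral_isometry_nth[OF f g] by (simp add: int S_def)
  finally show "(LINT w|M. (x \<bullet> J w) * (y \<bullet> K w)) =
      (\<integral>u. (x v* f u) \<bullet> (\<Sigma> *v (y v* g u)) \<partial>lborel)"
    by (simp add: S_def)
qed

end


subsection \<open>Second-order structure of the state process\<close>

locale levy_state = centred_levy M L for M :: "'w measure" and L :: "real \<Rightarrow> 'w \<Rightarrow> real^'k" +
  fixes \<AA> :: "real^'n^'n" and \<BB> :: "real^'k^'n" and X :: "real \<Rightarrow> 'w \<Rightarrow> real^'n"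
  assumes state: "\<And>t. has_levy_integral M L
    (\<lambda>u. indicator {..t} u *\<^sub>R (mat_exp ((t - u) *\<^sub>R \<AA>) ** \<BB>)) (X t)"
begin

text \<open>The observation vector is moved in place of the state: \<open>x \<bullet> (mat_exp (u
  *\<^sub>R \<AA>) *v y) = flow u x \<bullet> y\<close>.\<close>

definition flow :: "real \<Rightarrow> real^'n \<Rightarrow> real^'n"
  where "flow u x = mat_exp (u *\<^sub>R transpose \<AA>) *v x"

definition form :: "real^'n \<Rightarrow> real^'n \<Rightarrow> real"
  where "form x y = (x v* \<BB>) \<bullet> (\<Sigma> *v (y v* \<BB>))"

text \<open>The finite-horizon controllability Gramian of the state equation, weighted with \<Sigma>
  and seen as a bilinear form.\<close>

abbreviation (input) gram :: "real \<Rightarrow> real^'n \<Rightarrow> real^'n \<Rightarrow> real"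
  where "gram h x y \<equiv> integral {0..h} (\<lambda>u. form (flow u x) (flow u y))"

abbreviation (input) tpow :: "nat \<Rightarrow> real^'n \<Rightarrow> real^'n"
  where "tpow n x \<equiv> mat_pow (transpose \<AA>) n *v x"

definition scov :: "real^'n \<Rightarrow> real^'n \<Rightarrow> real"
  where "scov x y = (LINT w|M. (x \<bullet> X 0 w) * (y \<bullet> X 0 w))"

lemma flow_zero [simp]: "flow 0 x = x"
  by (simp add: flow_def mat_exp_zero)

lemma flow_add: "flow (s + t) x = flow s (flow t x)"
  by (simp add: flow_def mat_exp_add matrix_vector_mul_assoc)

lemma flow_has_derivative:
  "((\<lambda>u. flow u x) has_vector_derivative transpose \<AA> *v flow u x) (at u within A)"
  unfolding flow_def by (rule mat_exp_vec_has_derivative)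

lemma flow_continuous: "continuous_on A f \<Longrightarrow> continuous_on A (\<lambda>u. flow (f u) x)"
  using continuous_on_compose2[OF mat_exp_vec_continuous[of UNIV "transpose \<AA>" x], of A f]
  by (simp add: flow_def)

lemma flow_tendsto: "((\<lambda>u. flow u x) \<longlongrightarrow> x) (at 0 within A)"
  using continuous_on_tendsto_compose[OF flow_continuous[of UNIV "\<lambda>u. u" x] tendsto_ident_at[of 0 A]]
  by simp

lemma form_bounded_bilinear: "bounded_bilinear form"
proof -
  have "bounded_linear (\<lambda>x. x v* \<BB>)"
    using matrix_vector_mul_bounded_linear[of "transpose \<BB>"] unfolding transpose_matrix_vector .
  from bounded_bilinear.comp[OF bounded_bilinear_inner this
      bounded_linear_compose[OF matrix_vector_mul_bounded_linear this]]
  show ?thesis unfolding form_def .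
qed

interpretation form: bounded_bilinear form
  by (rule form_bounded_bilinear)

lemma form_commute: "form x y = form y x"
proof -
  have "transpose (\<Sigma>) = \<Sigma>"
    by (simp add: second_moment_def transpose_def vec_eq_iff mult.commute)
  then show ?thesis
    unfolding form_def by (metis dot_lmul_matrix inner_commute vector_transpose_matrix)
qed

lemma form_flow_continuous:
  "continuous_on A f \<Longrightarrow> continuous_on A g \<Longrightarrow> continuous_on A (\<lambda>u. form (flow (f u) x) (flow (g u) y))"
  by (intro form.continuous_on flow_continuous)

lemma state_nth_L2: "square_integrable M (\<lambda>w. X t w $ i)"
  using state by (rule levy_integral_nth_L2)

lemma state_L2: "square_integrable M (\<lambda>w. x \<bullet> X t w)"
  unfolding inner_vec_def inner_real_def
  by (intro L2_sum L2_mult_left state_nth_L2)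

lemma row_integrand:
  "x v* (indicator {..t} u *\<^sub>R (mat_exp ((t - u) *\<^sub>R \<AA>) ** \<BB>)) =
    (indicator {..t} u :: real) *\<^sub>R (flow (t - u) x v* \<BB>)"
proof -
  have "x v* (indicator {..t} u *\<^sub>R (mat_exp ((t - u) *\<^sub>R \<AA>) ** \<BB>)) =
      (indicator {..t} u :: real) *\<^sub>R (x v* (mat_exp ((t - u) *\<^sub>R \<AA>) ** \<BB>))"
    by (simp add: vector_matrix_mult_def vec_eq_iff sum_distrib_left mult_ac)
  then show ?thesis
    by (simp add: flow_def mat_exp_transpose vector_matrix_mul_assoc)
qed

lemma state_product:
  "(LINT w|M. (x \<bullet> X t w) * (y \<bullet> X s w)) =
    (\<integral>u. indicator {..min t s} u * form (flow (t - u) x) (flow (s - u) y) \<partial>lborel)"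
  and state_product_integrable:
  "integrable lborel (\<lambda>u. indicator {..min t s} u * form (flow (t - u) x) (flow (s - u) y))"
proof -
  have eq: "(x v* (indicator {..t} u *\<^sub>R (mat_exp ((t - u) *\<^sub>R \<AA>) ** \<BB>))) \<bullet>
      (\<Sigma> *v (y v* (indicator {..s} u *\<^sub>R (mat_exp ((s - u) *\<^sub>R \<AA>) ** \<BB>)))) =
      indicator {..min t s} u * form (flow (t - u) x) (flow (s - u) y)" for u
    unfolding row_integrand by (auto simp: form_def indicator_def)
  show "(LINT w|M. (x \<bullet> X t w) * (y \<bullet> X s w)) =
      (\<integral>u. indicator {..min t s} u * form (flow (t - u) x) (flow (s - u) y) \<partial>lborel)"
    using levy_integral_isometry(1)[OF state[of t] state[of s], of x y] unfolding eq .
  show "integrable lborel (\<lambda>u. indicator {..min t s} u * form (flow (t - u) x) (flow (s - u) y))"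
    using levy_integral_isometry(2)[OF state[of t] state[of s], of x y] unfolding eq .
qed

text \<open>Only the noise up to \<open>s\<close> is shared by the two states. Shifting time by
  \<open>s\<close> makes this stationary, and the semigroup law splits \<open>flow (t - s)\<close>
  off the later state.\<close>

lemma state_cov:
  assumes "s \<le> t"
  shows "(LINT w|M. (x \<bullet> X t w) * (y \<bullet> X s w)) = scov (flow (t - s) x) y"
proof -
  have "(LINT w|M. (x \<bullet> X t w) * (y \<bullet> X s w)) =
      (\<integral>u. indicator {..min t s} (s + 1 * u) * form (flow (t - (s + 1 * u)) x) (flow (s - (s + 1 * u)) y) \<partial>lborel)"
    unfolding state_product by (subst lborel_integral_real_affine[where c = 1 and t = s]) simp_all
  also have "\<dots> = (\<integral>u. indicator {..min 0 0} u * form (flow (0 - u) (flow (t - s) x)) (flow (0 - u) y) \<partial>lborel)"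
  proof (rule Bochner_Integration.integral_cong[OF refl])
    fix u :: real
    have "flow (t - (s + 1 * u)) x = flow (0 - u) (flow (t - s) x)"
      unfolding flow_add[symmetric] by (simp add: algebra_simps)
    then show "indicator {..min t s} (s + 1 * u) * form (flow (t - (s + 1 * u)) x) (flow (s - (s + 1 * u)) y) =
        indicator {..min 0 0} u * form (flow (0 - u) (flow (t - s) x)) (flow (0 - u) y)"
      using assms by (simp add: indicator_def)
  qed
  also have "\<dots> = scov (flow (t - s) x) y"
    unfolding scov_def state_product[of _ 0 _ 0] ..
  finally show ?thesis .
qed

lemma scov_bilinear:
  "scov (x + y) z = scov x z + scov y z" "scov (x - y) z = scov x z - scov y z"
  "scov (c *\<^sub>R x) z = c * scov x z" "scov x y = scov y x"
proof -
  note int = L2_times[OF state_L2 state_L2]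
  show "scov (x + y) z = scov x z + scov y z" "scov (x - y) z = scov x z - scov y z"
    by (simp_all add: scov_def inner_add_left inner_diff_left distrib_right left_diff_distrib int)
  show "scov (c *\<^sub>R x) z = c * scov x z"
    by (simp add: scov_def mult.assoc)
  show "scov x y = scov y x"
    by (simp add: scov_def mult.commute)
qed

text \<open>Expresses \<open>scov\<close> by finitely many numbers, which makes its continuity
  evident.\<close>

lemma scov_matrix: "scov x y = (\<Sum>i\<in>UNIV. \<Sum>j\<in>UNIV. x $ i * y $ j * scov (axis i 1) (axis j 1))"
proof -
  have "scov x y = (LINT w|M. (\<Sum>i\<in>UNIV. \<Sum>j\<in>UNIV. x $ i * y $ j * (X 0 w $ i * X 0 w $ j)))"
    unfolding scov_def inner_vec_def sum_product by (simp add: mult_ac)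
  also have "\<dots> = (\<Sum>i\<in>UNIV. \<Sum>j\<in>UNIV. x $ i * y $ j * (LINT w|M. X 0 w $ i * X 0 w $ j))"
    using L2_times[OF state_nth_L2 state_nth_L2] by simp
  also have "\<dots> = (\<Sum>i\<in>UNIV. \<Sum>j\<in>UNIV. x $ i * y $ j * scov (axis i 1) (axis j 1))"
    by (simp add: scov_def inner_axis')
  finally show ?thesis .
qed

lemma scov_tendsto_0:
  assumes "(f \<longlongrightarrow> 0) F" shows "((\<lambda>h. scov (f h) (f h)) \<longlongrightarrow> 0) F"
proof -
  have "((\<lambda>h. \<Sum>i\<in>UNIV. \<Sum>j\<in>UNIV. f h $ i * f h $ j * scov (axis i 1) (axis j 1)) \<longlongrightarrow>
      (\<Sum>i\<in>UNIV. \<Sum>j\<in>UNIV. 0 $ i * 0 $ j * scov (axis i 1) (axis j 1))) F"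
    by (intro tendsto_intros tendsto_vec_nth assms)
  then show ?thesis
    by (subst scov_matrix) simp
qed

text \<open>The integrated Lyapunov equation: the covariance at time \<open>h\<close> is the part
  due to noise before 0, carried along by the flow, plus the part due to noise during
  \<open>[0, h]\<close>.\<close>

lemma scov_flow:
  assumes "0 \<le> h"
  shows "scov x y = scov (flow h x) (flow h y) + integral {0..h} (\<lambda>s. form (flow (h - s) x) (flow (h - s) y))"
proof -
  define g where "g u = form (flow (h - u) x) (flow (h - u) y)" for u
  have int: "integrable lborel (\<lambda>u. indicator {..h} u * g u)"
    unfolding g_def using state_product_integrable[of h h x y] by simp
  have int1: "integrable lborel (\<lambda>u. indicator {..0} u * g u)"
  proof -
    have "(\<lambda>u. indicator {..0} u * g u) = (\<lambda>u. indicator {..0} u *\<^sub>R (indicator {..h} u * g u))"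
      using assms by (auto simp: indicator_def fun_eq_iff)
    then show ?thesis using integrable_mult_indicator[OF _ int, of "{..0}"] by simp
  qed
  have sint2: "set_integrable lborel {0..h} g"
    unfolding g_def by (intro borel_integrable_atLeastAtMost' form_flow_continuous continuous_intros)
  then have int2: "integrable lborel (\<lambda>u. indicator {0..h} u * g u)"
    by (simp add: set_integrable_def)
  have "scov x y = (\<integral>u. indicator {..h} u * g u \<partial>lborel)"
    using state_cov[of h h x y] state_product[of x h y h] by (simp add: g_def)
  also have "\<dots> = (\<integral>u. indicator {..0} u * g u + indicator {0..h} u * g u \<partial>lborel)"
  proof (rule integral_cong_AE)
    show "AE u in lborel. indicator {..h} u * g u = indicator {..0} u * g u + indicator {0..h} u * g u"
      \<comment> \<open>The point 0 belongs to both pieces.\<close>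
      using AE_lborel_singleton[of 0] by eventually_elim (use assms in \<open>auto simp: indicator_def\<close>)
  qed (use int int1 int2 in auto)
  also have "\<dots> = (\<integral>u. indicator {..0} u * g u \<partial>lborel) + (\<integral>u. indicator {0..h} u * g u \<partial>lborel)"
    using int1 int2 by simp
  also have "(\<integral>u. indicator {0..h} u * g u \<partial>lborel) = integral {0..h} g"
    using set_borel_integral_eq_integral(2)[OF sint2] by (simp add: set_lebesgue_integral_def)
  also have "(\<integral>u. indicator {..0} u * g u \<partial>lborel) = scov (flow h x) (flow h y)"
  proof -
    have "g u = form (flow (0 - u) (flow h x)) (flow (0 - u) (flow h y))" for u
      unfolding g_def flow_add[symmetric] by simp
    then show ?thesis
      unfolding scov_def state_product by simp
  qed
  finally show ?thesis by (simp add: g_def)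
qed

text \<open>A version of \<open>x \<bullet>\<close> the integral of
  \<open>mat_exp ((t + h - u) *\<^sub>R \<AA>) ** \<BB>\<close> against \<open>L\<close> over
  \<open>(t, t + h]\<close>. As a difference of states, all its moments follow from
  \<open>state_cov\<close>, and no stochastic integral over a bounded interval has to be
  constructed.\<close>

definition noise :: "real^'n \<Rightarrow> real \<Rightarrow> real \<Rightarrow> 'w \<Rightarrow> real"
  where "noise x t h w = x \<bullet> X (t + h) w - flow h x \<bullet> X t w"

lemma noise_L2: "square_integrable M (noise x t h)"
  unfolding noise_def by (intro L2_diff state_L2)

text \<open>Both terms of the noise have the same covariance with \<open>X r\<close>, because
  \<open>flow (t + h - r) x = flow (t - r) (flow h x)\<close>.\<close>

lemma noise_orthogonal:
  assumes "0 \<le> h" "r \<le> t"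
  shows "(LINT w|M. noise x t h w * (y \<bullet> X r w)) = 0"
proof -
  note int = L2_times[OF state_L2 state_L2]
  have "(LINT w|M. noise x t h w * (y \<bullet> X r w)) =
      (LINT w|M. (x \<bullet> X (t + h) w) * (y \<bullet> X r w)) - (LINT w|M. (flow h x \<bullet> X t w) * (y \<bullet> X r w))"
    by (simp add: noise_def left_diff_distrib int)
  also have "\<dots> = scov (flow (t + h - r) x) y - scov (flow (t - r) (flow h x)) y"
    using assms by (simp add: state_cov)
  also have "\<dots> = 0"
    by (simp add: flow_add[symmetric] algebra_simps)
  finally show ?thesis .
qed

text \<open>For \<open>h \<le> h'\<close> orthogonality allows the later noise to be replaced by the
  full state at \<open>t + h'\<close>; the two remaining state covariances differ by exactly the
  integral in \<open>scov_flow\<close>.\<close>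

lemma noise_cov:
  assumes "0 \<le> h" "0 \<le> h'"
  shows "(LINT w|M. noise x t h w * noise y t h' w) =
    integral {0..min h h'} (\<lambda>s. form (flow (h - s) x) (flow (h' - s) y))"
proof -
  have *: "(LINT w|M. noise x t h w * noise y t h' w) =
      integral {0..h} (\<lambda>s. form (flow (h - s) x) (flow (h' - s) y))" if "0 \<le> h" "h \<le> h'" for h h' x y
  proof -
    note int = L2_times[OF state_L2 state_L2] L2_times[OF noise_L2 state_L2]
    have "(LINT w|M. noise x t h w * noise y t h' w) =
        (LINT w|M. noise x t h w * (y \<bullet> X (t + h') w) - noise x t h w * (flow h' y \<bullet> X t w))"
      by (simp add: noise_def[of y] right_diff_distrib)
    also have "\<dots> = (LINT w|M. noise x t h w * (y \<bullet> X (t + h') w))"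
      using that by (simp add: int noise_orthogonal)
    also have "\<dots> = (LINT w|M. (y \<bullet> X (t + h') w) * (x \<bullet> X (t + h) w) - (y \<bullet> X (t + h') w) * (flow h x \<bullet> X t w))"
      by (simp add: noise_def algebra_simps)
    also have "\<dots> = scov (flow (h' - h) y) x - scov (flow h' y) (flow h x)"
      using that by (simp add: int state_cov)
    also have "flow h' y = flow h (flow (h' - h) y)"
      unfolding flow_add[symmetric] by simp
    also have "scov (flow (h' - h) y) x - scov (flow h (flow (h' - h) y)) (flow h x) =
        integral {0..h} (\<lambda>s. form (flow (h - s) (flow (h' - h) y)) (flow (h - s) x))"
      using scov_flow[OF that(1), of "flow (h' - h) y" x] by simp
    also have "\<dots> = integral {0..h} (\<lambda>s. form (flow (h - s) x) (flow (h' - s) y))"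
      unfolding flow_add[symmetric] by (simp add: form_commute)
    finally show ?thesis .
  qed
  show ?thesis
  proof (cases "h \<le> h'")
    case True
    then show ?thesis using * assms by simp
  next
    case False
    then show ?thesis
      using *[of h' h y x] assms by (simp add: mult.commute form_commute)
  qed
qed

end


subsection \<open>Mean-square derivatives of the state process\<close>

context levy_state
begin

interpretation form: bounded_bilinear form
  by (rule form_bounded_bilinear)

lemma flow_quotient: "((\<lambda>h. (1 / h) *\<^sub>R (flow h x - x)) \<longlongrightarrow> transpose \<AA> *v x) (at 0 within A)"
proof (rule vec_tendstoI)
  fix i
  have "((\<lambda>u. flow u x $ i) has_real_derivative (transpose \<AA> *v flow 0 x) $ i) (at 0 within A)"
    unfolding has_real_derivative_iff_has_vector_derivative
    by (rule bounded_linear.has_vector_derivative[OF bounded_linear_vec_nth flow_has_derivative])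
  then show "((\<lambda>h. ((1 / h) *\<^sub>R (flow h x - x)) $ i) \<longlongrightarrow> (transpose \<AA> *v x) $ i) (at 0 within A)"
    unfolding has_field_derivative_iff by simp
qed

lemma scov_scaleR: "scov (k *\<^sub>R y) (k *\<^sub>R y) = k\<^sup>2 * scov y y"
proof -
  have "scov (k *\<^sub>R y) (k *\<^sub>R y) = k * scov (k *\<^sub>R y) y"
    using scov_bilinear(3)[of k y "k *\<^sub>R y"] scov_bilinear(4)[of y "k *\<^sub>R y"] by simp
  also have "\<dots> = k\<^sup>2 * scov y y"
    by (simp add: scov_bilinear(3) power2_eq_square)
  finally show ?thesis .
qed

lemma form_flow_integral_has_derivative:
  "((\<lambda>h. gram h x y) has_real_derivative
      form (flow h x) (flow h y)) (at h within {0..1})" if "h \<in> {0..1}"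
  unfolding has_real_derivative_iff_has_vector_derivative
  by (rule integral_has_vector_derivative[OF form_flow_continuous that]) (auto intro: continuous_intros)

lemma form_flow_integral_reflect:
  "integral {0..h} (\<lambda>s. form (flow (h - s) x) (flow (h - s) y)) = gram h x y"
proof -
  have "integral {0..h} (\<lambda>s. form (flow (h - s) x) (flow (h - s) y)) =
      integral {- h..0} (\<lambda>s. form (flow (h + s) x) (flow (h + s) y))"
    using Henstock_Kurzweil_Integration.integral_reflect_real[of 0 "- h" "\<lambda>s. form (flow (h + s) x) (flow (h + s) y)"]
    by simp
  also have "\<dots> = gram h x y"
    using integral_shift[of "-h" h 0 "\<lambda>u. form (flow u x) (flow u y)"]
    by (simp add: form_flow_continuous continuous_intros add.commute comp_def)
  finally show ?thesis .
qed

lemma noise_cov_diagonal: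
  "0 \<le> h \<Longrightarrow> (LINT w|M. noise x t h w * noise y t h w) = gram h x y"
  by (simp add: noise_cov form_flow_integral_reflect)

lemma noise_cov_quotient:
  "((\<lambda>h. (LINT w|M. noise x t h w * noise y t h w) / h) \<longlongrightarrow> form x y) (at_right 0)"
proof -
  have "((\<lambda>h. (gram h x y - gram 0 x y) / (h - 0))
      \<longlongrightarrow> form (flow 0 x) (flow 0 y)) (at 0 within {0..1})"
    using form_flow_integral_has_derivative[of 0 x y] unfolding has_field_derivative_iff by simp
  then have "((\<lambda>h. gram h x y / h) \<longlongrightarrow> form x y) (at_right 0)"
    by (simp add: at_within_Icc_at_right)
  then show ?thesis
    by (rule Lim_transform_eventually)
      (auto simp: eventually_at_filter noise_cov_diagonal intro!: always_eventually)
qed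

text \<open>By l'Hospital the quotient behaves like
  \<open>form (flow h x) (flow h x) / (2 * h)\<close>. Since \<open>form x\<close> vanishes,
  \<open>x\<close> may be subtracted from both arguments: one difference divided by \<open>h\<close>
  converges, the other tends to 0.\<close>

lemma form_flow_quotient_square:
  assumes "x v* \<BB> = 0"
  shows "((\<lambda>h. gram h x x / h\<^sup>2) \<longlongrightarrow> 0) (at_right 0)"
proof (rule lhopital_right_0[where f' = "\<lambda>h. form (flow h x) (flow h x)" and g' = "\<lambda>h. 2 * h"])
  have zero: "form x y = 0" for y using assms by (simp add: form_def)
  have D: "((\<lambda>h. gram h x x) has_real_derivative form (flow h x) (flow h x)) (at h)"
    if "0 < h" "h < 1" for h
    using form_flow_integral_has_derivative[of h x x] that by (simp add: at_within_Icc_at)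
  have "isCont (\<lambda>h::real. h\<^sup>2) 0" by (intro continuous_intros)
  then show "((\<lambda>h::real. h\<^sup>2) \<longlongrightarrow> 0) (at_right 0)"
    unfolding isCont_def by (auto intro: tendsto_within_subset)
  have "((\<lambda>h. gram h x x) \<longlongrightarrow> gram 0 x x)
      (at 0 within {0..1})"
    using DERIV_continuous[OF form_flow_integral_has_derivative[of 0 x x]]
    by (simp add: continuous_within)
  then show "((\<lambda>h. gram h x x) \<longlongrightarrow> 0) (at_right 0)"
    by (simp add: at_within_Icc_at_right)
  show "\<forall>\<^sub>F h in at_right 0. h\<^sup>2 \<noteq> (0::real)" "\<forall>\<^sub>F h in at_right 0. 2 * h \<noteq> (0::real)"
    by (auto simp: eventually_at_filter)
  show "\<forall>\<^sub>F h in at_right 0. ((\<lambda>h::real. h\<^sup>2) has_real_derivative 2 * h) (at h)"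
    by (auto intro!: always_eventually derivative_eq_intros)
  show "\<forall>\<^sub>F h in at_right 0. ((\<lambda>h. gram h x x) has_real_derivative
      form (flow h x) (flow h x)) (at h)"
    by (rule eventually_at_rightI[of 0 1]) (auto intro: D)
  have quot: "((\<lambda>h. (1 / h) *\<^sub>R (flow h x - x)) \<longlongrightarrow> transpose \<AA> *v x) (at_right 0)"
    by (rule flow_quotient)
  have "((\<lambda>h. form ((1 / h) *\<^sub>R (flow h x - x)) (flow h x - x) / 2) \<longlongrightarrow> form (transpose \<AA> *v x) (x - x) / 2) (at_right 0)"
    by (intro tendsto_divide tendsto_const form.tendsto quot tendsto_diff flow_tendsto) simp
  then have "((\<lambda>h. form ((1 / h) *\<^sub>R (flow h x - x)) (flow h x - x) / 2) \<longlongrightarrow> 0) (at_right 0)"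
    by (simp add: form.zero_right)
  moreover have "form ((1 / h) *\<^sub>R (flow h x - x)) (flow h x - x) / 2 = form (flow h x) (flow h x) / (2 * h)" for h
    using zero by (simp add: form.scaleR_left form.diff_left form.diff_right form_commute[of _ x])
  ultimately show "((\<lambda>h. form (flow h x) (flow h x) / (2 * h)) \<longlongrightarrow> 0) (at_right 0)"
    by simp
qed

text \<open>The increment is the noise plus \<open>(flow h x - c) \<bullet> X s\<close>, and the two
  are orthogonal. The vector \<open>c\<close> is free: \<open>c = x\<close> serves continuity and
  \<open>c = x + h *\<^sub>R (transpose \<AA> *v x)\<close> the difference quotient.\<close>

lemma state_increment_norm:
  assumes "0 \<le> h"
  shows "(LINT w|M. (x \<bullet> X (s + h) w - c \<bullet> X s w)\<^sup>2) =
    gram h x x + scov (flow h x - c) (flow h x - c)"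
proof -
  have "(LINT w|M. (x \<bullet> X (s + h) w - c \<bullet> X s w)\<^sup>2) =
      (LINT w|M. noise x s h w * noise x s h w + 2 * (noise x s h w * ((flow h x - c) \<bullet> X s w))
        + ((flow h x - c) \<bullet> X s w) * ((flow h x - c) \<bullet> X s w))"
    by (simp add: noise_def inner_diff_left power2_eq_square algebra_simps)
  also have "\<dots> = (LINT w|M. noise x s h w * noise x s h w)
      + (LINT w|M. ((flow h x - c) \<bullet> X s w) * ((flow h x - c) \<bullet> X s w))"
    using assms by (simp add: L2_times[OF noise_L2 noise_L2]
        L2_times[OF noise_L2 state_L2] L2_times[OF state_L2 state_L2] noise_orthogonal)
  also have "\<dots> = gram h x x + scov (flow h x - c) (flow h x - c)"
    using assms by (simp add: noise_cov_diagonal state_cov)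
  finally show ?thesis .
qed

text \<open>The base point may move with \<open>h\<close>, as the mean square in
  \<open>state_increment_norm\<close> does not depend on it. This is how left-hand quotients at
  \<open>t\<close> are later treated as right-hand quotients at \<open>t - h\<close>.\<close>

lemma state_continuous_in_mean:
  "((\<lambda>h. LINT w|M. (x \<bullet> X (s h + h) w - x \<bullet> X (s h) w)\<^sup>2) \<longlongrightarrow> 0) (at_right 0)"
proof -
  have "((\<lambda>h. gram h x x) \<longlongrightarrow> gram 0 x x)
      (at 0 within {0..1})"
    using DERIV_continuous[OF form_flow_integral_has_derivative[of 0 x x]]
    by (simp add: continuous_within)
  then have 1: "((\<lambda>h. gram h x x) \<longlongrightarrow> 0) (at_right 0)"
    by (simp add: at_within_Icc_at_right)
  have "((\<lambda>h. flow h x - x) \<longlongrightarrow> x - x) (at_right 0)"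
    by (intro tendsto_intros flow_tendsto)
  then have 2: "((\<lambda>h. scov (flow h x - x) (flow h x - x)) \<longlongrightarrow> 0) (at_right 0)"
    by (intro scov_tendsto_0) simp
  have "((\<lambda>h. gram h x x + scov (flow h x - x) (flow h x - x)) \<longlongrightarrow> 0) (at_right 0)"
    using tendsto_add[OF 1 2] by simp
  then show ?thesis
    by (rule Lim_transform_eventually)
      (auto simp: eventually_at_filter state_increment_norm intro!: always_eventually)
qed

lemma state_forward_quotient:
  assumes "x v* \<BB> = 0"
  shows "((\<lambda>h. LINT w|M. ((x \<bullet> X (s h + h) w - x \<bullet> X (s h) w) / h - (transpose \<AA> *v x) \<bullet> X (s h) w)\<^sup>2) \<longlongrightarrow> 0) (at_right 0)"
proof -
  let ?r = "\<lambda>h. (1 / h) *\<^sub>R (flow h x - x) - transpose \<AA> *v x"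
  have "((\<lambda>h. (1 / h) *\<^sub>R (flow h x - x)) \<longlongrightarrow> transpose \<AA> *v x) (at_right 0)"
    by (rule flow_quotient)
  then have "((\<lambda>h. ?r h) \<longlongrightarrow> 0) (at_right 0)"
    by (simp add: LIM_zero_iff)
  then have "((\<lambda>h. scov (?r h) (?r h)) \<longlongrightarrow> 0) (at_right 0)"
    by (rule scov_tendsto_0)
  from tendsto_add[OF form_flow_quotient_square[OF assms] this]
  have "((\<lambda>h. gram h x x / h\<^sup>2 + scov (?r h) (?r h)) \<longlongrightarrow> 0) (at_right 0)"
    by simp
  then show ?thesis
  proof (rule Lim_transform_eventually)
    have "gram h x x / h\<^sup>2 + scov (?r h) (?r h) =
        (LINT w|M. ((x \<bullet> X (s h + h) w - x \<bullet> X (s h) w) / h - (transpose \<AA> *v x) \<bullet> X (s h) w)\<^sup>2)"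
      if "0 < h" for h
    proof -
      define c where "c = x + h *\<^sub>R (transpose \<AA> *v x)"
      have r: "?r h = (1 / h) *\<^sub>R (flow h x - c)"
        using that by (simp add: c_def algebra_simps)
      have "(LINT w|M. ((x \<bullet> X (s h + h) w - x \<bullet> X (s h) w) / h - (transpose \<AA> *v x) \<bullet> X (s h) w)\<^sup>2) =
          (LINT w|M. (x \<bullet> X (s h + h) w - c \<bullet> X (s h) w)\<^sup>2 / h\<^sup>2)"
        using that by (simp add: c_def inner_add_left power_divide[symmetric] diff_divide_distrib add_divide_distrib diff_diff_eq)
      also have "\<dots> = gram h x x / h\<^sup>2 + scov (flow h x - c) (flow h x - c) / h\<^sup>2"
        using that by (simp add: state_increment_norm add_divide_distrib)
      also have "scov (flow h x - c) (flow h x - c) / h\<^sup>2 = scov (?r h) (?r h)"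
        unfolding r by (simp add: scov_scaleR power_divide)
      finally show ?thesis ..
    qed
    then show "\<forall>\<^sub>F h in at_right 0. gram h x x / h\<^sup>2 + scov (?r h) (?r h) =
        (LINT w|M. ((x \<bullet> X (s h + h) w - x \<bullet> X (s h) w) / h - (transpose \<AA> *v x) \<bullet> X (s h) w)\<^sup>2)"
      by (auto simp: eventually_at_filter)
  qed
qed

end


section \<open>Versions of mean-square derivatives and the order of differentiability\<close>

abbreviation (input) ms_quot :: "(real \<Rightarrow> 'w \<Rightarrow> complex) \<Rightarrow> real \<Rightarrow> real \<Rightarrow> 'w \<Rightarrow> complex"
  where "ms_quot W t \<equiv> (\<lambda>h w. (W (t + h) w - W t w) / complex_of_real h)"

lemma has_ms_deriv_measurable:
  "has_ms_deriv M j Z D \<Longrightarrow> (\<And>t. Z t \<in> borel_measurable M) \<Longrightarrow> D t \<in> borel_measurable M"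
  by (cases j) (auto dest: L2_measurable)

text \<open>Two derivatives of the preceding order agree almost surely at each time, so their
  difference quotients have the same mean-square limits. This gives access to the arbitrary version
  selected by \<open>ms_deriv\<close>.\<close>

lemma has_ms_deriv_unique:
  assumes "has_ms_deriv M j Z D" "has_ms_deriv M j Z D'" "\<And>t. Z t \<in> borel_measurable M"
  shows "AE w in M. D t w = D' t w"
  using assms(1,2)
proof (induction j arbitrary: D D' t)
  case (Suc j)
  obtain W where W: "has_ms_deriv M j Z W"
    "\<And>t. square_integrable M (D t) \<and> L2_tendsto M (ms_quot W t) (D t) (at 0)"
    using Suc.prems(1) by auto
  obtain W' where W': "has_ms_deriv M j Z W'"
    "\<And>t. square_integrable M (D' t) \<and> L2_tendsto M (ms_quot W' t) (D' t) (at 0)"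
    using Suc.prems(2) by auto
  have [measurable]: "W t \<in> borel_measurable M" "W' t \<in> borel_measurable M" for t
    using has_ms_deriv_measurable[OF W(1) assms(3)] has_ms_deriv_measurable[OF W'(1) assms(3)] by auto
  have "L2_tendsto M (ms_quot W t) (D' t) (at 0) \<longleftrightarrow>
      L2_tendsto M (ms_quot W' t) (D' t) (at 0)"
  proof (rule L2_tendsto_AE_cong)
    show "AE w in M. (W (t + h) w - W t w) / complex_of_real h = (W' (t + h) w - W' t w) / complex_of_real h" for h
      using Suc.IH[OF W(1) W'(1), of "t + h"] Suc.IH[OF W(1) W'(1), of t] by eventually_elim simp
  qed simp
  then show ?case
    using W(2) W'(2) L2_measurable
    by (intro L2_tendsto_measurable_unique[where F = "at (0::real)"
          and Zs = "\<lambda>h w. (W (t + h) w - W t w) / complex_of_real h"]) (auto simp: measurable_compose)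
qed simp

context levy_state
begin

interpretation form: bounded_bilinear form
  by (rule form_bounded_bilinear)

definition cstate :: "real^'n \<Rightarrow> real \<Rightarrow> 'w \<Rightarrow> complex"
  where "cstate x t w = complex_of_real (x \<bullet> X t w)"

lemma cstate_L2: "square_integrable M (cstate x t)"
  unfolding cstate_def[abs_def] L2_of_real_iff by (rule state_L2)

lemma cstate_measurable [measurable]: "cstate x t \<in> borel_measurable M"
  by (rule L2_measurable[OF cstate_L2])

lemma cstate_quotient_norm:
  "norm ((cstate x s w - cstate x t w) / complex_of_real h - cstate y r w) =
    \<bar>(x \<bullet> X s w - x \<bullet> X t w) / h - y \<bullet> X r w\<bar>"
  unfolding cstate_def
  by (simp only: of_real_diff[symmetric] of_real_divide[symmetric] norm_of_real)

lemma state_quotient_L2: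
  "square_integrable M (\<lambda>w. (x \<bullet> X (t + h) w - x \<bullet> X t w) / h - y \<bullet> X t w)"
  unfolding divide_inverse mult.commute[of _ "inverse h"]
  by (intro L2_diff L2_mult_left state_L2)

lemma state_quotient_tendsto:
  assumes "x v* \<BB> = 0"
  shows "((\<lambda>h. LINT w|M. ((x \<bullet> X (t + h) w - x \<bullet> X t w) / h - (transpose \<AA> *v x) \<bullet> X t w)\<^sup>2) \<longlongrightarrow> 0) (at 0)"
proof -
  define y where "y = transpose \<AA> *v x"
  define q where "q s h w = (x \<bullet> X (s + h) w - x \<bullet> X s w) / h - y \<bullet> X s w" for s h w
  have q_L2: "square_integrable M (q s h)" for s h
    unfolding q_def by (rule state_quotient_L2)
  define \<delta> where "\<delta> s h = (LINT w|M. (q (s h) h w)\<^sup>2)" for s h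
  define \<eta> where "\<eta> h = (LINT w|M. (y \<bullet> X (t - h + h) w - y \<bullet> X (t - h) w)\<^sup>2)" for h
  have \<delta>: "(\<delta> s \<longlongrightarrow> 0) (at_right 0)" for s
    unfolding \<delta>_def q_def y_def by (rule state_forward_quotient[OF assms])
  have \<eta>: "(\<eta> \<longlongrightarrow> 0) (at_right 0)"
    unfolding \<eta>_def by (rule state_continuous_in_mean)
  have abs: "filterlim (\<lambda>h::real. \<bar>h\<bar>) (at_right 0) (at 0)"
    unfolding filterlim_at by (auto simp: eventually_at_filter intro!: tendsto_rabs_zero tendsto_ident_at)
  have "((\<lambda>h. \<delta> (\<lambda>_. t) h + 2 * \<delta> (\<lambda>h. t - h) h + 2 * \<eta> h) \<longlongrightarrow> 0 + 2 * 0 + 2 * 0) (at_right 0)"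
    by (intro tendsto_intros \<delta> \<eta>)
  then have "((\<lambda>h. \<delta> (\<lambda>_. t) h + 2 * \<delta> (\<lambda>h. t - h) h + 2 * \<eta> h) \<longlongrightarrow> 0) (at_right 0)" by simp
  from filterlim_compose[OF this abs]
  have lim: "((\<lambda>h. \<delta> (\<lambda>_. t) \<bar>h\<bar> + 2 * \<delta> (\<lambda>h. t - h) \<bar>h\<bar> + 2 * \<eta> \<bar>h\<bar>) \<longlongrightarrow> 0) (at 0)" .
  have nonneg: "0 \<le> \<delta> s h" "0 \<le> \<eta> h" for s h
    by (simp_all add: \<delta>_def \<eta>_def)
  have "((\<lambda>h. LINT w|M. (q t h w)\<^sup>2) \<longlongrightarrow> 0) (at 0)"
  proof (rule tendsto_sandwich[OF _ _ tendsto_const lim])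
    have "(LINT w|M. (q t h w)\<^sup>2) \<le> \<delta> (\<lambda>_. t) \<bar>h\<bar> + 2 * \<delta> (\<lambda>h. t - h) \<bar>h\<bar> + 2 * \<eta> \<bar>h\<bar>" if "h \<noteq> 0" for h
    proof (cases "h > 0")
      case True
      then have "(LINT w|M. (q t h w)\<^sup>2) = \<delta> (\<lambda>_. t) \<bar>h\<bar>" by (simp add: \<delta>_def)
      then show ?thesis using nonneg(1)[of "\<lambda>h. t - h" "\<bar>h\<bar>"] nonneg(2)[of "\<bar>h\<bar>"] by (simp add: add_increasing2)
    next
      case False
      \<comment> \<open>A left-hand quotient at \<open>t\<close> is the right-hand quotient at
        \<open>t - k\<close>, but the latter is compared with the state at \<open>t - k\<close>;
        \<open>d\<close> is the cost of returning to time \<open>t\<close>.\<close>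
      define k where "k = - h"
      have k: "\<bar>h\<bar> = k" "h = - k" using False by (auto simp: k_def)
      define d where "d w = y \<bullet> X (t - k + k) w - y \<bullet> X (t - k) w" for w
      have split: "q t h w = q (t - k) k w + - d w" for w
        by (simp add: q_def d_def k(2) minus_divide_left[symmetric] diff_divide_distrib)
      have d_L2: "square_integrable M (\<lambda>w. - d w)"
        unfolding d_def by (intro L2_uminus L2_diff state_L2)
      have "(LINT w|M. (q t h w)\<^sup>2) \<le> (LINT w|M. 2 * (q (t - k) k w)\<^sup>2 + 2 * (d w)\<^sup>2)"
      proof (rule integral_mono)
        show "integrable M (\<lambda>w. (q t h w)\<^sup>2)" "integrable M (\<lambda>w. 2 * (q (t - k) k w)\<^sup>2 + 2 * (d w)\<^sup>2)"
          using L2D[OF q_L2] L2D[OF d_L2] by simp_all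
        show "(q t h w)\<^sup>2 \<le> 2 * (q (t - k) k w)\<^sup>2 + 2 * (d w)\<^sup>2" for w
          unfolding split using norm_add_power2_le[of "q (t - k) k w" "- d w"] by simp
      qed
      also have "\<dots> = 2 * (LINT w|M. (q (t - k) k w)\<^sup>2) + 2 * (LINT w|M. (d w)\<^sup>2)"
        using L2D[OF q_L2] L2D[OF d_L2] by simp
      also have "\<dots> = 2 * \<delta> (\<lambda>h. t - h) k + 2 * \<eta> k"
        by (simp only: \<delta>_def \<eta>_def d_def)
      finally show ?thesis using nonneg(1)[of "\<lambda>_. t" k] by (simp add: k(1) add_increasing)
    qed
    then show "\<forall>\<^sub>F h in at 0. (LINT w|M. (q t h w)\<^sup>2) \<le>
        \<delta> (\<lambda>_. t) \<bar>h\<bar> + 2 * \<delta> (\<lambda>h. t - h) \<bar>h\<bar> + 2 * \<eta> \<bar>h\<bar>"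
      by (auto simp: eventually_at_filter)
  qed simp
  then show ?thesis by (simp only: q_def y_def)
qed

lemma cstate_ms_deriv:
  assumes "x v* \<BB> = 0"
  shows "L2_tendsto M (ms_quot (cstate x) t)
    (cstate (transpose \<AA> *v x) t) (at 0)"
proof -
  have "(\<integral>\<^sup>+ w. ennreal ((norm ((cstate x (t + h) w - cstate x t w) / complex_of_real h - cstate y t w))\<^sup>2) \<partial>M)
      = ennreal (LINT w|M. ((x \<bullet> X (t + h) w - x \<bullet> X t w) / h - y \<bullet> X t w)\<^sup>2)" for h y
    using nn_integral_norm_power2[OF state_quotient_L2[of x t h y]] unfolding cstate_quotient_norm by simp
  then show ?thesis
    using state_quotient_tendsto[OF assms, of t]
    unfolding L2_tendsto_def by (simp add: tendsto_ennreal_iff flip: ennreal_0)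
qed

text \<open>The noise alone gives the increment a mean square of order \<open>h * form x x\<close>,
  so that of the quotient grows like \<open>form x x / h\<close>, whereas convergence to
  \<open>D\<close> would keep it below a constant \<open>K\<close>.\<close>

lemma cstate_not_ms_differentiable:
  assumes pos: "0 < form x x" and D: "square_integrable M D"
  shows "\<not> L2_tendsto M (ms_quot (cstate x) t) D (at 0)"
proof
  assume "L2_tendsto M (ms_quot (cstate x) t) D (at 0)"
  then have "\<forall>\<^sub>F h in at 0. (\<integral>\<^sup>+ w. ennreal ((norm ((cstate x (t + h) w - cstate x t w) / complex_of_real h - D w))\<^sup>2) \<partial>M) < 1"
    unfolding L2_tendsto_def by (rule order_tendstoD) simp
  then have ev1: "\<forall>\<^sub>F h in at_right 0. (\<integral>\<^sup>+ w. ennreal ((norm ((cstate x (t + h) w - cstate x t w) / complex_of_real h - D w))\<^sup>2) \<partial>M) < 1"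
    by (rule filter_leD[OF at_le[OF subset_UNIV]])
  define K where "K = 2 + 2 * (LINT w|M. (norm (D w))\<^sup>2)"
  have "K > 0" by (simp add: K_def add_pos_nonneg)
  have ev2: "\<forall>\<^sub>F h in at_right 0. form x x / 2 < (LINT w|M. noise x t h w * noise x t h w) / h"
    by (rule order_tendstoD(1)[OF noise_cov_quotient]) (use pos in simp)
  \<comment> \<open>Below this threshold \<open>h * K < form x x / 2\<close>, while
    \<open>form x x / 2\<close> is less than the noise variance divided by \<open>h\<close>, itself
    at most \<open>h * K\<close>.\<close>
  have ev3: "\<forall>\<^sub>F h in at_right 0. 0 < h \<and> h < form x x / (2 * K)"
    using pos \<open>K > 0\<close> by (intro eventually_at_rightI[of 0 "form x x / (2 * K)"]) auto
  obtain h where h: "0 < h" "h < form x x / (2 * K)"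
    "form x x / 2 < (LINT w|M. noise x t h w * noise x t h w) / h"
    "(\<integral>\<^sup>+ w. ennreal ((norm ((cstate x (t + h) w - cstate x t w) / complex_of_real h - D w))\<^sup>2) \<partial>M) < 1"
    using eventually_happens'[OF _ eventually_conj[OF ev1 eventually_conj[OF ev2 ev3]]] by auto
  define Q where "Q = (\<lambda>w. (cstate x (t + h) w - cstate x t w) / complex_of_real h)"
  have Q_L2: "square_integrable M Q"
    using L2_mult_left[OF L2_diff[OF cstate_L2[of x "t + h"] cstate_L2[of x t]],
        of "inverse (complex_of_real h)"]
    by (simp add: Q_def divide_inverse mult.commute)
  note QD = L2_diff[OF Q_L2 D]
  have "(LINT w|M. (norm (Q w - D w))\<^sup>2) < 1"
    using h(4) nn_integral_norm_power2[OF QD] by (simp add: Q_def ennreal_less_one_iff)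
  have "(LINT w|M. (norm (Q w))\<^sup>2) \<le> (LINT w|M. 2 * (norm (Q w - D w))\<^sup>2 + 2 * (norm (D w))\<^sup>2)"
  proof (rule integral_mono)
    show "(norm (Q w))\<^sup>2 \<le> 2 * (norm (Q w - D w))\<^sup>2 + 2 * (norm (D w))\<^sup>2" for w
      using norm_add_power2_le[of "Q w - D w" "D w"] by simp
  qed (use L2D[OF Q_L2] L2D[OF QD] L2D[OF D] in simp_all)
  also have "\<dots> = 2 * (LINT w|M. (norm (Q w - D w))\<^sup>2) + 2 * (LINT w|M. (norm (D w))\<^sup>2)"
    using L2D[OF QD] L2D[OF D] by simp
  also have "\<dots> \<le> K"
    using \<open>(LINT w|M. (norm (Q w - D w))\<^sup>2) < 1\<close> by (simp add: K_def)
  finally have upper: "(LINT w|M. (norm (Q w))\<^sup>2) \<le> K" .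
  have "(LINT w|M. noise x t h w * noise x t h w) \<le> (LINT w|M. (x \<bullet> X (t + h) w - x \<bullet> X t w)\<^sup>2)"
    using h(1) by (simp add: state_increment_norm noise_cov_diagonal) (simp add: scov_def)
  also have "\<dots> = (LINT w|M. h\<^sup>2 * (norm (Q w))\<^sup>2)"
  proof (rule Bochner_Integration.integral_cong[OF refl])
    show "(x \<bullet> X (t + h) w - x \<bullet> X t w)\<^sup>2 = h\<^sup>2 * (norm (Q w))\<^sup>2" for w
      using h(1) by (simp add: Q_def cstate_def norm_divide power_divide flip: of_real_diff)
  qed
  also have "\<dots> \<le> h\<^sup>2 * K" using upper by (simp add: mult_left_mono)
  finally have "(LINT w|M. noise x t h w * noise x t h w) / h \<le> h * K"
    using h(1) by (simp add: power2_eq_square field_simps)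
  with h(2,3) \<open>K > 0\<close> show False by (simp add: field_simps)
qed

text \<open>A derivative of order 0 is \<open>Z\<close> itself as a function, and \<open>Z\<close>
  agrees with the state only on \<open>space M\<close>. Hence the conclusion asserts some derivative
  with that agreement and does not name \<open>cstate\<close>.\<close>

lemma state_has_ms_deriv:
  assumes Z: "\<And>t w. w \<in> space M \<Longrightarrow> Z t w = cstate x t w"
    and B: "\<And>i. i < j \<Longrightarrow> (tpow i x) v* \<BB> = 0"
  shows "\<exists>D. has_ms_deriv M j Z D \<and> (\<forall>t. \<forall>w\<in>space M. D t w = cstate (tpow j x) t w)"
  using B
proof (induction j)
  case 0
  then show ?case using Z by auto
next
  case (Suc j)
  then obtain W where W: "has_ms_deriv M j Z W"
    "\<And>t w. w \<in> space M \<Longrightarrow> W t w = cstate (tpow j x) t w"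
    by auto
  let ?D = "cstate (tpow (Suc j) x)"
  have "L2_tendsto M (ms_quot W t) (?D t) (at 0)" for t
  proof (subst L2_tendsto_AE_cong)
    show "L2_tendsto M (ms_quot (cstate (tpow j x)) t) (?D t) (at 0)"
      using cstate_ms_deriv[OF Suc.prems[of j], of t] by (simp only: mat_pow.simps matrix_vector_mul_assoc lessI)
  qed (use W(2) in \<open>auto intro!: AE_I2\<close>)
  then have "has_ms_deriv M (Suc j) Z ?D"
    using W(1) cstate_L2 by auto
  then show ?case by blast
qed

lemma state_not_has_ms_deriv:
  assumes Z: "\<And>t w. w \<in> space M \<Longrightarrow> Z t w = cstate x t w"
    and B: "\<And>i. i < j \<Longrightarrow> (tpow i x) v* \<BB> = 0"
    and pos: "0 < form (tpow j x) (tpow j x)"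
  shows "\<not> has_ms_deriv M (Suc j) Z D"
proof
  assume "has_ms_deriv M (Suc j) Z D"
  then obtain W where W: "has_ms_deriv M j Z W"
    "\<And>t. square_integrable M (D t)"
    "\<And>t. L2_tendsto M (ms_quot W t) (D t) (at 0)"
    by auto
  have Z_meas: "Z t \<in> borel_measurable M" for t
    using cstate_measurable[of x t] Z by (simp cong: measurable_cong)
  obtain D' where D': "has_ms_deriv M j Z D'"
    "\<And>t w. w \<in> space M \<Longrightarrow> D' t w = cstate (tpow j x) t w"
    using state_has_ms_deriv[where j = j, OF Z B] by blast
  have AE: "AE w in M. W t w = cstate (tpow j x) t w" for t
    using has_ms_deriv_unique[OF W(1) D'(1) Z_meas, of t] AE_space by eventually_elim (simp add: D'(2))
  have "L2_tendsto M (ms_quot (cstate (tpow j x)) 0) (D 0) (at 0)"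
  proof (rule L2_tendsto_AE_cong[THEN iffD1, OF _ _ W(3)[of 0]])
    show "AE w in M. (W (0 + h) w - W 0 w) / complex_of_real h =
        (cstate (tpow j x) (0 + h) w - cstate (tpow j x) 0 w) / complex_of_real h" for h
      using AE[of "0 + h"] AE[of 0] by eventually_elim simp
  qed simp
  with cstate_not_ms_differentiable[OF pos W(2)] show False by blast
qed

text \<open>The number \<open>j\<close> is a relative degree: the noise enters
  \<open>tpow i x\<close> for the first time at \<open>i = j\<close>.\<close>

lemma ms_order_state:
  assumes Z: "\<And>t w. w \<in> space M \<Longrightarrow> Z t w = cstate x t w"
    and B: "\<And>i. i < j \<Longrightarrow> (tpow i x) v* \<BB> = 0"
    and pos: "0 < form (tpow j x) (tpow j x)"
  shows "ms_order M Z = j"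
    and "AE w in M. ms_deriv M j Z t w = cstate (tpow j x) t w"
    and "ms_deriv M j Z t \<in> borel_measurable M"
proof -
  have ex: "\<exists>D. has_ms_deriv M i Z D" if "i \<le> j" for i
    using state_has_ms_deriv[of Z x i] Z B that by (meson less_le_trans)
  have mono: "\<exists>D. has_ms_deriv M i Z D" if "has_ms_deriv M (i + n) Z D" for i n D
    using that by (induction n arbitrary: D) auto
  have no: "\<not> (\<exists>D. has_ms_deriv M (Suc j) Z D)"
    using state_not_has_ms_deriv[OF Z B pos] by blast
  show "ms_order M Z = j"
    unfolding ms_order_def
  proof (rule the_equality)
    show "(\<exists>D. has_ms_deriv M j Z D) \<and> \<not> (\<exists>D. has_ms_deriv M (Suc j) Z D)"
      using ex no by blast
    fix i assume i: "(\<exists>D. has_ms_deriv M i Z D) \<and> \<not> (\<exists>D. has_ms_deriv M (Suc i) Z D)"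
    show "i = j"
    proof (cases i j rule: linorder_cases)
      case less
      then show ?thesis using i ex[of "Suc i"] by (meson Suc_leI)
    next
      case greater
      then have eq: "Suc j + (i - Suc j) = i" by simp
      obtain D where "has_ms_deriv M i Z D" using i by blast
      then show ?thesis
        using mono[of "Suc j" "i - Suc j" D] no unfolding eq by blast
    qed
  qed
  have Z_meas: "Z t \<in> borel_measurable M" for t
    using cstate_measurable[of x t] Z by (simp cong: measurable_cong)
  have D: "has_ms_deriv M j Z (ms_deriv M j Z)"
    unfolding ms_deriv_def by (rule someI_ex[OF ex[OF order.refl]])
  then show "ms_deriv M j Z t \<in> borel_measurable M"
    using Z_meas by (rule has_ms_deriv_measurable)
  obtain D' where D': "has_ms_deriv M j Z D'"
    "\<And>t w. w \<in> space M \<Longrightarrow> D' t w = cstate (tpow j x) t w"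
    using state_has_ms_deriv[where j = j, OF Z B] by blast
  show "AE w in M. ms_deriv M j Z t w = cstate (tpow j x) t w"
    using has_ms_deriv_unique[OF D D'(1) Z_meas, of t] AE_space by eventually_elim (simp add: D'(2))
qed

end


subsection \<open>Bounded solutions of observable anti-stable systems\<close>

lemma span_image_lessThan:
  fixes h :: "nat \<Rightarrow> 'a::real_vector"
  assumes "y \<in> span (h ` {..<N})"
  obtains c where "y = (\<Sum>i<N. c i *\<^sub>R h i)"
proof -
  let ?S = "range (\<lambda>c. \<Sum>i<N. c i *\<^sub>R h i)"
  have "h ` {..<N} \<subseteq> ?S"
  proof
    fix z assume "z \<in> h ` {..<N}"
    then obtain j where j: "j < N" "z = h j" by auto
    have "z = (\<Sum>i<N. if i = j then h i else 0)" using j by simp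
    also have "\<dots> = (\<Sum>i<N. (if i = j then 1 else 0) *\<^sub>R h i)"
      by (rule sum.cong) auto
    finally show "z \<in> ?S" by (rule range_eqI[where x = "\<lambda>i. if i = j then 1 else 0"])
  qed
  moreover have "subspace ?S"
  proof (rule subspaceI)
    have "0 = (\<Sum>i<N. 0 *\<^sub>R h i)" by simp
    then show "0 \<in> ?S" by (rule range_eqI[where x = "\<lambda>_. 0"])
  next
    fix a b assume "a \<in> ?S" "b \<in> ?S"
    then obtain c d where "a = (\<Sum>i<N. c i *\<^sub>R h i)" "b = (\<Sum>i<N. d i *\<^sub>R h i)" by auto
    then have "a + b = (\<Sum>i<N. (c i + d i) *\<^sub>R h i)"
      by (simp add: sum.distrib scaleR_left_distrib)
    then show "a + b \<in> ?S" by (rule range_eqI[where x = "\<lambda>i. c i + d i"])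
  next
    fix r a assume "a \<in> ?S"
    then obtain c where "a = (\<Sum>i<N. c i *\<^sub>R h i)" by auto
    then have "r *\<^sub>R a = (\<Sum>i<N. (r * c i) *\<^sub>R h i)" by (simp add: scaleR_sum_right)
    then show "r *\<^sub>R a \<in> ?S" by (rule range_eqI[where x = "\<lambda>i. r * c i"])
  qed
  ultimately have "span (h ` {..<N}) \<subseteq> ?S" by (rule span_minimal)
  with assms that show ?thesis by auto
qed

text \<open>Krylov spaces of left multiplication by \<open>X\<close>, started at the identity
  matrix. The degree may be as large as the square of the size, which is harmless since any monic
  annihilating polynomial will do.\<close>

lemma mat_pow_annihilating:
  fixes X :: "real^'n^'n"
  obtains N c where "mat_pow X N = (\<Sum>i<N. c i *\<^sub>R mat_pow X i)"
proof -
  have "linear ((**) X)"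
    by (rule linearI) (simp_all add: matrix_add_ldistrib matrix_scalar_ac scalar_matrix_assoc)
  moreover have "((**) X ^^ i) (mat 1) = mat_pow X i" for i
    by (induction i) simp_all
  ultimately have "mat_pow X (DIM(real^'n^'n)) \<in> span (mat_pow X ` {..<DIM(real^'n^'n)})"
    using funpow_in_span_Krylov[of "(**) X" "DIM(real^'n^'n)" "mat 1"] by simp
  then show ?thesis using that span_image_lessThan by blast
qed

section \<open>Polynomials of a matrix acting on vectors\<close>

lemma matrix_minus_mat_mult:
  fixes N :: "complex^'n^'n"
  shows "(N - mat z) *v v = N *v v - z *s v"
proof -
  have "(\<Sum>j\<in>UNIV. (if i = j then z else 0) * v $ j) = z * v $ i" for i
    by (simp add: if_distrib[of "\<lambda>x. x * _"] cong: if_cong)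
  then show ?thesis
    by (simp add: vec_eq_iff matrix_vector_mult_def mat_def left_diff_distrib sum_subtractf)
qed

text \<open>This is \<open>p(N) v\<close>, by iterated application because \<open>mat_pow\<close> is
  reserved for real matrices.\<close>

definition poly_act :: "complex poly \<Rightarrow> complex^'n^'n \<Rightarrow> complex^'n \<Rightarrow> complex^'n"
  where "poly_act p N v = (\<Sum>i\<le>degree p. coeff p i *s ((*v) N ^^ i) v)"

lemma poly_act_eq: "degree p \<le> n \<Longrightarrow> poly_act p N v = (\<Sum>i\<le>n. coeff p i *s ((*v) N ^^ i) v)"
  unfolding poly_act_def by (rule sum.mono_neutral_left) (simp_all add: coeff_eq_0)

text \<open>A linear factor commutes with all powers of \<open>N\<close> and can be absorbed into
  the vector; this permits splitting off one root at a time.\<close>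

lemma poly_act_linear_factor:
  fixes N :: "complex^'n^'n"
  shows "poly_act ([:- z, 1:] * p) N v = poly_act p N ((N - mat z) *v v)"
proof -
  define u where "u i = ((*v) N ^^ i) v" for i
  have shift: "((*v) N ^^ i) ((N - mat z) *v v) = u (Suc i) - z *s u i" for i
  proof (induction i)
    case 0
    show ?case by (simp add: u_def matrix_minus_mat_mult)
  next
    case (Suc i)
    then show ?case by (simp add: u_def matrix_vector_mult_diff_distrib vector_scalar_commute)
  qed
  let ?n = "degree p"
  have "degree ([:- z, 1:] * p) \<le> Suc ?n"
    using degree_mult_le[of "[:- z, 1:]" p] by simp
  then have "poly_act ([:- z, 1:] * p) N v = (\<Sum>i\<le>Suc ?n. coeff ([:- z, 1:] * p) i *s u i)"
    by (simp add: poly_act_eq u_def)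
  also have "\<dots> = (\<Sum>i\<le>Suc ?n. (- z * coeff p i) *s u i) + (\<Sum>i\<le>Suc ?n. coeff (pCons 0 p) i *s u i)"
    by (simp add: sum.distrib[symmetric] vector_sadd_rdistrib del: sum.atMost_Suc)
  also have "(\<Sum>i\<le>Suc ?n. (- z * coeff p i) *s u i) = (\<Sum>i\<le>?n. (- z * coeff p i) *s u i)"
    by (simp add: coeff_eq_0)
  also have "(\<Sum>i\<le>Suc ?n. coeff (pCons 0 p) i *s u i) = (\<Sum>i\<le>?n. coeff p i *s u (Suc i))"
    by (subst sum.atMost_Suc_shift) simp
  also have "(\<Sum>i\<le>?n. (- z * coeff p i) *s u i) + (\<Sum>i\<le>?n. coeff p i *s u (Suc i)) =
      (\<Sum>i\<le>?n. coeff p i *s (u (Suc i) - z *s u i))"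
    by (simp add: sum.distrib[symmetric] vec_eq_iff algebra_simps)
  also have "\<dots> = poly_act p N ((N - mat z) *v v)"
    by (simp add: poly_act_def shift)
  finally show ?thesis .
qed

lemma at_within_atMost_neq_bot:
  assumes "s \<le> (t::real)" shows "at s within {..t} \<noteq> bot"
proof
  assume "at s within {..t} = bot"
  moreover have "at_left s \<le> at s within {..t}" by (rule at_le) (use assms in auto)
  ultimately show False by (metis bot_unique trivial_limit_at_left_real)
qed

text \<open>The assumption is the Hautus test restricted to \<open>Re z \<ge> 0\<close>, that is,
  detectability. Modes with \<open>Re z < 0\<close> may be invisible to \<open>D\<close>;
  boundedness on the past excludes them instead.\<close>

locale observable_backward_system =
  fixes N :: "complex^'n^'n" and D :: "complex^'n^'m" and t :: real
  assumes hautus: "\<And>z v. Re z \<ge> 0 \<Longrightarrow> N *v v = z *s v \<Longrightarrow> D *v v = 0 \<Longrightarrow> v = 0"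
begin

definition sol :: "(real \<Rightarrow> complex^'n) \<Rightarrow> bool"
  where "sol g \<longleftrightarrow> (\<forall>s\<le>t. (g has_vector_derivative N *v g s) (at s within {..t})) \<and>
    (\<exists>K. \<forall>s\<le>t. norm (g s) \<le> K) \<and> (\<forall>s\<le>t. D *v g s = 0)"

lemma sol_observed_derivative:
  assumes "sol g" "s \<le> t" shows "D *v (N *v g s) = 0"
proof -
  have "((\<lambda>r. D *v g r) has_vector_derivative D *v (N *v g s)) (at s within {..t})"
    using assms unfolding sol_def
    by (intro bounded_linear.has_vector_derivative[OF matrix_vector_mul_bounded_linear]) auto
  moreover have "((\<lambda>r. D *v g r) has_vector_derivative 0) (at s within {..t})"
    by (rule has_vector_derivative_transform[OF _ _ has_vector_derivative_const[of 0]])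
      (use assms in \<open>auto simp: sol_def\<close>)
  ultimately show ?thesis
    using vector_derivative_unique_within[OF at_within_atMost_neq_bot[OF assms(2)]] by blast
qed

text \<open>Equation and boundedness survive because \<open>N - mat z\<close> commutes with
  \<open>N\<close> and is bounded. The output condition also needs
  \<open>D *v (N *v g s) = 0\<close>, which comes from differentiating
  \<open>D *v g s = 0\<close>.\<close>

lemma sol_shift:
  assumes "sol g" shows "sol (\<lambda>s. (N - mat z) *v g s)"
proof -
  obtain K where K: "\<And>s. s \<le> t \<Longrightarrow> norm (g s) \<le> K"
    using assms by (auto simp: sol_def)
  have bl: "bounded_linear ((*v) (N - mat z))" by (rule matrix_vector_mul_bounded_linear)
  then obtain B where B: "B > 0" "\<And>v. norm ((N - mat z) *v v) \<le> norm v * B"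
    using bounded_linear.pos_bounded by blast
  have comm: "(N - mat z) *v (N *v v) = N *v ((N - mat z) *v v)" for v
    by (simp add: matrix_minus_mat_mult matrix_vector_mult_diff_distrib
        vector_scalar_commute)
  show ?thesis
    unfolding sol_def
  proof (intro conjI allI impI exI)
    fix s assume s: "s \<le> t"
    show "((\<lambda>s. (N - mat z) *v g s) has_vector_derivative N *v ((N - mat z) *v g s)) (at s within {..t})"
      unfolding comm[symmetric]
      using assms s unfolding sol_def by (intro bounded_linear.has_vector_derivative[OF bl]) auto
    have "norm ((N - mat z) *v g s) \<le> norm (g s) * B" by (rule B)
    also have "\<dots> \<le> K * B" using B(1) K[OF s] by (intro mult_right_mono) auto
    finally show "norm ((N - mat z) *v g s) \<le> K * B" .
    show "D *v ((N - mat z) *v g s) = 0"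
      using sol_observed_derivative[OF assms s] assms s
      by (simp add: sol_def matrix_minus_mat_mult matrix_vector_mult_diff_distrib
          vector_scalar_commute)
  qed
qed

lemma sol_eigen_zero:
  assumes "sol g" and eig: "\<And>s. s \<le> t \<Longrightarrow> N *v g s = z *s g s" and "s \<le> t"
  shows "g s = 0"
proof (cases "Re z \<ge> 0")
  case True
  then show ?thesis using hautus[OF True eig[OF \<open>s \<le> t\<close>]] assms by (simp add: sol_def)
next
  case False
  obtain K where K: "\<And>s. s \<le> t \<Longrightarrow> norm (g s) \<le> K"
    using assms by (auto simp: sol_def)
  have "g s $ i = 0" for i
  proof -
    \<comment> \<open>Integrating factor: \<open>h\<close> is constant, so every component of
      \<open>g\<close> is a multiple of \<open>exp (z * (r - t))\<close>.\<close>
    define h where "h r = exp (- z * of_real (r - t)) * g r $ i" for r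
    have "(h has_vector_derivative 0) (at r within {..t})" if "r \<in> {..t}" for r
    proof -
      have "((\<lambda>r. g r $ i) has_vector_derivative (N *v g r) $ i) (at r within {..t})"
        using assms(1) that unfolding sol_def
        by (intro bounded_linear.has_vector_derivative[OF bounded_linear_vec_nth]) auto
      moreover have "((\<lambda>r. exp (- z * of_real (r - t))) has_vector_derivative
          (- z) * exp (- z * of_real (r - t))) (at r within {..t})"
      proof -
        have "((\<lambda>w. exp (- z * (w - of_real t))) has_field_derivative (- z) * exp (- z * (of_real r - of_real t)))
            (at (of_real r))"
          by (auto intro!: derivative_eq_intros)
        from has_vector_derivative_real_field[OF this] show ?thesis by simp
      qed
      ultimately have "(h has_vector_derivative
          exp (- z * of_real (r - t)) * (N *v g r) $ i + (- z) * exp (- z * of_real (r - t)) * g r $ i)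
          (at r within {..t})"
        unfolding h_def by (intro has_vector_derivative_mult)
      then show ?thesis using eig[of r] that by simp
    qed
    then obtain c where c: "\<And>r. r \<le> t \<Longrightarrow> h r = c"
      using has_vector_derivative_zero_constant[of "{..t}" h] by auto
    have ct: "c = g t $ i" using c[of t] by (simp add: h_def)
    have gr: "g r $ i = exp (z * of_real (r - t)) * c" if "r \<le> t" for r
    proof -
      have "c = exp (- (z * of_real (r - t))) * g r $ i"
        using c[OF that] by (simp add: h_def)
      then show ?thesis
        by (simp only: mult.assoc[symmetric] exp_minus_inverse mult_1_left)
    qed
    have "c = 0"
    proof (rule ccontr)
      assume "c \<noteq> 0"
      \<comment> \<open>Chosen so that \<open>exp (Re z * (r - t))\<close> is
        \<open>(\<bar>K\<bar> + 1) / norm c + 1\<close>, which pushes the component beyond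
        \<open>K\<close>. The added 1 makes the logarithm positive; as \<open>Re z < 0\<close>, this
        puts \<open>r\<close> to the left of \<open>t\<close>.\<close>
      define r where "r = t + ln ((\<bar>K\<bar> + 1) / norm c + 1) / Re z"
      have "(\<bar>K\<bar> + 1) / norm c > 0" using \<open>c \<noteq> 0\<close> by (simp add: add_nonneg_pos)
      then have "r \<le> t" using False by (simp add: r_def divide_nonneg_neg)
      have "Re z * (r - t) = ln ((\<bar>K\<bar> + 1) / norm c + 1)" using False by (simp add: r_def)
      then have "exp (Re z * (r - t)) = (\<bar>K\<bar> + 1) / norm c + 1"
        using \<open>(\<bar>K\<bar> + 1) / norm c > 0\<close> by simp
      then have "norm (g r $ i) = ((\<bar>K\<bar> + 1) / norm c + 1) * norm c"
        using gr[OF \<open>r \<le> t\<close>] by (simp add: norm_mult)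
      also have "\<dots> = \<bar>K\<bar> + 1 + norm c" using \<open>c \<noteq> 0\<close> by (simp add: field_simps)
      finally have "norm (g r $ i) > K" using norm_ge_zero[of c] by linarith
      moreover have "norm (g r $ i) \<le> K"
        using K[OF \<open>r \<le> t\<close>] Finite_Cartesian_Product.norm_nth_le[of "g r" i] by simp
      ultimately show False by simp
    qed
    then show ?thesis using gr[OF \<open>s \<le> t\<close>] by simp
  qed
  then show ?thesis by (simp add: vec_eq_iff)
qed

text \<open>Induction on the degree replaces a decomposition into generalised eigenspaces. For a
  root \<open>z\<close> of \<open>p\<close>, the solution \<open>(N - mat z) *v g s\<close> is
  annihilated by the cofactor, hence zero; so \<open>g\<close> consists of eigenvectors for
  \<open>z\<close>.\<close>

lemma sol_annihilated_zero:
  assumes "p \<noteq> 0" "sol g" "\<And>s. s \<le> t \<Longrightarrow> poly_act p N (g s) = 0" "s \<le> t"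
  shows "g s = 0"
  using assms
proof (induction "degree p" arbitrary: p g s)
  case 0
  then obtain c where "p = [:c:]" using degree_eq_zeroE by metis
  with 0 show ?case using "0.prems"(3)[OF "0.prems"(4)] by (simp add: poly_act_def)
next
  case (Suc n)
  then have "\<not> constant (poly p)" by (simp add: constant_degree)
  then obtain z where "poly p z = 0" using fundamental_theorem_of_algebra by blast
  then obtain p' where p': "p = [:- z, 1:] * p'" by (auto simp: poly_eq_0_iff_dvd elim: dvdE)
  then have "p' \<noteq> 0" using Suc.prems(1) by auto
  then have "degree p' = n" using Suc.hyps(2) p' degree_mult_eq[of "[:- z, 1:]" p'] by simp
  have "(N - mat z) *v g r = 0" if "r \<le> t" for r
  proof (rule Suc.hyps(1)[of p' "\<lambda>s. (N - mat z) *v g s" r])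
    show "poly_act p' N ((N - mat z) *v g s) = 0" if "s \<le> t" for s
      using Suc.prems(3)[OF that] unfolding p' poly_act_linear_factor .
  qed (use \<open>degree p' = n\<close> \<open>p' \<noteq> 0\<close> that sol_shift[OF Suc.prems(2)] in auto)
  then have "N *v g r = z *s g r" if "r \<le> t" for r
    using that by (simp add: matrix_minus_mat_mult)
  then show ?case using sol_eigen_zero[OF Suc.prems(2) _ Suc.prems(4)] by blast
qed

end

abbreviation cmat :: "real^'n^'m \<Rightarrow> complex^'n^'m"
  where "cmat \<equiv> map_matrix complex_of_real"

abbreviation cvec :: "real^'n \<Rightarrow> complex^'n"
  where "cvec x \<equiv> (\<chi> i. complex_of_real (x $ i))"

lemma cmat_mult_cvec: "cmat A *v cvec x = cvec (A *v x)"
  by (simp add: vec_eq_iff matrix_vector_mult_def map_matrix_def)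

lemma bounded_backward_solution_zero:
  fixes \<Lambda> :: "real^'n^'n" and D :: "real^'n^'m" and x :: "real \<Rightarrow> real^'n"
  assumes deriv: "\<And>s. s \<le> t \<Longrightarrow> (x has_vector_derivative \<Lambda> *v x s) (at s within {..t})"
    and bdd: "\<And>s. s \<le> t \<Longrightarrow> norm (x s) \<le> K"
    and obs: "\<And>s. s \<le> t \<Longrightarrow> D *v x s = 0"
    and hautus: "\<And>z v. Re z \<ge> 0 \<Longrightarrow> cmat \<Lambda> *v v = z *s v \<Longrightarrow> cmat D *v v = 0 \<Longrightarrow> v = 0"
  shows "x t = 0"
proof -
  interpret observable_backward_system "cmat \<Lambda>" "cmat D" t
    by unfold_locales (rule hautus)
  have bl: "bounded_linear (cvec :: real^'n \<Rightarrow> complex^'n)"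
    unfolding linear_conv_bounded_linear[symmetric]
    by (rule linearI) (simp_all add: vec_eq_iff scaleR_conv_of_real[where 'a = complex])
  have "norm (cvec v) = norm v" for v :: "real^'n"
    by (simp add: norm_vec_def L2_set_def)
  then have "sol (\<lambda>s. cvec (x s))"
    unfolding sol_def cmat_mult_cvec
    using bounded_linear.has_vector_derivative[OF bl deriv] bdd obs by (auto simp: zero_vec_def)
  moreover obtain N c where c: "mat_pow \<Lambda> N = (\<Sum>i<N. c i *\<^sub>R mat_pow \<Lambda> i)"
    by (rule mat_pow_annihilating)
  \<comment> \<open>The leading coefficient 1 at \<open>N\<close> ensures
    \<open>p \<noteq> 0\<close>, also when \<open>N = 0\<close>.\<close>
  define p where "p = (\<Sum>i\<le>N. monom (if i = N then 1 else - complex_of_real (c i)) i)"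
  have coeff_p: "coeff p i = (if i = N then 1 else if i < N then - complex_of_real (c i) else 0)" for i
    by (auto simp: p_def coeff_sum coeff_monom if_distrib[of "\<lambda>m. coeff m _"])
  then have "p \<noteq> 0" by (metis coeff_0 zero_neq_one)
  moreover have "poly_act p (cmat \<Lambda>) (cvec (x s)) = 0" for s
  proof -
    have pow: "((*v) (cmat \<Lambda>) ^^ i) (cvec (x s)) = cvec (mat_pow \<Lambda> i *v x s)" for i
      by (induction i) (simp_all add: cmat_mult_cvec matrix_vector_mul_assoc)
    have "degree p \<le> N" by (rule degree_le) (simp add: coeff_p)
    then have "poly_act p (cmat \<Lambda>) (cvec (x s)) = (\<Sum>i\<le>N. coeff p i *s cvec (mat_pow \<Lambda> i *v x s))"
      by (simp add: poly_act_eq pow)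
    also have "\<dots> = cvec (mat_pow \<Lambda> N *v x s) + (\<Sum>i<N. - (complex_of_real (c i) *s cvec (mat_pow \<Lambda> i *v x s)))"
      by (simp add: coeff_p lessThan_Suc_atMost[symmetric])
    also have "\<dots> = cvec (mat_pow \<Lambda> N *v x s - (\<Sum>i<N. c i *\<^sub>R (mat_pow \<Lambda> i *v x s)))"
      by (simp add: vec_eq_iff sum_negf)
    also have "(\<Sum>i<N. c i *\<^sub>R (mat_pow \<Lambda> i *v x s)) = mat_pow \<Lambda> N *v x s"
      unfolding c by (simp add: vec_eq_iff matrix_vector_mult_def sum_distrib_left sum_distrib_right mult.assoc)
        (intro allI sum.swap)
    finally show ?thesis by (simp add: vec_eq_iff)
  qed
  ultimately have "cvec (x t) = 0" using sol_annihilated_zero[of p] by blast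
  then show ?thesis by (simp add: vec_eq_iff)
qed


subsection \<open>Block companion matrices\<close>

lemma row_mult: "axis a 1 v* (Z :: real^'n^'m) = Z $ a"
proof -
  have "(\<Sum>i\<in>UNIV. (if i = a then 1 else 0) * Z $ i $ j) = Z $ a $ j" for j
    by (simp add: if_distrib[of "\<lambda>x. x * _"] cong: if_cong)
  then show ?thesis
    by (simp add: vec_eq_iff vector_matrix_mult_def axis_def)
qed

lemma row_matrix_mult: "(Z ** (W :: real^'n^'m)) $ a = Z $ a v* W"
  by (metis row_mult vector_matrix_mul_assoc)

lemma blk_bij: "bij_betw (blk :: 'p::{finite, linorder} \<Rightarrow> nat) UNIV {..<CARD('p)}"
proof -
  have mono: "blk i < blk j" if "i < j" for i j :: 'p
    unfolding blk_def by (rule psubset_card_mono) (use that in auto)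
  then have inj: "inj (blk :: 'p \<Rightarrow> nat)"
    by (intro injI) (metis less_irrefl linorder_neqE)
  have "blk i < CARD('p)" for i :: 'p
    unfolding blk_def by (rule psubset_card_mono) auto
  then have "range (blk :: 'p \<Rightarrow> nat) \<subseteq> {..<CARD('p)}" by auto
  moreover have "card (range (blk :: 'p \<Rightarrow> nat)) = CARD('p)"
    using inj by (simp add: card_image)
  ultimately have "range (blk :: 'p \<Rightarrow> nat) = {..<CARD('p)}"
    by (intro card_subset_eq) auto
  with inj show ?thesis by (simp add: bij_betw_def)
qed

definition unblk :: "nat \<Rightarrow> 'p::{finite, linorder}"
  where "unblk = inv_into UNIV blk"

lemma unblk_blk [simp]: "unblk (blk (i :: 'p::{finite, linorder})) = i"
  unfolding unblk_def using blk_bij[where 'p = 'p] by (simp add: bij_betw_def inv_into_f_f)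

lemma blk_unblk [simp]: "j < CARD('p) \<Longrightarrow> blk (unblk j :: 'p::{finite, linorder}) = j"
  unfolding unblk_def using blk_bij[where 'p = 'p] by (intro f_inv_into_f) (simp add: bij_betw_def)

lemma blk_less: "blk (i :: 'p) < CARD('p::{finite, linorder})"
  using blk_bij[where 'p = 'p] by (auto simp: bij_betw_def)

lemma blk_pair_eq_iff:
  fixes c :: "'p::{finite, linorder} \<times> 'k"
  assumes "j < CARD('p)"
  shows "blk (fst c) = j \<and> snd c = b \<longleftrightarrow> c = (unblk j, b)"
  using assms by (cases c) (metis blk_unblk fst_conv snd_conv unblk_blk)

lemma vec_bB_nth: "(y v* (bB :: real^'k^('p::{finite, linorder} \<times> 'k))) $ c = y $ (unblk (CARD('p) - 1), c)"
proof -
  have nth: "(bB :: real^'k^('p \<times> 'k)) $ r $ c = (if r = (unblk (CARD('p) - 1), c) then 1 else 0)" for r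
    using blk_pair_eq_iff[of "CARD('p) - 1" r c] by (auto simp: bB_def mat_def)
  show ?thesis
    unfolding vector_matrix_mult_def vec_lambda_beta nth
    by (simp add: if_distrib[of "\<lambda>x. x * _"] if_distrib[of "\<lambda>x. _ * x"] cong: if_cong)
qed

text \<open>When the last block of \<open>y\<close> is empty, the coefficient row of the companion
  matrix is not touched and the product merely shifts all blocks one place to the right.\<close>

lemma vec_bA_nth:
  fixes y :: "real^('p::{finite, linorder} \<times> 'k::finite)"
  assumes "\<And>b. y $ (unblk (CARD('p) - 1), b) = 0"
  shows "(y v* bA A) $ c = (if blk (fst c) = 0 then 0 else y $ (unblk (blk (fst c) - 1), snd c))"
proof -
  have "bA A $ r $ c * y $ r =
      (if blk (fst c) \<noteq> 0 \<and> r = (unblk (blk (fst c) - 1), snd c) then y $ r else 0)" for r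
  proof (cases "blk (fst r) = CARD('p) - 1")
    case True
    then have "y $ r = 0" using assms[of "snd r"] by (metis prod.collapse unblk_blk)
    then show ?thesis by auto
  next
    case False
    have "blk (fst c) - 1 < CARD('p)" using blk_less[of "fst c"] by simp
    with blk_pair_eq_iff[of "blk (fst c) - 1" r "snd c"] False show ?thesis
      by (auto simp: bA_def mat_def)
  qed
  then have "(y v* bA A) $ c = (\<Sum>r\<in>UNIV. if blk (fst c) \<noteq> 0 \<and> r = (unblk (blk (fst c) - 1), snd c) then y $ r else 0)"
    by (simp add: vector_matrix_mult_def mult.commute)
  then show ?thesis by simp
qed

lemma sC_bB:
  assumes "q < CARD('p)"
  shows "(sC q C :: real^('p::{finite, linorder} \<times> 'k)^'k) ** bB = C q"
proof -
  have "((sC q C :: real^('p \<times> 'k)^'k) ** bB) $ a $ c = C q $ a $ c" for a c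
    unfolding row_matrix_mult vec_bB_nth using assms by (simp add: sC_def Let_def)
  then show ?thesis by (simp add: vec_eq_iff)
qed

text \<open>A row of \<open>bC\<close> occupies blocks 0 to \<open>q\<close>, and each
  multiplication by the companion matrix shifts it by one block. After \<open>p - 1 - q\<close>
  shifts the coefficient \<open>C q\<close> has reached the last block and the row is that of
  \<open>sC\<close>; before that the last block is empty, so the noise input is not seen.\<close>

lemma row_bC_shift:
  assumes "q < CARD('p)" "m \<le> CARD('p) - 1 - q"
  shows "mat_pow (transpose (bA A)) m *v ((bC q C :: real^('p::{finite, linorder} \<times> 'k)^'k) $ a) =
    (\<chi> r. if m \<le> blk (fst r) \<and> blk (fst r) \<le> m + q then C (blk (fst r) - m) $ a $ snd r else 0)"
  using assms(2)
proof (induction m)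
  case 0
  show ?case by (simp add: bC_def vec_eq_iff)
next
  case (Suc m)
  let ?y = "mat_pow (transpose (bA A)) m *v ((bC q C :: real^('p \<times> 'k)^'k) $ a)"
  have y: "?y = (\<chi> r. if m \<le> blk (fst r) \<and> blk (fst r) \<le> m + q then C (blk (fst r) - m) $ a $ snd r else 0)"
    using Suc by simp
  \<comment> \<open>Before the shift the entries end at block \<open>m + q\<close>, which is
    strictly below \<open>p - 1\<close>.\<close>
  have last: "?y $ (unblk (CARD('p) - 1), b) = 0" for b
  proof -
    have "\<not> CARD('p) - 1 \<le> m + q" using Suc.prems by arith
    then show ?thesis unfolding y by simp
  qed
  have "mat_pow (transpose (bA A)) (Suc m) *v ((bC q C :: real^('p \<times> 'k)^'k) $ a) = ?y v* bA A"
    by (simp add: matrix_vector_mul_assoc[symmetric])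
  also have "\<dots> = (\<chi> r. if Suc m \<le> blk (fst r) \<and> blk (fst r) \<le> Suc m + q then C (blk (fst r) - Suc m) $ a $ snd r else 0)"
    unfolding vec_eq_iff
  proof
    fix r :: "'p \<times> 'k"
    have "blk (fst r) - 1 < CARD('p)" using blk_less[of "fst r"] by simp
    then show "(?y v* bA A) $ r =
        (\<chi> r. if Suc m \<le> blk (fst r) \<and> blk (fst r) \<le> Suc m + q then C (blk (fst r) - Suc m) $ a $ snd r else 0) $ r"
      unfolding vec_bA_nth[OF last] unfolding y by auto
  qed
  finally show ?case .
qed

lemma row_bC_shift_bB:
  assumes "q < CARD('p)" "m < CARD('p) - 1 - q"
  shows "(mat_pow (transpose (bA A)) m *v ((bC q C :: real^('p::{finite, linorder} \<times> 'k)^'k) $ a)) v* bB = 0"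
  unfolding vec_eq_iff vec_bB_nth
  by (subst row_bC_shift) (use assms in auto)

lemma row_sC:
  assumes "q < CARD('p)"
  shows "mat_pow (transpose (bA A)) (CARD('p) - 1 - q) *v ((bC q C :: real^('p::{finite, linorder} \<times> 'k)^'k) $ a) = sC q C $ a"
proof -
  have "blk (fst r) \<le> CARD('p) - 1 - q + q" for r :: "'p \<times> 'k"
    using blk_less[of "fst r"] assms by simp
  then show ?thesis
    by (subst row_bC_shift) (use assms in \<open>auto simp: sC_def vec_eq_iff\<close>)
qed

text \<open>A projection that kills the noise input \<open>bB\<close> and fixes the states with \<open>sC *v x = 0\<close>, so that
  such states evolve under \<open>noise_free ** bA\<close> without noise.\<close>

definition noise_free :: "nat \<Rightarrow> (nat \<Rightarrow> real^'k^'k) \<Rightarrow> real^('p::{finite, linorder} \<times> 'k)^('p \<times> 'k)"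
  where "noise_free q C = mat 1 - bB ** matrix_inv (C q) ** sC q C"

lemma matrix_inv_left: "invertible Z \<Longrightarrow> matrix_inv Z ** Z = mat 1"
  unfolding matrix_inv_def invertible_def by (rule someI2_ex) auto

lemma matrix_diff_rdistrib: "(Z - W) ** (V :: 'a::ring_1^'n^'m) = Z ** V - W ** V"
  by (simp add: vec_eq_iff matrix_matrix_mult_def left_diff_distrib sum_subtractf)

lemma noise_free_bB:
  assumes "q < CARD('p)" "invertible (C q)"
  shows "(noise_free q C :: real^('p::{finite, linorder} \<times> 'k::finite)^('p \<times> 'k)) ** bB = 0"
proof -
  have "(noise_free q C :: real^('p \<times> 'k)^('p \<times> 'k)) ** bB =
      bB - bB ** matrix_inv (C q) ** (sC q C ** (bB :: real^'k^('p \<times> 'k)))"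
    by (simp add: noise_free_def matrix_diff_rdistrib matrix_mul_assoc)
  also have "\<dots> = bB - bB ** (matrix_inv (C q) ** C q)"
    unfolding sC_bB[OF assms(1)] by (simp add: matrix_mul_assoc)
  also have "\<dots> = 0"
    using assms(2) by (simp add: matrix_inv_left)
  finally show ?thesis .
qed

lemma noise_free_fixes:
  assumes "sC q C *v x = 0"
  shows "noise_free q C *v x = x"
  using assms by (simp add: noise_free_def matrix_vector_mult_diff_rdistrib matrix_vector_mul_assoc[symmetric])

text \<open>\<open>bB\<close> is zero outside the last block, so the projection alters only the last
  block row and the other rows keep the shift structure of the companion matrix.\<close>

lemma noise_free_bA_nth:
  fixes r :: "'p::{finite, linorder} \<times> 'k::finite"
  assumes "blk (fst r) + 1 < CARD('p)"
  shows "(noise_free q C ** bA A) $ r $ c = (if c = (unblk (blk (fst r) + 1), snd r) then 1 else 0)"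
proof -
  have "bB $ r = (0 :: real^'k)" using assms by (simp add: bB_def vec_eq_iff)
  then have "noise_free q C $ r = mat 1 $ r"
    by (simp add: noise_free_def row_matrix_mult matrix_mul_assoc[symmetric])
  then have "(noise_free q C ** bA A) $ r = (mat 1 ** bA A) $ r"
    by (simp only: row_matrix_mult)
  then have "(noise_free q C ** bA A) $ r $ c = bA A $ r $ c" by simp
  then show ?thesis
    using blk_pair_eq_iff[OF assms, of c "snd r"] assms by (simp add: bA_def mat_def Let_def) auto
qed

text \<open>The unaltered block rows force an eigenvector into the form
  \<open>(v0, z v0, z^2 v0, ...)\<close>, and \<open>bC\<close> applied to such a vector is
  \<open>Q(z) v0\<close>. For \<open>Re z \<ge> 0\<close> the matrix \<open>Q(z)\<close> is
  invertible.\<close>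

lemma noise_free_observable:
  fixes v :: "complex^('p::{finite, linorder} \<times> 'k::finite)"
  assumes q: "q < CARD('p)" and det: "\<And>z. det (Q_poly q C z) = 0 \<Longrightarrow> Re z < 0"
    and z: "Re z \<ge> 0"
    and eig: "map_matrix complex_of_real (noise_free q C ** bA A) *v v = z *s v"
    and obs: "map_matrix complex_of_real (bC q C) *v v = 0"
  shows "v = 0"
proof -
  define v0 where "v0 = (\<chi> b. v $ (unblk 0, b))"
  have step: "v $ (unblk (Suc j), b) = z * v $ (unblk j, b)" if "Suc j < CARD('p)" for j b
  proof -
    let ?r = "(unblk j, b) :: 'p \<times> 'k"
    have "z * v $ ?r = (map_matrix complex_of_real (noise_free q C ** bA A) *v v) $ ?r"
      by (simp add: eig)
    also have "\<dots> = (\<Sum>c\<in>UNIV. complex_of_real ((noise_free q C ** bA A) $ ?r $ c) * v $ c)"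
      by (simp add: matrix_vector_mult_def map_matrix_def)
    also have "\<dots> = (\<Sum>c\<in>UNIV. if c = (unblk (Suc j), b) then v $ c else 0)"
      by (rule sum.cong[OF refl]) (subst noise_free_bA_nth, use that in auto)
    also have "\<dots> = v $ (unblk (Suc j), b)" by simp
    finally show ?thesis by simp
  qed
  have pow: "v $ (unblk j, b) = z ^ j * v0 $ b" if "j < CARD('p)" for j b
    using that by (induction j) (simp_all add: step v0_def)
  have v_nth: "v $ c = z ^ blk (fst c) * v0 $ snd c" for c
    using pow[OF blk_less, of "fst c" "snd c"] by simp
  have "Q_poly q C z *v v0 = 0"
    unfolding vec_eq_iff
  proof
    fix a
    have "(Q_poly q C z *v v0) $ a = (\<Sum>b\<in>UNIV. \<Sum>j\<le>q. complex_of_real (C j $ a $ b) * z ^ j * v0 $ b)"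
      by (simp add: Q_poly_def matrix_vector_mult_def map_matrix_def sum_distrib_right)
    also have "\<dots> = (\<Sum>j\<le>q. \<Sum>b\<in>UNIV. complex_of_real (C j $ a $ b) * z ^ j * v0 $ b)"
      by (rule sum.swap)
    also have "\<dots> = (\<Sum>j<CARD('p). if j \<le> q then \<Sum>b\<in>UNIV. complex_of_real (C j $ a $ b) * z ^ j * v0 $ b else 0)"
      using q by (intro sum.mono_neutral_cong_left) auto
    also have "\<dots> = (\<Sum>i\<in>UNIV. if blk (i::'p) \<le> q then \<Sum>b\<in>UNIV. complex_of_real (C (blk i) $ a $ b) * z ^ blk i * v0 $ b else 0)"
      by (rule sum.reindex_bij_betw[OF blk_bij, symmetric])
    also have "\<dots> = (\<Sum>i\<in>UNIV. \<Sum>b\<in>UNIV. complex_of_real (bC q C $ a $ (i :: 'p, b)) * v $ (i, b))"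
      by (intro sum.cong refl) (simp add: bC_def v_nth mult.assoc)
    also have "\<dots> = (map_matrix complex_of_real (bC q C) *v v) $ a"
      by (simp add: matrix_vector_mult_def map_matrix_def sum.cartesian_product UNIV_Times_UNIV case_prod_unfold
          flip: UNIV_Times_UNIV)
    finally show "(Q_poly q C z *v v0) $ a = 0 $ a" by (simp add: obs)
  qed
  moreover have "det (Q_poly q C z) \<noteq> 0" using det z by force
  then have "invertible (Q_poly q C z)" by (simp add: invertible_det_nz)
  ultimately have "v0 = 0"
    by (metis matrix_inv_left matrix_vector_mul_assoc matrix_vector_mul_lid matrix_vector_mult_0_right)
  then show ?thesis by (simp add: vec_eq_iff v_nth)
qed


subsection \<open>The closed linear past and residuals\<close>

lemma lin_past_base: "r \<le> t \<Longrightarrow> comp_proc Y v r \<in> lin_past Y t"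
  unfolding lin_past_def
  by (intro CollectI exI[of _ "{(v, r)}"] exI[of _ "\<lambda>_ _. 1"]) simp

lemma lin_past_zero: "(\<lambda>_. 0) \<in> lin_past Y t"
  unfolding lin_past_def by (intro CollectI exI[of _ "{}"]) simp

lemma lin_past_lincomb:
  assumes "Z \<in> lin_past Y t" "W \<in> lin_past Y t"
  shows "(\<lambda>w. Z w + c * W w) \<in> lin_past Y t"
proof -
  obtain F a where F: "finite F" "F \<subseteq> UNIV \<times> {..t}"
    "Z = (\<lambda>w. \<Sum>(v, r)\<in>F. a v r * comp_proc Y v r w)"
    using assms(1) unfolding lin_past_def by blast
  obtain G b where G: "finite G" "G \<subseteq> UNIV \<times> {..t}"
    "W = (\<lambda>w. \<Sum>(v, r)\<in>G. b v r * comp_proc Y v r w)"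
    using assms(2) unfolding lin_past_def by blast
  define d where "d v r = (if (v, r) \<in> F then a v r else 0) + c * (if (v, r) \<in> G then b v r else 0)" for v r
  have "Z w + c * W w = (\<Sum>(v, r)\<in>F \<union> G. d v r * comp_proc Y v r w)" for w
  proof -
    have "Z w = (\<Sum>(v, r)\<in>F \<union> G. (if (v, r) \<in> F then a v r else 0) * comp_proc Y v r w)"
      unfolding F(3) using F(1) G(1) by (intro sum.mono_neutral_cong_left) auto
    moreover have "W w = (\<Sum>(v, r)\<in>F \<union> G. (if (v, r) \<in> G then b v r else 0) * comp_proc Y v r w)"
      unfolding G(3) using F(1) G(1) by (intro sum.mono_neutral_cong_left) auto
    ultimately show ?thesis
      by (simp add: d_def case_prod_unfold sum.distrib sum_distrib_left distrib_right mult.assoc)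
  qed
  moreover have "finite (F \<union> G)" "F \<union> G \<subseteq> UNIV \<times> {..t}"
    using F G by auto
  ultimately show ?thesis
    unfolding lin_past_def by blast
qed

locale L2_process =
  fixes M :: "'w measure" and Y :: "real \<Rightarrow> 'w \<Rightarrow> real^'k"
  assumes comp_proc_L2: "\<And>v r. square_integrable M (comp_proc Y v r)"
begin

lemma lin_past_L2:
  assumes "Z \<in> lin_past Y t" shows "square_integrable M Z"
proof -
  obtain F c where "Z = (\<lambda>w. \<Sum>(v, r)\<in>F. c v r * comp_proc Y v r w)"
    using assms unfolding lin_past_def by blast
  then show ?thesis
    by (simp add: case_prod_unfold L2_sum L2_mult_left comp_proc_L2)
qed

lemma pastE:
  assumes "Z \<in> past M Y t"
  obtains W where "\<And>n::nat. W n \<in> lin_past Y t" "square_integrable M Z"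
    "\<And>n. square_integrable M (\<lambda>w. W n w - Z w)"
    "(\<lambda>n. LINT w|M. (norm (W n w - Z w))\<^sup>2) \<longlonglongrightarrow> 0"
proof -
  obtain W where W: "\<And>n::nat. W n \<in> lin_past Y t" "L2_tendsto M W Z sequentially" "square_integrable M Z"
    using assms unfolding past_def by blast
  have "square_integrable M (\<lambda>w. W n w - Z w)" for n
    using L2_diff[OF lin_past_L2[OF W(1)] W(3)] .
  with W show ?thesis using that L2_tendsto_iff_integral by blast
qed

lemma past_L2: "Z \<in> past M Y t \<Longrightarrow> square_integrable M Z"
  by (simp add: past_def)

lemma past_zero: "(\<lambda>_. 0) \<in> past M Y t"
  unfolding past_def using lin_past_zero
  by (intro CollectI conjI exI[of _ "\<lambda>_ _. 0"]) (simp_all add: L2_tendsto_def)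

lemma past_lincomb:
  assumes "Z \<in> past M Y t" "Z' \<in> past M Y t"
  shows "(\<lambda>w. Z w + c * Z' w) \<in> past M Y t"
proof -
  obtain W where W: "\<And>n::nat. W n \<in> lin_past Y t" "square_integrable M Z"
    "\<And>n. square_integrable M (\<lambda>w. W n w - Z w)"
    "(\<lambda>n. LINT w|M. (norm (W n w - Z w))\<^sup>2) \<longlonglongrightarrow> 0"
    using assms(1) by (rule pastE) (rule that)
  obtain W' where W': "\<And>n::nat. W' n \<in> lin_past Y t" "square_integrable M Z'"
    "\<And>n. square_integrable M (\<lambda>w. W' n w - Z' w)"
    "(\<lambda>n. LINT w|M. (norm (W' n w - Z' w))\<^sup>2) \<longlonglongrightarrow> 0"
    using assms(2) by (rule pastE) (rule that)
  let ?V = "\<lambda>n w. W n w + c * W' n w"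
  have eq: "?V n w - (Z w + c * Z' w) = (W n w - Z w) + c * (W' n w - Z' w)" for n w
    by (simp add: algebra_simps)
  have L2: "square_integrable M (\<lambda>w. ?V n w - (Z w + c * Z' w))" for n
    unfolding eq by (intro L2_add L2_mult_left W(3) W'(3))
  have "(\<lambda>n. LINT w|M. (norm (?V n w - (Z w + c * Z' w)))\<^sup>2) \<longlonglongrightarrow> 0"
  proof (rule tendsto_sandwich[OF _ _ tendsto_const])
    have "(\<lambda>n. 2 * (LINT w|M. (norm (W n w - Z w))\<^sup>2) + 2 * (norm c)\<^sup>2 * (LINT w|M. (norm (W' n w - Z' w))\<^sup>2))
        \<longlonglongrightarrow> 2 * 0 + 2 * (norm c)\<^sup>2 * 0"
      by (intro tendsto_intros W(4) W'(4))
    then show "(\<lambda>n. 2 * (LINT w|M. (norm (W n w - Z w))\<^sup>2) + 2 * (norm c)\<^sup>2 * (LINT w|M. (norm (W' n w - Z' w))\<^sup>2))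
        \<longlonglongrightarrow> 0" by simp
    have "(LINT w|M. (norm (?V n w - (Z w + c * Z' w)))\<^sup>2) \<le>
        (LINT w|M. 2 * (norm (W n w - Z w))\<^sup>2 + 2 * (norm c)\<^sup>2 * (norm (W' n w - Z' w))\<^sup>2)" for n
    proof (rule integral_mono)
      show "(norm (?V n w - (Z w + c * Z' w)))\<^sup>2 \<le>
          2 * (norm (W n w - Z w))\<^sup>2 + 2 * (norm c)\<^sup>2 * (norm (W' n w - Z' w))\<^sup>2" for w
        unfolding eq using norm_add_power2_le[of "W n w - Z w" "c * (W' n w - Z' w)"]
        by (simp add: norm_mult power_mult_distrib)
    qed (use L2D[OF L2[of n]] L2D[OF W(3)[of n]]
        L2D[OF W'(3)[of n]] in simp_all)
    also have "\<dots> n = 2 * (LINT w|M. (norm (W n w - Z w))\<^sup>2) + 2 * (norm c)\<^sup>2 * (LINT w|M. (norm (W' n w - Z' w))\<^sup>2)" for n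
      using L2D[OF W(3)[of n]] L2D[OF W'(3)[of n]] by simp
    finally show "\<forall>\<^sub>F n in sequentially. (LINT w|M. (norm (?V n w - (Z w + c * Z' w)))\<^sup>2) \<le>
        2 * (LINT w|M. (norm (W n w - Z w))\<^sup>2) + 2 * (norm c)\<^sup>2 * (LINT w|M. (norm (W' n w - Z' w))\<^sup>2)"
      by simp
  qed simp
  then have "L2_tendsto M ?V (\<lambda>w. Z w + c * Z' w) sequentially"
    using L2 by (simp add: L2_tendsto_iff_integral)
  moreover have "?V n \<in> lin_past Y t" for n
    using W(1) W'(1) by (rule lin_past_lincomb)
  moreover have "square_integrable M (\<lambda>w. Z w + c * Z' w)"
    by (intro L2_add L2_mult_left W(2) W'(2))
  ultimately show ?thesis
    unfolding past_def by (intro CollectI conjI exI[of _ ?V] allI)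
qed

text \<open>Orthogonality to the generators passes to finite combinations by linearity and to the
  closure by Cauchy-Schwarz.\<close>

lemma past_orthogonal:
  assumes E: "square_integrable M E"
    and orth: "\<And>v r. r \<le> t \<Longrightarrow> (LINT w|M. E w * cnj (comp_proc Y v r w)) = 0"
    and U: "U \<in> past M Y t"
  shows "(LINT w|M. E w * cnj (U w)) = 0"
proof -
  obtain W where W: "\<And>n::nat. W n \<in> lin_past Y t" "square_integrable M U"
    "\<And>n. square_integrable M (\<lambda>w. W n w - U w)"
    "(\<lambda>n. LINT w|M. (norm (W n w - U w))\<^sup>2) \<longlonglongrightarrow> 0"
    using U by (rule pastE) (rule that)
  have lin: "(LINT w|M. E w * cnj (V w)) = 0" if V: "V \<in> lin_past Y t" for V
  proof -
    obtain F c where F: "F \<subseteq> UNIV \<times> {..t}" "V = (\<lambda>w. \<Sum>(v, r)\<in>F. c v r * comp_proc Y v r w)"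
      using V unfolding lin_past_def by blast
    have "(LINT w|M. E w * cnj (V w)) =
        (LINT w|M. (\<Sum>x\<in>F. cnj (c (fst x) (snd x)) * (E w * cnj (comp_proc Y (fst x) (snd x) w))))"
      unfolding F(2) by (simp add: case_prod_unfold sum_distrib_left mult_ac)
    also have "\<dots> = (\<Sum>x\<in>F. cnj (c (fst x) (snd x)) * (LINT w|M. E w * cnj (comp_proc Y (fst x) (snd x) w)))"
      using L2_times[OF E L2_cnj[OF comp_proc_L2]] by simp
    also have "\<dots> = 0"
      using F(1) by (intro sum.neutral ballI) (auto simp: orth)
    finally show ?thesis .
  qed
  have bound: "norm (LINT w|M. E w * cnj (U w)) \<le>
      sqrt (LINT w|M. (norm (E w))\<^sup>2) * sqrt (LINT w|M. (norm (W n w - U w))\<^sup>2)" for n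
  proof -
    have "(LINT w|M. E w * cnj (W n w - U w)) = (LINT w|M. E w * cnj (W n w) - E w * cnj (U w))"
      by (simp add: right_diff_distrib)
    also have "\<dots> = - (LINT w|M. E w * cnj (U w))"
      using L2_times[OF E L2_cnj[OF lin_past_L2[OF W(1)]]]
        L2_times[OF E L2_cnj[OF W(2)]]
      by (simp add: lin[OF W(1)])
    finally have eq: "(LINT w|M. E w * cnj (W n w - U w)) = - (LINT w|M. E w * cnj (U w))" .
    show ?thesis
      using norm_integral_mult_le_sqrt[OF E L2_cnj[OF W(3)[of n]]]
      unfolding eq norm_minus_cancel complex_mod_cnj .
  qed
  have "(\<lambda>n. sqrt (LINT w|M. (norm (E w))\<^sup>2) * sqrt (LINT w|M. (norm (W n w - U w))\<^sup>2)) \<longlonglongrightarrow>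
      sqrt (LINT w|M. (norm (E w))\<^sup>2) * sqrt 0"
    by (intro tendsto_intros W(4))
  then have "norm (LINT w|M. E w * cnj (U w)) \<le> sqrt (LINT w|M. (norm (E w))\<^sup>2) * sqrt 0"
    by (rule LIMSEQ_le_const) (use bound in auto)
  then show ?thesis by simp
qed

text \<open>The candidate \<open>W0\<close> witnesses that the choice in \<open>L2_proj\<close> is
  not void. The difference between the chosen projection and \<open>W0\<close> belongs to the past
  and is orthogonal to the past, hence to itself, so it vanishes almost surely.\<close>

lemma resid_eq:
  assumes Z: "square_integrable M Z" and W0: "W0 \<in> past M Y t"
    and orth: "\<And>v r. r \<le> t \<Longrightarrow> (LINT w|M. (Z w - W0 w) * cnj (comp_proc Y v r w)) = 0"
  shows "AE w in M. resid M Y t Z w = Z w - W0 w"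
    and "resid M Y t Z \<in> borel_measurable M"
proof -
  define W where "W = L2_proj M (past M Y t) Z"
  have W0_orth: "(LINT w|M. (Z w - W0 w) * cnj (U w)) = 0" if "U \<in> past M Y t" for U
    by (rule past_orthogonal[OF L2_diff[OF Z past_L2[OF W0]] orth that])
  have "W \<in> past M Y t \<and> (\<forall>U\<in>past M Y t. (LINT w|M. (Z w - W w) * cnj (U w)) = 0)"
    unfolding W_def L2_proj_def
    by (rule someI[of _ W0]) (use W0 W0_orth in blast)
  then have W: "W \<in> past M Y t" "\<And>U. U \<in> past M Y t \<Longrightarrow> (LINT w|M. (Z w - W w) * cnj (U w)) = 0"
    by blast+
  define D where "D = (\<lambda>w. W w + (- 1) * W0 w)"
  have D: "D \<in> past M Y t"
    unfolding D_def using W(1) W0 by (rule past_lincomb)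
  note D_L2 = past_L2[OF D]
  have "(LINT w|M. D w * cnj (D w)) = (LINT w|M. (Z w - W0 w) * cnj (D w) - (Z w - W w) * cnj (D w))"
    by (simp add: D_def algebra_simps)
  also have "\<dots> = 0"
    using L2_times[OF L2_diff[OF Z past_L2[OF W0]] L2_cnj[OF D_L2]]
      L2_times[OF L2_diff[OF Z past_L2[OF W(1)]] L2_cnj[OF D_L2]]
    by (simp add: W0_orth[OF D] W(2)[OF D])
  finally have "(LINT w|M. complex_of_real ((norm (D w))\<^sup>2)) = 0"
    by (simp only: complex_norm_square)
  then have "(LINT w|M. (norm (D w))\<^sup>2) = 0"
    by (simp only: integral_complex_of_real of_real_eq_0_iff)
  then have "AE w in M. (norm (D w))\<^sup>2 = 0"
    using integral_nonneg_eq_0_iff_AE[OF L2D[OF D_L2]] by simp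
  then show "AE w in M. resid M Y t Z w = Z w - W0 w"
    by eventually_elim (simp add: resid_def W_def[symmetric] D_def)
  show "resid M Y t Z \<in> borel_measurable M"
    unfolding resid_def[abs_def] W_def[symmetric]
    by (rule L2_measurable[OF L2_diff[OF Z past_L2[OF W(1)]]])
qed

end


subsection \<open>Vanishing noise covariances\<close>

context levy_state
begin

interpretation form: bounded_bilinear form
  by (rule form_bounded_bilinear)

lemma flow_zero_derivatives:
  assumes l: "bounded_linear l" and zero: "\<And>u. 0 \<le> u \<Longrightarrow> u \<le> 1/2 \<Longrightarrow> l (flow u x) = (0::real)"
  shows "0 \<le> u \<Longrightarrow> u \<le> 1/2 \<Longrightarrow> l (mat_pow (transpose \<AA>) n *v flow u x) = 0"
proof (induction n arbitrary: u)
  case 0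
  then show ?case using zero by simp
next
  case (Suc n)
  let ?l = "\<lambda>z. l (tpow n z)"
  have "bounded_linear ?l"
    by (rule bounded_linear_compose[OF l matrix_vector_mul_bounded_linear])
  then have "((\<lambda>u. ?l (flow u x)) has_vector_derivative ?l (transpose \<AA> *v flow u x)) (at u within {0..1/2})"
    by (rule bounded_linear.has_vector_derivative[OF _ flow_has_derivative])
  moreover have "((\<lambda>u. ?l (flow u x)) has_vector_derivative 0) (at u within {0..1/2})"
    by (rule has_vector_derivative_transform[OF _ _ has_vector_derivative_const[of 0]])
      (use Suc in auto)
  ultimately have "?l (transpose \<AA> *v flow u x) = 0"
    using vector_derivative_unique_within_closed_interval[of 0 "1/2" u] Suc.prems by (simp add: cbox_interval)
  then show ?case
    unfolding mat_pow_Suc2 by (simp only: matrix_vector_mul_assoc)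
qed

text \<open>For a fixed lag \<open>v - u\<close> the hypothesis makes a Gram integral of
  \<open>x\<close> and \<open>flow (v - u) y\<close> vanish at all endpoints, so its integrand
  vanishes. This covers a whole square of pairs \<open>(u, v)\<close>, and derivatives at 0 in
  either variable produce the powers.\<close>

lemma form_pow_eq_zeroI:
  assumes int: "\<And>h h'. 0 \<le> h \<Longrightarrow> h \<le> 1 \<Longrightarrow> 0 \<le> h' \<Longrightarrow> h' \<le> 1 \<Longrightarrow>
    integral {0..min h h'} (\<lambda>s. form (flow (h - s) x) (flow (h' - s) y)) = 0"
  shows "form (tpow \<alpha> x) (tpow \<beta> y) = 0"
proof -
  \<comment> \<open>The bound 1/2 leaves room for a lag: with \<open>h\<close>, \<open>u\<close> and
    \<open>v\<close> at most 1/2, the shifted horizon \<open>h + (v - u)\<close> stays within the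
    range of the hypothesis.\<close>
  have diag: "form (flow h x') (flow h y') = 0"
    if z: "\<And>h. 0 \<le> h \<Longrightarrow> h \<le> 1/2 \<Longrightarrow> integral {0..h} (\<lambda>s. form (flow (h - s) x') (flow (h - s) y')) = 0"
      and h: "0 \<le> h" "h \<le> 1/2" for h x' y'
  proof -
    have "((\<lambda>h. gram h x' y') has_vector_derivative form (flow h x') (flow h y'))
        (at h within {0..1/2})"
      using form_flow_integral_has_derivative[of h x' y'] h
      unfolding has_real_derivative_iff_has_vector_derivative
      by (auto intro: has_vector_derivative_within_subset)
    moreover have "((\<lambda>h. gram h x' y') has_vector_derivative 0) (at h within {0..1/2})"
      by (rule has_vector_derivative_transform[OF _ _ has_vector_derivative_const[of 0]])
        (use z h in \<open>auto simp: form_flow_integral_reflect[symmetric]\<close>)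
    ultimately show ?thesis
      using vector_derivative_unique_within_closed_interval[of 0 "1/2" h] h by (simp add: cbox_interval)
  qed
  have square: "form (flow u x) (flow v y) = 0" if "0 \<le> u" "u \<le> 1/2" "0 \<le> v" "v \<le> 1/2" for u v
  proof (cases "u \<le> v")
    case True
    have "form (flow u x) (flow u (flow (v - u) y)) = 0"
    proof (rule diag)
      fix h :: real assume "0 \<le> h" "h \<le> 1/2"
      then show "integral {0..h} (\<lambda>s. form (flow (h - s) x) (flow (h - s) (flow (v - u) y))) = 0"
        using int[of h "h + (v - u)"] that True unfolding flow_add[symmetric] by (simp add: algebra_simps)
    qed (use that in auto)
    then show ?thesis unfolding flow_add[symmetric] by simp
  next
    case False
    have "form (flow v (flow (u - v) x)) (flow v y) = 0"
    proof (rule diag)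
      fix h :: real assume "0 \<le> h" "h \<le> 1/2"
      then show "integral {0..h} (\<lambda>s. form (flow (h - s) (flow (u - v) x)) (flow (h - s) y)) = 0"
        using int[of "h + (u - v)" h] that False unfolding flow_add[symmetric] by (simp add: algebra_simps)
    qed (use that in auto)
    then show ?thesis unfolding flow_add[symmetric] by simp
  qed
  have "form (mat_pow (transpose \<AA>) \<alpha> *v flow 0 x) (flow v y) = 0" if "0 \<le> v" "v \<le> 1/2" for v
    by (rule flow_zero_derivatives[OF form.bounded_linear_left]) (use square that in auto)
  then have "form (mat_pow (transpose \<AA>) \<alpha> *v flow 0 x) (mat_pow (transpose \<AA>) \<beta> *v flow 0 y) = 0"
    by (intro flow_zero_derivatives[OF form.bounded_linear_right]) auto
  then show ?thesis by simp
qed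

lemma linear_pow_zero_Krylov:
  assumes l: "linear l" and zero: "\<And>i. i < CARD('n) \<Longrightarrow> l (tpow i x) = (0::real)"
  shows "l (tpow n x) = 0"
proof -
  have "tpow n x \<in> span ((\<lambda>i. tpow i x) ` {..<CARD('n)})"
    using funpow_in_span_Krylov[OF Finite_Cartesian_Product.matrix_vector_mul_linear, of n "transpose \<AA>" x]
    by (simp only: mat_pow_mult_vec DIM_cart DIM_real mult_1_right)
  also have "\<dots> \<subseteq> {z. l z = 0}"
    by (rule span_minimal) (use zero l in \<open>auto intro: linear_subspace_kernel\<close>)
  finally show ?thesis by simp
qed

lemma flow_zero_pow:
  assumes "\<And>n. z \<bullet> (tpow n x) = 0"
  shows "z \<bullet> flow u x = 0"
proof -
  have "(\<lambda>n. 0) sums (z \<bullet> flow u x)"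
    using mat_exp_vec_sums[of u z "transpose \<AA>" x] assms by (simp only: flow_def mult_zero_right)
  then show ?thesis using sums_unique2 sums_zero by blast
qed

lemma form_inner: "form x y = (\<BB> *v (\<Sigma> *v (y v* \<BB>))) \<bullet> x"
  unfolding form_def dot_lmul_matrix by (simp add: inner_commute)

text \<open>For the converse, bilinearity extends the vanishing from powers below the dimension to
  all powers, one argument at a time; the exponential series then annihilates the integrand
  itself.\<close>

lemma noise_cov_zero_iff:
  "(\<forall>h h'. 0 \<le> h \<and> h \<le> 1 \<and> 0 \<le> h' \<and> h' \<le> 1 \<longrightarrow>
      integral {0..min h h'} (\<lambda>s. form (flow (h - s) x) (flow (h' - s) y)) = 0) \<longleftrightarrow>
    (\<forall>\<alpha> \<beta>. \<alpha> < CARD('n) \<and> \<beta> < CARD('n) \<longrightarrow>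
      form (tpow \<alpha> x) (tpow \<beta> y) = 0)"
  (is "?I \<longleftrightarrow> ?P")
proof
  assume ?I
  then show ?P using form_pow_eq_zeroI[of x y] by blast
next
  assume P: ?P
  have half: "form (tpow \<alpha> x) (tpow \<beta> y) = 0" if "\<beta> < CARD('n)" for \<alpha> \<beta>
    by (rule linear_pow_zero_Krylov[of "\<lambda>z. form z _"])
      (use P that form.bounded_linear_left in \<open>auto simp: linear_conv_bounded_linear\<close>)
  have all: "form (tpow \<alpha> x) (tpow \<beta> y) = 0" for \<alpha> \<beta>
    by (rule linear_pow_zero_Krylov[of "form _"])
      (use half form.bounded_linear_right in \<open>auto simp: linear_conv_bounded_linear\<close>)
  have flow_x: "form (flow u x) (tpow \<beta> y) = 0" for u \<beta>
    unfolding form_inner by (rule flow_zero_pow) (simp only: form_inner[symmetric] all)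
  have "form (flow v y) (flow u x) = 0" for u v
    unfolding form_inner[of _ "flow u x"]
    by (rule flow_zero_pow) (simp only: form_inner[symmetric] form_commute[of _ "flow u x"] flow_x)
  then show ?I by (subst form_commute) simp
qed

end


subsection \<open>ICCSS processes\<close>

locale iccss = levy_state M L "bA A" bB X
  for M :: "'w measure" and L :: "real \<Rightarrow> 'w \<Rightarrow> real^'k" and A :: "nat \<Rightarrow> real^'k^'k"
    and X :: "real \<Rightarrow> 'w \<Rightarrow> real^('p::{finite, linorder} \<times> 'k)" +
  fixes Y :: "real \<Rightarrow> 'w \<Rightarrow> real^'k" and q :: nat and C :: "nat \<Rightarrow> real^'k^'k"
  assumes q_less: "q < CARD('p)"
    and Cq_invertible: "invertible (C q)"
    and Q_stable: "\<And>z. det (Q_poly q C z) = 0 \<Longrightarrow> Re z < 0"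
    and Y_state: "\<And>t w. w \<in> space M \<Longrightarrow> Y t w = bC q C *v X t w"
begin

interpretation form: bounded_bilinear form
  by (rule form_bounded_bilinear)

abbreviation out :: "'k \<Rightarrow> real^('p \<times> 'k)"
  where "out v \<equiv> (bC q C :: real^('p \<times> 'k)^'k) $ v"

text \<open>\<open>lead v \<bullet> X t\<close> will turn out to be the highest mean-square
  derivative of component \<open>v\<close> of \<open>Y\<close>.\<close>

abbreviation lead :: "'k \<Rightarrow> real^('p \<times> 'k)"
  where "lead v \<equiv> (sC q C :: real^('p \<times> 'k)^'k) $ v"

lemma Y_nth: "w \<in> space M \<Longrightarrow> Y r w $ v = out v \<bullet> X r w"
  by (simp add: Y_state matrix_vector_mul_component)

lemma comp_proc_state: "w \<in> space M \<Longrightarrow> comp_proc Y v r w = cstate (out v) r w"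
  by (simp add: comp_proc_def cstate_def Y_nth)

sublocale L2_process M Y
proof
  show "square_integrable M (comp_proc Y v r)" for v r
    by (rule L2_AE_cong[OF cstate_L2[of "out v" r]])
      (auto simp: comp_proc_state cong: measurable_cong)
qed

text \<open>The vector \<open>x s\<close> of values of \<phi> on the components of
  \<open>X s\<close> is differentiable in all noise-free directions, since \<phi> turns mean-square
  limits into ordinary ones. Vanishing outputs confine it to the kernel of \<open>sC\<close>, where
  it solves an ODE on the whole past; detectability and boundedness then force it to be 0.\<close>

lemma functional_vanishes:
  fixes \<phi> :: "('w \<Rightarrow> real) \<Rightarrow> real"
  assumes lin: "\<And>y z c. square_integrable M y \<Longrightarrow> square_integrable M z \<Longrightarrow>
      \<phi> (\<lambda>w. y w + c * z w) = \<phi> y + c * \<phi> z"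
    and bdd: "\<And>y. square_integrable M y \<Longrightarrow> (\<phi> y)\<^sup>2 \<le> K * (LINT w|M. (y w)\<^sup>2)"
    and kill: "\<And>v r. r \<le> t \<Longrightarrow> \<phi> (\<lambda>w. out v \<bullet> X r w) = 0"
  shows "\<phi> (\<lambda>w. X t w $ i) = 0"
proof -
  define x where "x s = (\<chi> i. \<phi> (\<lambda>w. X s w $ i))" for s
  have zero: "\<phi> (\<lambda>_. 0) = 0"
    using lin[of "\<lambda>_. 0" "\<lambda>_. 0" 1] by simp
  have sum: "\<phi> (\<lambda>w. \<Sum>i\<in>I. c i * X s w $ i) = (\<Sum>i\<in>I. c i * x s $ i)" for I c s
  proof (induction I rule: infinite_finite_induct)
    case (insert j I)
    have "\<phi> (\<lambda>w. \<Sum>i\<in>insert j I. c i * X s w $ i) = \<phi> (\<lambda>w. (\<Sum>i\<in>I. c i * X s w $ i) + c j * X s w $ j)"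
      using insert by (simp add: add.commute)
    also have "\<dots> = (\<Sum>i\<in>I. c i * x s $ i) + c j * x s $ j"
      by (subst lin) (auto simp: insert.IH x_def intro!: L2_sum L2_mult_left state_nth_L2)
    finally show ?case using insert by (simp add: add.commute)
  qed (simp_all add: zero)
  have inner: "\<phi> (\<lambda>w. c \<bullet> X s w) = c \<bullet> x s" for c s
    using sum[of "\<lambda>i. c $ i" s UNIV] by (simp add: inner_vec_def)
  have abs_le: "\<bar>\<phi> y\<bar> \<le> sqrt (K * (LINT w|M. (y w)\<^sup>2))" if "square_integrable M y" for y
    using real_sqrt_le_mono[OF bdd[OF that]] by simp
  \<comment> \<open>\<open>Q h\<close> is the error of the difference quotient. It tends to 0 in
    mean square, so boundedness of \<phi> makes \<phi> of it tend to 0 as well.\<close>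
  have D: "((\<lambda>s. c \<bullet> x s) has_real_derivative (transpose (bA A) *v c) \<bullet> x s) (at s)"
    if c: "c v* bB = (0 :: real^'k)" for c s
  proof -
    define Q where "Q h w = (c \<bullet> X (s + h) w - c \<bullet> X s w) / h - (transpose (bA A) *v c) \<bullet> X s w" for h w
    have "\<phi> (Q h) = (c \<bullet> x (s + h) - c \<bullet> x s) / h - (transpose (bA A) *v c) \<bullet> x s" for h
    proof -
      have "Q h = (\<lambda>w. ((0 + (1 / h) * (c \<bullet> X (s + h) w)) + (- (1 / h)) * (c \<bullet> X s w))
          + (- 1) * ((transpose (bA A) *v c) \<bullet> X s w))"
        by (simp add: Q_def fun_eq_iff diff_divide_distrib)
      then have "\<phi> (Q h) = 0 + (1 / h) * (c \<bullet> x (s + h)) + (- (1 / h)) * (c \<bullet> x s)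
          + (- 1) * ((transpose (bA A) *v c) \<bullet> x s)"
        by (simp only: lin L2_add L2_mult_left L2_zero
            state_L2 inner zero)
      then show ?thesis by (simp add: diff_divide_distrib)
    qed
    moreover have "((\<lambda>h. \<phi> (Q h)) \<longlongrightarrow> 0) (at 0)"
    proof (rule Lim_null_comparison)
      have "((\<lambda>h. sqrt (K * (LINT w|M. (Q h w)\<^sup>2))) \<longlongrightarrow> sqrt (K * 0)) (at 0)"
        unfolding Q_def by (intro tendsto_intros state_quotient_tendsto[OF c])
      then show "((\<lambda>h. sqrt (K * (LINT w|M. (Q h w)\<^sup>2))) \<longlongrightarrow> 0) (at 0)" by simp
      have "square_integrable M (Q h)" for h
        unfolding Q_def by (rule state_quotient_L2)
      then show "\<forall>\<^sub>F h in at 0. norm (\<phi> (Q h)) \<le> sqrt (K * (LINT w|M. (Q h w)\<^sup>2))"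
        using abs_le by simp
    qed
    ultimately show ?thesis
      unfolding DERIV_def by (simp add: LIM_zero_iff)
  qed
  \<comment> \<open>A function that vanishes up to \<open>t\<close> has vanishing derivatives there,
    one-sided at \<open>t\<close> itself. Passing from \<open>m\<close> to \<open>Suc m\<close>
    requires \<open>tpow m (out v)\<close> to be noise-free, which holds for
    \<open>m < p - 1 - q\<close>.\<close>
  have pow: "(tpow m (out v)) \<bullet> x s = 0" if "m \<le> CARD('p) - 1 - q" "s \<le> t" for m v s
    using that
  proof (induction m arbitrary: s)
    case 0
    then show ?case using kill[of s v] by (simp add: inner)
  next
    case (Suc m)
    let ?c = "tpow m (out v)"
    have "?c v* bB = (0 :: real^'k)"
      by (rule row_bC_shift_bB) (use Suc.prems q_less in auto)
    from D[OF this, of s]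
    have "((\<lambda>s. ?c \<bullet> x s) has_vector_derivative (transpose (bA A) *v ?c) \<bullet> x s) (at s within {..t})"
      unfolding has_real_derivative_iff_has_vector_derivative by (rule has_vector_derivative_at_within)
    moreover have "((\<lambda>s. ?c \<bullet> x s) has_vector_derivative 0) (at s within {..t})"
      by (rule has_vector_derivative_transform[OF _ _ has_vector_derivative_const[of 0]])
        (use Suc in auto)
    ultimately have "(transpose (bA A) *v ?c) \<bullet> x s = 0"
      using vector_derivative_unique_within[OF at_within_atMost_neq_bot[OF Suc.prems(2)]] by blast
    then show ?case by (simp only: mat_pow.simps matrix_vector_mul_assoc)
  qed
  have bC_zero: "bC q C *v x s = 0" if "s \<le> t" for s
    using pow[of 0 s] that by (simp add: vec_eq_iff matrix_vector_mul_component)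
  have sC_zero: "sC q C *v x s = 0" if "s \<le> t" for s
    using pow[of "CARD('p) - 1 - q" s] that
    by (simp only: row_sC[OF q_less] order.refl vec_eq_iff matrix_vector_mul_component zero_index simp_thms)
  let ?F = "noise_free q C :: real^('p \<times> 'k)^('p \<times> 'k)"
  have deriv: "(x has_vector_derivative (?F ** bA A) *v x s) (at s within {..t})" if "s \<le> t" for s
  proof -
    have "((\<lambda>s. x s $ i) has_vector_derivative ((?F ** bA A) *v x s) $ i) (at s within {..t})" for i
    proof (rule has_vector_derivative_transform)
      show "s \<in> {..t}" using that by simp
      \<comment> \<open>A coordinate of \<open>x\<close> need not be a noise-free direction. On the
        kernel of \<open>sC\<close> it equals the pairing with row \<open>i\<close> of the
        projection, which is noise-free and can be differentiated.\<close>
      show "x r $ i = ?F $ i \<bullet> x r" if "r \<in> {..t}" for r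
      proof -
        have "?F *v x r = x r" using that by (intro noise_free_fixes sC_zero) simp
        then show ?thesis using matrix_vector_mul_component[of ?F "x r" i] by simp
      qed
      have "?F $ i v* bB = (0 :: real^'k)"
        unfolding row_matrix_mult[symmetric] noise_free_bB[where C = C, OF q_less Cq_invertible] by simp
      from D[OF this, of s]
      have "((\<lambda>s. ?F $ i \<bullet> x s) has_vector_derivative (?F $ i v* bA A) \<bullet> x s) (at s within {..t})"
        unfolding has_real_derivative_iff_has_vector_derivative transpose_matrix_vector
        by (rule has_vector_derivative_at_within)
      then show "((\<lambda>s. ?F $ i \<bullet> x s) has_vector_derivative ((?F ** bA A) *v x s) $ i) (at s within {..t})"
        by (simp add: matrix_vector_mul_component row_matrix_mult)
    qed
    then show ?thesis by (rule has_vector_derivative_componentwise)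
  qed
  have "x t = 0"
  \<comment> \<open>The bound combines the constant of \<phi> with the second moment of each
    component of \<open>X s\<close>, which by stationarity does not depend on
    \<open>s\<close>.\<close>
  proof (rule bounded_backward_solution_zero[of t x "?F ** bA A" "\<Sum>i\<in>UNIV. sqrt (K * scov (axis i 1) (axis i 1))" "bC q C"])
    fix s
    have "\<bar>x s $ i\<bar> \<le> sqrt (K * scov (axis i 1) (axis i 1))" for i
      using abs_le[OF state_nth_L2[of s i]] state_cov[of s s "axis i 1" "axis i 1"]
      by (simp add: x_def inner_axis' power2_eq_square)
    then show "norm (x s) \<le> (\<Sum>i\<in>UNIV. sqrt (K * scov (axis i 1) (axis i 1)))"
      by (intro order.trans[OF norm_le_l1_cart] sum_mono) simp
  next
    fix z v assume "0 \<le> Re z" "cmat (?F ** bA A) *v v = z *s v" "cmat (bC q C) *v v = 0"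
    then show "v = 0" using noise_free_observable[OF q_less Q_stable] by blast
  qed (use deriv bC_zero in auto)
  then have "x t $ i = 0" by simp
  then show ?thesis by (simp add: x_def)
qed

end


section \<open>Residuals as noise terms and the conditions in matrix form\<close>

context iccss
begin

interpretation form: bounded_bilinear form
  by (rule form_bounded_bilinear)

abbreviation (input) "\<AA> \<equiv> (bA A :: real^('p \<times> 'k)^('p \<times> 'k))"
abbreviation (input) "\<BB> \<equiv> (bB :: real^'k^('p \<times> 'k))"
abbreviation (input) "\<CC> \<equiv> (bC q C :: real^('p \<times> 'k)^'k)"
abbreviation (input) "\<C> \<equiv> (sC q C :: real^('p \<times> 'k)^'k)"

lemma cstate_axis_in_past: "cstate (axis i 1) t \<in> past M Y t"
proof -
  \<comment> \<open>The closure criterion is real while the linear past is complex. Real elements of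
    the past suffice because the target is real-valued.\<close>
  define S where "S = {U. square_integrable M U \<and> (\<lambda>w. complex_of_real (U w)) \<in> lin_past Y t}"
  have "\<exists>U. (\<forall>n::nat. U n \<in> S) \<and> L2_tendsto M U (\<lambda>w. X t w $ i) sequentially"
  proof (rule L2_closure_criterion)
    show "square_integrable M U" if "U \<in> S" for U using that by (simp add: S_def)
    show "(\<lambda>_. 0) \<in> S" by (simp add: S_def lin_past_zero)
    show "(\<lambda>w. U w + c * V w) \<in> S" if "U \<in> S" "V \<in> S" for U V c
      using that lin_past_lincomb[of "\<lambda>w. complex_of_real (U w)" Y t "\<lambda>w. complex_of_real (V w)" "complex_of_real c"]
      by (simp add: S_def L2_add L2_mult_left)
    show "square_integrable M (\<lambda>w. X t w $ i)" by (rule state_nth_L2)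
  next
    fix \<phi> :: "('w \<Rightarrow> real) \<Rightarrow> real" and K
    assume lin: "\<And>y z c. square_integrable M y \<Longrightarrow> square_integrable M z \<Longrightarrow>
        \<phi> (\<lambda>w. y w + c * z w) = \<phi> y + c * \<phi> z"
      and bdd: "\<And>y. square_integrable M y \<Longrightarrow> (\<phi> y)\<^sup>2 \<le> K * (LINT w|M. (y w)\<^sup>2)"
      and kill: "\<And>U. U \<in> S \<Longrightarrow> \<phi> U = 0"
    show "\<phi> (\<lambda>w. X t w $ i) = 0"
    proof (rule functional_vanishes[OF lin bdd])
      fix v r assume "r \<le> t"
      let ?y = "\<lambda>w. Y r w $ v" and ?z = "\<lambda>w. out v \<bullet> X r w"
      have y_L2: "square_integrable M ?y"
        using comp_proc_L2[of v r] unfolding comp_proc_def[abs_def] L2_of_real_iff .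
      have "?y \<in> S"
        using lin_past_base[OF \<open>r \<le> t\<close>, of Y v] y_L2 by (simp add: S_def comp_proc_def[abs_def])
      then have "\<phi> ?y = 0" by (rule kill)
      \<comment> \<open>The functional acts on functions, and \<open>?y\<close> and
        \<open>?z\<close> coincide only on \<open>space M\<close>. Their difference has norm 0, so
        boundedness gives \<phi> the same value on both.\<close>
      moreover have "(\<phi> (\<lambda>w. ?y w + (- 1) * ?z w))\<^sup>2 \<le> K * (LINT w|M. (?y w + (- 1) * ?z w)\<^sup>2)"
        using L2_diff[OF y_L2 state_L2[of "out v" r]] by (intro bdd) simp
      moreover have "(LINT w|M. (?y w + (- 1) * ?z w)\<^sup>2) = (LINT w|M. 0)"
        by (rule Bochner_Integration.integral_cong[OF refl]) (simp add: Y_nth)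
      ultimately show "\<phi> ?z = 0"
        using lin[OF y_L2 state_L2[of "out v" r], of "-1"] by simp
    qed
  qed
  then obtain U where U: "\<And>n::nat. U n \<in> S" "L2_tendsto M U (\<lambda>w. X t w $ i) sequentially"
    by blast
  have "L2_tendsto M (\<lambda>n w. complex_of_real (U n w)) (cstate (axis i 1) t) sequentially"
    by (rule L2_tendsto_bound[OF U(2)]) (simp add: cstate_def inner_axis' flip: of_real_diff)
  moreover have "(\<lambda>w. complex_of_real (U n w)) \<in> lin_past Y t" for n
    using U(1)[of n] by (simp add: S_def)
  ultimately show ?thesis
    unfolding past_def
    by (intro CollectI conjI exI[of _ "\<lambda>n w. complex_of_real (U n w)"] allI cstate_L2)
qed

lemma cstate_in_past: "cstate y t \<in> past M Y t"
proof -
  have "(\<lambda>w. \<Sum>i\<in>I. complex_of_real (y $ i) * cstate (axis i 1) t w) \<in> past M Y t" for I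
  proof (induction I rule: infinite_finite_induct)
    case (insert j I)
    have "(\<lambda>w. (\<Sum>i\<in>I. complex_of_real (y $ i) * cstate (axis i 1) t w) + complex_of_real (y $ j) * cstate (axis j 1) t w) \<in> past M Y t"
      by (rule past_lincomb[OF insert.IH cstate_axis_in_past])
    then show ?case using insert by (simp add: add.commute)
  qed (simp_all add: past_zero)
  from this[of UNIV] show ?thesis
    by (simp add: cstate_def[abs_def] inner_axis' inner_vec_def[of y])
qed

text \<open>The projection is guessed as \<open>cstate (flow h x) t\<close>: it lies in the past,
  and what it leaves over is noise, orthogonal to the past. Agreement of \<open>Z\<close> with the
  state is required only almost surely, so that arbitrary versions of derivatives are
  covered.\<close>

lemma resid_state:
  assumes Z: "Z \<in> borel_measurable M" "AE w in M. Z w = cstate x (t + h) w" and "0 \<le> h"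
  shows "AE w in M. resid M Y t Z w = complex_of_real (noise x t h w)"
    and "resid M Y t Z \<in> borel_measurable M"
proof -
  have Z_L2: "square_integrable M Z"
    by (rule L2_AE_cong[OF cstate_L2[of x "t + h"] Z])
  have diff: "AE w in M. Z w - cstate (flow h x) t w = complex_of_real (noise x t h w)"
    using Z(2) by eventually_elim (simp add: cstate_def noise_def)
  have noise_meas [measurable]: "noise x t h \<in> borel_measurable M"
    by (rule L2_measurable[OF noise_L2])
  have state_meas [measurable]: "(\<lambda>w. y \<bullet> X r w) \<in> borel_measurable M" for y r
    by (rule L2_measurable[OF state_L2])
  note [measurable] = Z(1) L2_measurable[OF comp_proc_L2]
  have orth: "(LINT w|M. (Z w - cstate (flow h x) t w) * cnj (comp_proc Y v r w)) = 0" if "r \<le> t" for v r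
  proof -
    have "(LINT w|M. (Z w - cstate (flow h x) t w) * cnj (comp_proc Y v r w)) =
        (LINT w|M. complex_of_real (noise x t h w * (out v \<bullet> X r w)))"
    proof (rule integral_cong_AE)
      show "AE w in M. (Z w - cstate (flow h x) t w) * cnj (comp_proc Y v r w) =
          complex_of_real (noise x t h w * (out v \<bullet> X r w))"
        using diff AE_space by eventually_elim (simp add: comp_proc_state, simp add: cstate_def)
      have "square_integrable M (\<lambda>w. Z w - cstate (flow h x) t w)"
        by (rule L2_diff[OF Z_L2 cstate_L2])
      from L2_times[OF this L2_cnj[OF comp_proc_L2]]
      show "(\<lambda>w. (Z w - cstate (flow h x) t w) * cnj (comp_proc Y v r w)) \<in> borel_measurable M"
        by (rule borel_measurable_integrable)
    qed measurable
    then show ?thesis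
      using noise_orthogonal[OF \<open>0 \<le> h\<close> that, of x "out v"] by (simp only: integral_complex_of_real) simp
  qed
  have "AE w in M. resid M Y t Z w = Z w - cstate (flow h x) t w"
    by (rule resid_eq(1)[OF Z_L2 cstate_in_past]) (rule orth)
  then show "AE w in M. resid M Y t Z w = complex_of_real (noise x t h w)"
    using diff by eventually_elim simp
  show "resid M Y t Z \<in> borel_measurable M"
    by (rule resid_eq(2)[OF Z_L2 cstate_in_past]) (rule orth)
qed

lemma resid_cov:
  assumes "Z \<in> borel_measurable M" "AE w in M. Z w = cstate x (t + h) w" "0 \<le> h"
    and "Z' \<in> borel_measurable M" "AE w in M. Z' w = cstate y (t + h') w" "0 \<le> h'"
  shows "(LINT w|M. resid M Y t Z w * cnj (resid M Y t Z' w)) =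
    complex_of_real (LINT w|M. noise x t h w * noise y t h' w)"
proof -
  note r = resid_state[OF assms(1-3)] and r' = resid_state[OF assms(4-6)]
  have [measurable]: "noise x t h \<in> borel_measurable M" for x h
    by (rule L2_measurable[OF noise_L2])
  have "(\<lambda>w. cnj (resid M Y t Z' w)) \<in> borel_measurable M"
    by (rule measurable_compose[OF r'(2) borel_measurable_continuous_onI]) (intro continuous_intros)
  note [measurable] = r(2) this
  have "(LINT w|M. resid M Y t Z w * cnj (resid M Y t Z' w)) =
      (LINT w|M. complex_of_real (noise x t h w * noise y t h' w))"
  proof (rule integral_cong_AE)
    show "AE w in M. resid M Y t Z w * cnj (resid M Y t Z' w) = complex_of_real (noise x t h w * noise y t h' w)"
      using r(1) r'(1) by eventually_elim simp
  qed measurable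
  then show ?thesis by (simp only: integral_complex_of_real)
qed

lemma contemp_uncorrelated_iff:
  "contemp_uncorrelated M Y a b \<longleftrightarrow> (\<forall>h h'. 0 \<le> h \<and> h \<le> 1 \<and> 0 \<le> h' \<and> h' \<le> 1 \<longrightarrow>
    integral {0..min h h'} (\<lambda>s. form (flow (h - s) (out a)) (flow (h' - s) (out b))) = 0)"
proof -
  have "(LINT w|M. resid M Y t (comp_proc Y a (t + h)) w * cnj (resid M Y t (comp_proc Y b (t + h')) w)) =
      complex_of_real (integral {0..min h h'} (\<lambda>s. form (flow (h - s) (out a)) (flow (h' - s) (out b))))"
    if "0 \<le> h" "0 \<le> h'" for t h h'
    unfolding noise_cov[OF that, where t = t, symmetric]
    by (rule resid_cov) (use that in \<open>auto intro: L2_measurable[OF comp_proc_L2] simp: comp_proc_state\<close>)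
  then show ?thesis
    unfolding contemp_uncorrelated_def by auto
qed

lemma form_entry:
  "axis a 1 \<bullet> ((Z ** bB ** \<Sigma> ** transpose bB ** V) *v axis b 1) = form (Z $ a) (V *v axis b 1)"
  for Z :: "real^('p \<times> 'k)^'k"
  unfolding form_def inner_axis' matrix_vector_mul_assoc[symmetric]
  by (simp add: matrix_vector_mul_component row_matrix_mult dot_lmul_matrix)

lemma out_column: "(V ** transpose (bC q C :: real^('p \<times> 'k)^'k)) *v axis b 1 = V *v out b"
  unfolding matrix_vector_mul_assoc[symmetric] transpose_matrix_vector row_mult ..

lemma out_flow: "(bC q C ** mat_exp (u *\<^sub>R bA A)) $ a = flow u (out a)"
  unfolding row_matrix_mult flow_def mat_exp_transpose transpose_matrix_vector ..

lemma out_pow: "(bC q C ** mat_pow (bA A) n) $ a = tpow n (out a)"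
  unfolding row_matrix_mult mat_pow_transpose transpose_matrix_vector ..

lemma integral_matrix_entry:
  "axis a 1 \<bullet> (integral {0..min h h'}
      (\<lambda>s. \<CC> ** mat_exp ((h - s) *\<^sub>R \<AA>) ** \<BB> ** \<Sigma> ** transpose \<BB> **
        mat_exp ((h' - s) *\<^sub>R transpose \<AA>) ** transpose \<CC>) *v axis b 1) =
    integral {0..min h h'} (\<lambda>s. form (flow (h - s) (out a)) (flow (h' - s) (out b)))"
proof -
  define G :: "real \<Rightarrow> real^'k^'k" where "G s = \<CC> ** mat_exp ((h - s) *\<^sub>R \<AA>) ** \<BB> ** \<Sigma> ** transpose \<BB> **
        mat_exp ((h' - s) *\<^sub>R transpose \<AA>) ** transpose \<CC>" for s
  have entry: "axis i 1 \<bullet> (W *v axis j 1) = W $ i $ j" for W :: "real^'k^'k" and i j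
    by (simp add: inner_axis' matrix_vector_mul_component inner_axis)
  have G: "G s $ i $ j = form (flow (h - s) (out i)) (flow (h' - s) (out j))" for s i j
    unfolding entry[symmetric] G_def
    unfolding matrix_mul_assoc[of _ "mat_exp ((h' - s) *\<^sub>R transpose \<AA>)", symmetric] form_entry out_column
      out_flow flow_def[of "h' - s", symmetric] ..
  have cont: "continuous_on {0..min h h'} (\<lambda>s. G s $ i $ j)" for i j
    unfolding G by (intro form_flow_continuous continuous_intros)
  have "continuous_on {0..min h h'} (\<lambda>s. \<chi> i j. G s $ i $ j)"
    by (intro continuous_on_vec_lambda cont)
  then have "G integrable_on {0..min h h'}"
    by (intro integrable_continuous_interval) simp
  moreover from this have "(\<lambda>s. G s $ a) integrable_on {0..min h h'}"
    using integrable_linear[OF _ bounded_linear_vec_nth[of a]] by (simp add: comp_def)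
  ultimately have "integral {0..min h h'} G $ a $ b = integral {0..min h h'} (\<lambda>s. G s $ a $ b)"
    using integral_linear[OF _ bounded_linear_vec_nth[of a], of G "{0..min h h'}"]
      integral_linear[OF _ bounded_linear_vec_nth[of b], of "\<lambda>s. G s $ a" "{0..min h h'}"]
    by (simp add: comp_def)
  then show ?thesis
    unfolding G_def[symmetric] entry by (simp only: G)
qed

lemma pow_matrix_entry:
  "axis a 1 \<bullet> ((\<CC> ** mat_pow \<AA> \<alpha> ** \<BB> ** \<Sigma> ** transpose \<BB> **
      mat_pow (transpose \<AA>) \<beta> ** transpose \<CC>) *v axis b 1) =
    form (tpow \<alpha> (out a)) (tpow \<beta> (out b))"
  unfolding matrix_mul_assoc[of _ "mat_pow (transpose \<AA>) \<beta>", symmetric] form_entry out_column out_pow ..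

lemma sC_matrix_entry:
  "axis a 1 \<bullet> ((\<C> ** \<BB> ** \<Sigma> ** transpose \<BB> **
      transpose \<C>) *v axis b 1) = form (lead a) (lead b)"
  unfolding form_entry transpose_matrix_vector row_mult ..

lemma sC_bB_product:
  "\<C> ** \<BB> ** \<Sigma> ** transpose \<BB> ** transpose \<C> =
    C q ** \<Sigma> ** transpose (C q)"
  unfolding sC_bB[OF q_less] matrix_mul_assoc[of _ "transpose \<BB>" "transpose (\<C>)", symmetric]
    matrix_transpose_mul[symmetric] ..

text \<open>The noise enters \<open>lead v\<close> through row \<open>v\<close> of
  \<open>C q\<close>. That row is nonzero as \<open>C q\<close> is invertible, so positive
  definiteness makes \<open>form (lead v) (lead v)\<close> positive; hence every component has the
  same order \<open>p - 1 - q\<close>.\<close>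

lemma top_deriv_state:
  assumes "pos_def (\<Sigma>)"
  shows "AE w in M. top_deriv M Y v t w = cstate (lead v) t w"
    and "top_deriv M Y v t \<in> borel_measurable M"
proof -
  have row: "lead v v* (bB :: real^'k^('p \<times> 'k)) = C q $ v"
    unfolding row_matrix_mult[symmetric] sC_bB[OF q_less] ..
  have "C q $ v \<noteq> 0"
  proof
    assume "C q $ v = 0"
    then have "(C q ** matrix_inv (C q)) $ v = 0" by (simp add: row_matrix_mult)
    moreover have "C q ** matrix_inv (C q) = mat 1"
      using matrix_inv_left[OF Cq_invertible] matrix_left_right_inverse by blast
    ultimately have "(mat 1 :: real^'k^'k) $ v $ v = 0" by simp
    then show False by (simp add: mat_def)
  qed
  then have pos: "0 < form (lead v) (lead v)"
    using assms by (simp add: form_def row pos_def_def)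
  have B: "(tpow i (out v)) v* bB = (0 :: real^'k)" if "i < CARD('p) - 1 - q" for i
    by (rule row_bC_shift_bB[OF q_less that])
  have pos': "0 < form (tpow (CARD('p) - 1 - q) (out v))
      (tpow (CARD('p) - 1 - q) (out v))"
    unfolding row_sC[OF q_less] by (rule pos)
  have order: "ms_order M (comp_proc Y v) = CARD('p) - 1 - q"
    by (rule ms_order_state(1)[OF comp_proc_state B pos'])
  show "AE w in M. top_deriv M Y v t w = cstate (lead v) t w"
    unfolding top_deriv_def order row_sC[OF q_less, where A = A, symmetric]
    by (rule ms_order_state(2)[OF comp_proc_state B pos'])
  show "top_deriv M Y v t \<in> borel_measurable M"
    unfolding top_deriv_def order
    by (rule ms_order_state(3)[OF comp_proc_state B pos'])
qed

text \<open>The limit always exists, at every \<open>t\<close>, and equals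
  \<open>form (lead a) (lead b)\<close>; both directions follow from its uniqueness.\<close>

lemma locally_contemp_uncorrelated_iff:
  assumes "pos_def (\<Sigma>)"
  shows "locally_contemp_uncorrelated M Y a b \<longleftrightarrow> form (lead a) (lead b) = 0"
proof -
  let ?R = "\<lambda>t h. (LINT w|M. resid M Y t (top_deriv M Y a (t + h)) w * cnj (resid M Y t (top_deriv M Y b (t + h)) w))
      / complex_of_real h"
  have lim: "(?R t \<longlongrightarrow> complex_of_real (form (lead a) (lead b))) (at_right 0)" for t
  proof (rule Lim_transform_eventually)
    show "((\<lambda>h. complex_of_real ((LINT w|M. noise (lead a) t h w * noise (lead b) t h w) / h)) \<longlongrightarrow>
        complex_of_real (form (lead a) (lead b))) (at_right 0)"
      by (intro tendsto_of_real noise_cov_quotient)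
    have "complex_of_real ((LINT w|M. noise (lead a) t h w * noise (lead b) t h w) / h) = ?R t h" if "0 < h" for h
    proof -
      have "(LINT w|M. resid M Y t (top_deriv M Y a (t + h)) w * cnj (resid M Y t (top_deriv M Y b (t + h)) w)) =
          complex_of_real (LINT w|M. noise (lead a) t h w * noise (lead b) t h w)"
        by (rule resid_cov) (use that in \<open>auto intro: top_deriv_state[OF assms]\<close>)
      then show ?thesis by simp
    qed
    then show "\<forall>\<^sub>F h in at_right 0. complex_of_real ((LINT w|M. noise (lead a) t h w * noise (lead b) t h w) / h) = ?R t h"
      by (auto simp: eventually_at_filter)
  qed
  show ?thesis
  proof
    assume "locally_contemp_uncorrelated M Y a b"
    then have "(?R 0 \<longlongrightarrow> 0) (at_right 0)"
      unfolding locally_contemp_uncorrelated_def by (rule spec)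
    from tendsto_unique[OF _ lim this] show "form (lead a) (lead b) = 0" by simp
  next
    assume "form (lead a) (lead b) = 0"
    then show "locally_contemp_uncorrelated M Y a b"
      unfolding locally_contemp_uncorrelated_def using lim by simp
  qed
qed

end


theorem proposition4p6:
  fixes M :: "'w measure"
    and L Y :: "real \<Rightarrow> 'w \<Rightarrow> real^'k"
    and X :: "real \<Rightarrow> 'w \<Rightarrow> real^('p::{finite, linorder} \<times> 'k)"
    and A C :: "nat \<Rightarrow> real^'k^'k"
    and \<Sigma> :: "real^'k^'k"
    and p q :: nat
    and a b :: 'k
  defines "\<AA> \<equiv> (bA A :: real^('p \<times> 'k)^('p \<times> 'k))"
    and "\<BB> \<equiv> (bB :: real^'k^('p \<times> 'k))"
    and "\<CC> \<equiv> (bC q C :: real^('p \<times> 'k)^'k)"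
    and "\<C> \<equiv> (sC q C :: real^('p \<times> 'k)^'k)"
    and "\<Sigma> \<equiv> second_moment M (L 1)"
  assumes "ICCSS M L p q A C X Y"
    and "pos_def \<Sigma>"
    and "a \<noteq> b"
  shows "(contemp_uncorrelated M Y a b \<longleftrightarrow>
            (\<forall>h h'. 0 \<le> h \<and> h \<le> 1 \<and> 0 \<le> h' \<and> h' \<le> 1 \<longrightarrow>
              axis a 1 \<bullet> (integral {0..min h h'}
                (\<lambda>s. \<CC> ** mat_exp ((h - s) *\<^sub>R \<AA>) ** \<BB> ** \<Sigma> ** transpose \<BB> **
                     mat_exp ((h' - s) *\<^sub>R transpose \<AA>) ** transpose \<CC>) *v axis b 1) = 0))
       \<and> (contemp_uncorrelated M Y a b \<longleftrightarrow>
            (\<forall>\<alpha> \<beta>. \<alpha> \<le> CARD('k) * p - 1 \<and> \<beta> \<le> CARD('k) * p - 1 \<longrightarrow>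
              axis a 1 \<bullet> ((\<CC> ** mat_pow \<AA> \<alpha> ** \<BB> ** \<Sigma> ** transpose \<BB> **
                            mat_pow (transpose \<AA>) \<beta> ** transpose \<CC>) *v axis b 1) = 0))
       \<and> axis a 1 \<bullet> ((\<C> ** \<BB> ** \<Sigma> ** transpose \<BB> ** transpose \<C>) *v axis b 1)
           = axis a 1 \<bullet> ((C q ** \<Sigma> ** transpose (C q)) *v axis b 1)
       \<and> (locally_contemp_uncorrelated M Y a b \<longleftrightarrow>
            axis a 1 \<bullet> ((\<C> ** \<BB> ** \<Sigma> ** transpose \<BB> ** transpose \<C>) *v axis b 1) = 0)"
proof -
  note iccss_def' = assms(6)[unfolded ICCSS_def]
  have p: "p = CARD('p)" using iccss_def' by simp
  have "inj ((*v) (C q))" using iccss_def' by (simp add: full_rank_injective)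
  then have inv: "invertible (C q)"
    by (simp add: invertible_left_inverse matrix_left_invertible_injective)
  have "prob_space M" using iccss_def' by simp
  then interpret iccss M L A X Y q C
    unfolding iccss_def iccss_axioms_def levy_state_def levy_state_axioms_def
      centred_levy_def centred_levy_axioms_def
    using iccss_def' inv by simp
  \<comment> \<open>The subtraction in the range of \<alpha> and \<beta> is truncated; it yields the
    strict bound because k p is positive.\<close>
  have "n \<le> N - 1 \<longleftrightarrow> n < N" if "0 < N" for n N :: nat
    using that by arith
  from this[of "CARD('k) * p"]
  have card: "n \<le> CARD('k) * p - 1 \<longleftrightarrow> n < CARD('p \<times> 'k)" for n
    by (simp add: p mult.commute)
  show ?thesis
  proof (intro conjI)
    show "contemp_uncorrelated M Y a b \<longleftrightarrow>
        (\<forall>h h'. 0 \<le> h \<and> h \<le> 1 \<and> 0 \<le> h' \<and> h' \<le> 1 \<longrightarrow>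
          axis a 1 \<bullet> (integral {0..min h h'}
            (\<lambda>s. \<CC> ** mat_exp ((h - s) *\<^sub>R \<AA>) ** \<BB> ** \<Sigma> ** transpose \<BB> **
              mat_exp ((h' - s) *\<^sub>R transpose \<AA>) ** transpose \<CC>) *v axis b 1) = 0)"
      unfolding \<AA>_def \<BB>_def \<CC>_def \<Sigma>_def contemp_uncorrelated_iff integral_matrix_entry ..
    show "contemp_uncorrelated M Y a b \<longleftrightarrow>
        (\<forall>\<alpha> \<beta>. \<alpha> \<le> CARD('k) * p - 1 \<and> \<beta> \<le> CARD('k) * p - 1 \<longrightarrow>
          axis a 1 \<bullet> ((\<CC> ** mat_pow \<AA> \<alpha> ** \<BB> ** \<Sigma> ** transpose \<BB> **
            mat_pow (transpose \<AA>) \<beta> ** transpose \<CC>) *v axis b 1) = 0)"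
      unfolding \<AA>_def \<BB>_def \<CC>_def \<Sigma>_def
        contemp_uncorrelated_iff noise_cov_zero_iff pow_matrix_entry card ..
    show "axis a 1 \<bullet> ((\<C> ** \<BB> ** \<Sigma> ** transpose \<BB> ** transpose \<C>) *v axis b 1) =
        axis a 1 \<bullet> ((C q ** \<Sigma> ** transpose (C q)) *v axis b 1)"
      unfolding \<BB>_def \<C>_def \<Sigma>_def sC_bB_product ..
    show "locally_contemp_uncorrelated M Y a b \<longleftrightarrow>
        axis a 1 \<bullet> ((\<C> ** \<BB> ** \<Sigma> ** transpose \<BB> ** transpose \<C>) *v axis b 1) = 0"
      unfolding \<BB>_def \<C>_def \<Sigma>_def sC_matrix_entry
      by (rule locally_contemp_uncorrelated_iff) (use assms(7) in \<open>simp add: \<Sigma>_def\<close>)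
  qed
qed

end
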